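(* There exists $N_0$ such that for all integers $n \ge N_0$ and every positive integer $t \le \frac{1}{9}(2n-6)-2$, \[ \mathrm{ar}(n,(t+2)K_3) = \binom{t}{2}+t(n-t)+\left\lceil \frac{n-t}{2}\right\rceil \left\lfloor\frac{n-t}{2}\right\rfloor+2 . \]
   Context: For a graph $F$ and integer $s\ge 1$, $sF$ denotes the graph consisting of $s$ vertex-disjoint copies of $F$; $K_3$ is the triangle and $K_n$ the complete graph on $n$ vertices. An edge-colored graph is rainbow if all its edges receive distinct colors. $\mathrm{ar}(n,sF)$ denotes the minimum integer $N$ such that every edge-coloring of $K_n$ using exactly $N$ colors (i.e. every surjective map $E(K_n)\to[N]$) contains a rainbow copy of $sF$. *)

theory Defs
  imports Complex_Main
begin

text \<open>A graph is a pair of a vertex set and a set of edges, an edge being a two-element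
  set of vertices.\<close>

type_synonym 'a graph = "'a set \<times> 'a set set"

abbreviation vertices :: "'a graph \<Rightarrow> 'a set" where "vertices G \<equiv> fst G"
abbreviation edges :: "'a graph \<Rightarrow> 'a set set" where "edges G \<equiv> snd G"

definition complete_graph :: "nat \<Rightarrow> nat graph" where
  "complete_graph n = ({1..n}, {e. e \<subseteq> {1..n} \<and> card e = 2})"

definition disjoint_copies :: "nat \<Rightarrow> 'a graph \<Rightarrow> (nat \<times> 'a) graph" where
  "disjoint_copies s F =
     ({1..s} \<times> vertices F, {Pair i ` e | i e. i \<in> {1..s} \<and> e \<in> edges F})"

definition subgraph :: "'a graph \<Rightarrow> 'a graph \<Rightarrow> bool" where
  "subgraph H G \<longleftrightarrow> vertices H \<subseteq> vertices G \<and> edges H \<subseteq> edges G"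

definition graph_isomorphic :: "'a graph \<Rightarrow> 'b graph \<Rightarrow> bool" where
  "graph_isomorphic G H \<longleftrightarrow>
     (\<exists>f. bij_betw f (vertices G) (vertices H) \<and> edges H = (\<lambda>e. f ` e) ` edges G)"

text \<open>An edge-coloring is a total function on sets of vertices; its values outside the
  edge set of the colored graph play no role.\<close>

definition edge_coloring_onto :: "'a graph \<Rightarrow> nat \<Rightarrow> ('a set \<Rightarrow> nat) \<Rightarrow> bool" where
  "edge_coloring_onto G N c \<longleftrightarrow> c ` edges G = {1..N}"

definition rainbow :: "('a set \<Rightarrow> nat) \<Rightarrow> 'a graph \<Rightarrow> bool" where
  "rainbow c H \<longleftrightarrow> inj_on c (edges H)"

definition has_rainbow_copy :: "'a graph \<Rightarrow> ('a set \<Rightarrow> nat) \<Rightarrow> 'b graph \<Rightarrow> bool" where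
  "has_rainbow_copy G c H \<longleftrightarrow>
     (\<exists>R. subgraph R G \<and> graph_isomorphic H R \<and> rainbow c R)"

text \<open>The minimum ranges over positive \<open>N\<close>: for \<open>n \<ge> 2\<close> there is no coloring with exactly
  zero colors, so \<open>N = 0\<close> would satisfy the condition vacuously. The minimum always exists,
  because every \<open>N\<close> exceeding the number of edges satisfies the condition.\<close>

definition ar :: "nat \<Rightarrow> 'a graph \<Rightarrow> nat" where
  "ar n H = (LEAST N. N \<ge> 1 \<and>
     (\<forall>c. edge_coloring_onto (complete_graph n) N c \<longrightarrow>
            has_rainbow_copy (complete_graph n) c H))"

lemma ar_exists:
  "\<exists>N\<ge>1. \<forall>c. edge_coloring_onto (complete_graph n) N c \<longrightarrow>
            has_rainbow_copy (complete_graph n) c H"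
proof (intro exI conjI allI impI)
  let ?E = "edges (complete_graph n)"
  show "card ?E + 1 \<ge> 1" by simp
  fix c assume "edge_coloring_onto (complete_graph n) (card ?E + 1) c"
  hence "card (c ` ?E) = card ?E + 1" by (simp add: edge_coloring_onto_def)
  moreover have "finite ?E"
    by (rule finite_subset[of _ "Pow {1..n}"]) (auto simp: complete_graph_def)
  hence "card (c ` ?E) \<le> card ?E" by (rule card_image_le)
  ultimately show "has_rainbow_copy (complete_graph n) c H" by simp
qed

end

theory Submission
  imports Defs
begin

text \<open>
  Take a colouring with more colours than claimed, a largest family \<open>\<T>\<close> of disjoint triangles that is
  rainbow as a whole, a graph with one edge of each colour containing it, and a largest matching \<open>M\<close>
  off \<open>\<T>\<close>. Suppose \<open>\<T>\<close> has \<open>p \<le> t + 1\<close> members. If a vertex \<open>a\<close> of a triangle \<open>{a, b, c}\<close> of \<open>\<T>\<close> is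
  adjacent to both ends of many edges of \<open>M\<close>, then \<open>a\<close> can be completed to a triangle in many ways; we
  delete \<open>a\<close> and move \<open>{b, c}\<close> to \<open>M\<close>. Lowering \<open>n\<close> and \<open>t\<close> by one lowers the claimed value by exactly
  \<open>n - 1\<close>, so the excess of edges persists, and local exchanges in the rest still lift to the whole
  graph. First 18 edges count as many, and, if more than one triangle survives this, then 3.

  If the number 18 leaves one triangle, the rest has \<open>\<lfloor>n\<^sup>2/4\<rfloor> + 2\<close> colours, hence two disjoint rainbow triangles,
  and completing the deleted vertices contradicts the choice of \<open>p\<close>. If only the number 3 leaves one
  triangle, the vertices deleted last had too many non-neighbours. If \<open>r \<ge> 2\<close> triangles
  are left and no vertex is rich, the absence of exchanges bounds the number of edges by that of a
  complete bipartite graph with a clique on \<open>2 r + 1\<close> vertices placed inside one side. For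
  \<open>2 n \<ge> 9 r + 15\<close> this is too small.
\<close>

section \<open>Counting adjacencies\<close>

text \<open>Four times the number of edges is compared. For \<open>r\<close> remaining triangles on
  \<open>n\<close> vertices the upper bound is about n^2 + 8 r^2 and the assumed number about n^2 +
  2 r n - r^2; this is where 2 n against 9 r comes from. In the graph with the clique, two triangles
  have 8 adjacencies. The obstacle is pairs with all 9: they must be paid for by missing adjacencies
  to \<open>I\<close> or \<open>M\<close>, or be shown to be rare. Near 2 n = 9 r the linear terms
  decide too: the sharp bound has a slack of 2 r - 7, and one more rich incidence per triangle would
  cost 4 r. Hence the number 3. It is too small when one triangle is left, because completing the
  deleted vertices around two new rainbow triangles may have to avoid 18 edges of \<open>M\<close>.
  Hence two rounds of deletion. Also, two edges above n^2 / 4 do not force two disjoint triangles: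
  in a balanced complete bipartite graph with two added edges that share a vertex, any two triangles
  meet. So a rainbow triangle may need an edge outside the chosen graph, and rainbow families are
  taken in the colouring itself.\<close>

definition ed :: "('a \<Rightarrow> 'a \<Rightarrow> bool) \<Rightarrow> 'a set \<Rightarrow> 'a set \<Rightarrow> int" where
  "ed R X Y = (\<Sum>x\<in>X. \<Sum>y\<in>Y. (if R x y then 1 else 0))"

lemma ed_nonneg: "0 \<le> ed R X Y"
  by (simp add: ed_def sum_nonneg)

lemma ed_empty [simp]: "ed R {} Y = 0" "ed R X {} = 0"
  by (simp_all add: ed_def)

lemma ed_commute: "symp R \<Longrightarrow> ed R X Y = ed R Y X"
  unfolding ed_def by (subst sum.swap) (auto simp: symp_def intro!: sum.cong)

lemma ed_Un_left: "finite X \<Longrightarrow> finite X' \<Longrightarrow> X \<inter> X' = {} \<Longrightarrow> ed R (X \<union> X') Y = ed R X Y + ed R X' Y"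
  by (simp add: ed_def sum.union_disjoint)

lemma ed_Un_right: "finite Y \<Longrightarrow> finite Y' \<Longrightarrow> Y \<inter> Y' = {} \<Longrightarrow> ed R X (Y \<union> Y') = ed R X Y + ed R X Y'"
  by (simp add: ed_def sum.union_disjoint sum.distrib)

lemma ed_Union_left:
  assumes "\<And>X. X \<in> F \<Longrightarrow> finite X" "pairwise disjnt F"
  shows "ed R (\<Union>F) Y = (\<Sum>X\<in>F. ed R X Y)"
  unfolding ed_def using assms
  by (subst sum.Union_disjoint) (auto simp: disjnt_def pairwise_def)

lemma ed_Union_right:
  assumes "\<And>Y. Y \<in> F \<Longrightarrow> finite Y" "pairwise disjnt F"
  shows "ed R X (\<Union>F) = (\<Sum>Y\<in>F. ed R X Y)"
proof -
  have "(\<Sum>y\<in>\<Union>F. g y) = (\<Sum>Y\<in>F. \<Sum>y\<in>Y. g y)" for g :: "'a \<Rightarrow> int"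
    using assms by (subst sum.Union_disjoint) (auto simp: disjnt_def pairwise_def)
  then have "ed R X (\<Union>F) = (\<Sum>x\<in>X. \<Sum>Y\<in>F. \<Sum>y\<in>Y. if R x y then 1 else 0)"
    by (simp add: ed_def)
  also have "\<dots> = (\<Sum>Y\<in>F. ed R X Y)"
    by (subst sum.swap) (simp add: ed_def)
  finally show ?thesis .
qed

lemma ed_split_left: "finite X \<Longrightarrow> ed R X Y = (\<Sum>x\<in>X. ed R {x} Y)"
  by (simp add: ed_def)

lemma ed_split_right: "ed R X Y = (\<Sum>y\<in>Y. ed R X {y})"
  unfolding ed_def by (subst sum.swap) simp

lemma ed_point_left: "finite Y \<Longrightarrow> ed R {x} Y = int (card {y \<in> Y. R x y})"
  by (simp add: ed_def sum.If_cases Int_def)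

lemma ed_point_right: "finite X \<Longrightarrow> ed R X {y} = int (card {x \<in> X. R x y})"
  by (simp add: ed_def) (simp add: sum.If_cases Int_def)

lemma ed_le_card: "finite X \<Longrightarrow> finite Y \<Longrightarrow> ed R X Y \<le> int (card X) * int (card Y)"
proof -
  have "ed R X Y \<le> (\<Sum>x\<in>X. \<Sum>y\<in>Y. 1)"
    unfolding ed_def by (intro sum_mono) auto
  then show ?thesis by simp
qed

lemma ed_compl:
  "finite X \<Longrightarrow> finite Y \<Longrightarrow>
    ed R X Y + int (card {(x, y). x \<in> X \<and> y \<in> Y \<and> \<not> R x y}) = int (card X) * int (card Y)"
proof -
  assume f: "finite X" "finite Y"
  have "int (card {(x, y). x \<in> X \<and> y \<in> Y \<and> \<not> R x y}) = (\<Sum>z\<in>X\<times>Y. if R (fst z) (snd z) then 0 else 1)"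
    using f by (simp add: sum.If_cases) (rule arg_cong[of _ _ card], auto)
  also have "\<dots> = (\<Sum>x\<in>X. \<Sum>y\<in>Y. if R x y then 0 else 1)"
    by (simp add: sum.cartesian_product case_prod_beta)
  finally have "ed R X Y + int (card {(x, y). x \<in> X \<and> y \<in> Y \<and> \<not> R x y})
      = (\<Sum>x\<in>X. \<Sum>y\<in>Y. (if R x y then 1 else 0) + (if R x y then 0 else 1))"
    by (simp add: ed_def sum.distrib)
  also have "\<dots> = (\<Sum>x\<in>X. \<Sum>y\<in>Y. 1)"
    by (intro sum.cong) auto
  finally show ?thesis by simp
qed

text \<open>Every edge is counted in both orders. So \<open>2 * ed R V V\<close>, the quantity
  bounded later, is four times the number of edges.\<close>

lemma ed_edges:
  assumes "finite W" "\<And>e. e \<in> E \<Longrightarrow> card e = 2"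
  shows "ed (\<lambda>x y. {x, y} \<in> E) W W = 2 * int (card {e \<in> E. e \<subseteq> W})"
proof -
  let ?E = "{e \<in> E. e \<subseteq> W}"
  have fE: "finite ?E" using assms(1) by (intro finite_subset[of ?E "Pow W"]) auto
  have two: "card {z \<in> W \<times> W. {fst z, snd z} = e} = 2" if "e \<in> ?E" for e
  proof -
    have "card e = 2" using that assms(2) by simp
    then obtain x y where "e = {x, y}" "x \<noteq> y"
      by (auto simp: card_2_iff)
    with that have xy: "e = {x, y}" "x \<noteq> y" "x \<in> W" "y \<in> W" by auto
    have "{z \<in> W \<times> W. {fst z, snd z} = e} = {(x, y), (y, x)}"
      using xy by (auto simp: doubleton_eq_iff)
    with xy show ?thesis by simp
  qed
  have "ed (\<lambda>x y. {x, y} \<in> E) W W = (\<Sum>z\<in>W\<times>W. if {fst z, snd z} \<in> E then 1 else 0)"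
    by (simp add: ed_def sum.cartesian_product case_prod_beta)
  also have "\<dots> = int (card {z \<in> W \<times> W. {fst z, snd z} \<in> E})"
    using assms(1) by (simp add: sum.If_cases Int_def)
  also have "{z \<in> W \<times> W. {fst z, snd z} \<in> E} = (\<Union>e\<in>?E. {z \<in> W \<times> W. {fst z, snd z} = e})"
    by auto
  also have "card \<dots> = (\<Sum>e\<in>?E. card {z \<in> W \<times> W. {fst z, snd z} = e})"
    using assms(1) fE by (intro card_UN_disjoint) auto
  also have "\<dots> = 2 * card ?E" by (simp add: two)
  finally show ?thesis by simp
qed

section \<open>Disjoint triangles and edges\<close>

definition rich :: "('a \<Rightarrow> 'a \<Rightarrow> bool) \<Rightarrow> 'a \<Rightarrow> 'a set \<Rightarrow> bool" where
  "rich R v e \<longleftrightarrow> (\<forall>x\<in>e. R v x)"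

text \<open>One disjointness condition on \<open>\<T> \<union> M\<close> is enough: the members have
  3 and 2 elements, so no set belongs to both families.\<close>

definition cfg :: "('a \<Rightarrow> 'a \<Rightarrow> bool) \<Rightarrow> 'a set \<Rightarrow> 'a set set \<Rightarrow> 'a set set \<Rightarrow> bool" where
  "cfg R V \<T> M \<longleftrightarrow>
     (\<forall>T\<in>\<T>. T \<subseteq> V \<and> card T = 3 \<and> pairwise R T) \<and>
     (\<forall>e\<in>M. e \<subseteq> V \<and> card e = 2 \<and> pairwise R e) \<and>
     pairwise disjnt (\<T> \<union> M)"

lemma cfgD:
  assumes "cfg R V \<T> M"
  shows "\<And>T. T \<in> \<T> \<Longrightarrow> T \<subseteq> V" "\<And>T. T \<in> \<T> \<Longrightarrow> card T = 3" "\<And>T. T \<in> \<T> \<Longrightarrow> pairwise R T"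
    "\<And>e. e \<in> M \<Longrightarrow> e \<subseteq> V" "\<And>e. e \<in> M \<Longrightarrow> card e = 2" "\<And>e. e \<in> M \<Longrightarrow> pairwise R e"
    "pairwise disjnt (\<T> \<union> M)"
  using assms by (simp_all add: cfg_def)

lemma cfgI:
  assumes "\<And>T. T \<in> \<T> \<Longrightarrow> T \<subseteq> V \<and> card T = 3 \<and> pairwise R T"
    "\<And>e. e \<in> M \<Longrightarrow> e \<subseteq> V \<and> card e = 2 \<and> pairwise R e"
    "pairwise disjnt (\<T> \<union> M)"
  shows "cfg R V \<T> M"
  using assms by (simp add: cfg_def)

lemma cfg_empty: "cfg R V {} {}"
  by (simp add: cfg_def)

lemma cfg_mono:
  assumes "cfg R V \<T> M" "V \<subseteq> W"
  shows "cfg R W \<T> M"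
  by (rule cfgI; use cfgD[OF assms(1)] assms(2) in \<open>meson subset_trans\<close>)

lemma cfg_subset:
  assumes "cfg R V \<T> M" "\<T>' \<subseteq> \<T>" "M' \<subseteq> M"
  shows "cfg R V \<T>' M'"
proof (rule cfgI)
  show "pairwise disjnt (\<T>' \<union> M')"
    by (rule pairwise_subset[OF cfgD(7)[OF assms(1)]]) (use assms(2,3) in blast)
  show "T \<subseteq> V \<and> card T = 3 \<and> pairwise R T" if "T \<in> \<T>'" for T
    using cfgD(1-3)[OF assms(1)] that assms(2) by (simp add: subsetD)
  show "e \<subseteq> V \<and> card e = 2 \<and> pairwise R e" if "e \<in> M'" for e
    using cfgD(4-6)[OF assms(1)] that assms(3) by (simp add: subsetD)
qed

lemma cfg_finite:
  assumes "cfg R V \<T> M" "finite V"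
  shows "finite \<T>" "finite M"
proof -
  have "\<T> \<subseteq> Pow V" "M \<subseteq> Pow V"
    using cfgD(1,4)[OF assms(1)] by auto
  then show "finite \<T>" "finite M"
    using assms(2) finite_subset by (meson finite_Pow_iff)+
qed

lemma cfg_separate:
  assumes "cfg R V \<T> M"
  shows "\<Union>\<T> \<inter> \<Union>M = {}" "\<T> \<inter> M = {}"
proof -
  have ne: "T \<noteq> e" if "T \<in> \<T>" "e \<in> M" for T e
    using assms that by (auto simp: cfg_def)
  then show "\<T> \<inter> M = {}" by auto
  have "disjnt T e" if "T \<in> \<T>" "e \<in> M" for T e
    using ne[OF that] assms that by (auto simp: cfg_def pairwise_def)
  then show "\<Union>\<T> \<inter> \<Union>M = {}" by (fastforce simp: disjnt_def)
qed

lemma cfg_union: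
  assumes "cfg R V \<T> M" "cfg R W \<T>' M'" "V \<inter> W = {}"
  shows "cfg R (V \<union> W) (\<T> \<union> \<T>') (M \<union> M')"
proof -
  have sub: "X \<subseteq> V" if "X \<in> \<T> \<union> M" for X
    using assms(1) that by (auto simp: cfg_def)
  have sub': "X \<subseteq> W" if "X \<in> \<T>' \<union> M'" for X
    using assms(2) that by (auto simp: cfg_def)
  have p: "pairwise disjnt (\<T> \<union> M)" "pairwise disjnt (\<T>' \<union> M')"
    using assms(1,2) by (simp_all add: cfg_def)
  have "disjnt X Y" if "X \<in> \<T> \<union> M" "Y \<in> \<T>' \<union> M'" for X Y
    using sub[OF that(1)] sub'[OF that(2)] assms(3) by (auto simp: disjnt_def)
  then have "pairwise disjnt ((\<T> \<union> M) \<union> (\<T>' \<union> M'))"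
    using p unfolding pairwise_def by (metis Un_iff disjnt_sym)
  moreover have "(\<T> \<union> M) \<union> (\<T>' \<union> M') = (\<T> \<union> \<T>') \<union> (M \<union> M')" by auto
  ultimately have p': "pairwise disjnt ((\<T> \<union> \<T>') \<union> (M \<union> M'))" by simp
  have T: "T \<subseteq> V \<union> W \<and> card T = 3 \<and> pairwise R T" if "T \<in> \<T> \<union> \<T>'" for T
    using assms(1,2) that unfolding cfg_def by (elim UnE) (simp_all add: le_supI1 le_supI2)
  have M: "e \<subseteq> V \<union> W \<and> card e = 2 \<and> pairwise R e" if "e \<in> M \<union> M'" for e
    using assms(1,2) that unfolding cfg_def by (elim UnE) (simp_all add: le_supI1 le_supI2)
  show ?thesis unfolding cfg_def using T M p' by simp
qed

lemma cfg_disjoint: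
  assumes "cfg R V \<T> M" "cfg R W \<T>' M'" "V \<inter> W = {}"
  shows "\<T> \<inter> \<T>' = {}" "M \<inter> M' = {}"
proof -
  have "X \<noteq> {} \<and> X \<subseteq> V" if "X \<in> \<T> \<union> M" for X
    using assms(1) that by (auto simp: cfg_def)
  moreover have "X \<subseteq> W" if "X \<in> \<T>' \<union> M'" for X
    using assms(2) that by (auto simp: cfg_def)
  ultimately have "X \<notin> \<T>' \<union> M'" if "X \<in> \<T> \<union> M" for X
    using that assms(3) by (metis inf.boundedI subset_empty)
  then show "\<T> \<inter> \<T>' = {}" "M \<inter> M' = {}" by auto
qed

lemma cfg_triangle:
  assumes "distinct [x, y, z]" "R x y" "R y z" "R x z" "symp R"
  shows "cfg R {x, y, z} {{x, y, z}} {}"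
  using assms sympD[OF assms(5,2)] sympD[OF assms(5,3)] sympD[OF assms(5,4)]
  by (simp add: cfg_def pairwise_insert) auto

lemma cfg_edge:
  assumes "x \<noteq> y" "R x y" "symp R"
  shows "cfg R {x, y} {} {{x, y}}"
  using assms sympD[OF assms(3,2)] by (simp add: cfg_def pairwise_insert)

text \<open>Lists let an exchange be given by naming its vertices: \<open>distinct\<close> of the
  flattened list states all disjointness conditions at once, in a form that simplification can
  decide.\<close>

fun flat3 :: "('a \<times> 'a \<times> 'a) list \<Rightarrow> 'a list" where
  "flat3 [] = []"
| "flat3 ((x, y, z) # ts) = x # y # z # flat3 ts"

fun flat2 :: "('a \<times> 'a) list \<Rightarrow> 'a list" where
  "flat2 [] = []"
| "flat2 ((x, y) # es) = x # y # flat2 es"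

lemma cfg_flat2:
  assumes "symp R" "distinct (flat2 es)" "\<forall>(x, y)\<in>set es. R x y"
  shows "\<exists>M. cfg R (set (flat2 es)) {} M \<and> card M = length es"
  using assms(2,3)
proof (induction es rule: flat2.induct)
  case (2 x y es)
  then obtain M where M: "cfg R (set (flat2 es)) {} M" "card M = length es" by auto
  have e: "cfg R {x, y} {} {{x, y}}" using 2 assms(1) by (intro cfg_edge) auto
  have d: "{x, y} \<inter> set (flat2 es) = {}" using 2 by auto
  have "cfg R ({x, y} \<union> set (flat2 es)) ({} \<union> {}) ({{x, y}} \<union> M)"
    by (rule cfg_union[OF e M(1) d])
  moreover have "{x, y} \<notin> M" using cfg_disjoint(2)[OF e M(1) d] by auto
  then have "card ({{x, y}} \<union> M) = Suc (length es)"
    using M cfg_finite(2)[OF M(1)] by simp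
  ultimately show ?case
    by (intro exI[of _ "{{x, y}} \<union> M"]) (simp add: insert_commute)
next
  case 1
  show ?case using cfg_empty[of R] by (metis card.empty list.size(3))
qed

lemma cfg_flat3:
  assumes "symp R" "distinct (flat3 ts)" "\<forall>(x, y, z)\<in>set ts. R x y \<and> R y z \<and> R x z"
  shows "\<exists>\<T>. cfg R (set (flat3 ts)) \<T> {} \<and> card \<T> = length ts"
  using assms(2,3)
proof (induction ts rule: flat3.induct)
  case (2 x y z ts)
  then obtain \<T> where \<T>: "cfg R (set (flat3 ts)) \<T> {}" "card \<T> = length ts" by auto
  have e: "cfg R {x, y, z} {{x, y, z}} {}" using 2 assms(1) by (intro cfg_triangle) auto
  have d: "{x, y, z} \<inter> set (flat3 ts) = {}" using 2 by auto
  have "cfg R ({x, y, z} \<union> set (flat3 ts)) ({{x, y, z}} \<union> \<T>) ({} \<union> {})"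
    by (rule cfg_union[OF e \<T>(1) d])
  moreover have "{x, y, z} \<notin> \<T>" using cfg_disjoint(1)[OF e \<T>(1) d] by auto
  then have "card ({{x, y, z}} \<union> \<T>) = Suc (length ts)"
    using \<T> cfg_finite(1)[OF \<T>(1)] by simp
  ultimately show ?case
    by (intro exI[of _ "{{x, y, z}} \<union> \<T>"]) (simp add: insert_commute)
next
  case 1
  show ?case using cfg_empty[of R] by (metis card.empty list.size(3))
qed

lemma cfg_flat:
  assumes "symp R" "distinct (flat3 ts @ flat2 es)"
    "\<forall>(x, y, z)\<in>set ts. R x y \<and> R y z \<and> R x z" "\<forall>(x, y)\<in>set es. R x y"
  shows "\<exists>\<T> M. cfg R (set (flat3 ts) \<union> set (flat2 es)) \<T> M \<and> card \<T> = length ts \<and> card M = length es"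
proof -
  obtain \<T> where \<T>: "cfg R (set (flat3 ts)) \<T> {}" "card \<T> = length ts"
    using cfg_flat3[of R ts] assms by auto
  obtain M where M: "cfg R (set (flat2 es)) {} M" "card M = length es"
    using cfg_flat2[of R es] assms by auto
  have "cfg R (set (flat3 ts) \<union> set (flat2 es)) (\<T> \<union> {}) ({} \<union> M)"
    using assms(2) by (intro cfg_union \<T> M) auto
  then show ?thesis using \<T> M by auto
qed

text \<open>An exchange may raise the number of triangles, or keep it and raise the number of edges; \<open>D\<close>
  limits how many edges of \<open>M\<close> it may spend. All exchanges used below spend at most three.\<close>

definition stable :: "nat \<Rightarrow> ('a \<Rightarrow> 'a \<Rightarrow> bool) \<Rightarrow> 'a set \<Rightarrow> 'a set set \<Rightarrow> 'a set set \<Rightarrow> bool" where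
  "stable D R V \<T> M \<longleftrightarrow>
     (\<forall>\<T>' M'. cfg R V \<T>' M' \<longrightarrow> card (M - M') \<le> D \<longrightarrow>
        card \<T>' \<le> card \<T> \<and> (card \<T>' = card \<T> \<longrightarrow> card M' \<le> card M))"

lemma stable_mono: "stable D R V \<T> M \<Longrightarrow> D' \<le> D \<Longrightarrow> stable D' R V \<T> M"
  unfolding stable_def by (meson le_trans)

section \<open>Local exchanges in a stable configuration\<close>

locale stable_cfg =
  fixes R :: "'a \<Rightarrow> 'a \<Rightarrow> bool" and V :: "'a set" and \<T> M :: "'a set set"
  assumes finV: "finite V" and symR: "symp R" and irR: "irreflp R"
    and cfg: "cfg R V \<T> M" and stable: "stable 3 R V \<T> M"
begin

definition I :: "'a set" where "I = V - \<Union>\<T> - \<Union>M"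

lemma sym: "R x y \<Longrightarrow> R y x"
  using symR by (auto simp: symp_def)

lemma irrefl: "R x y \<Longrightarrow> x \<noteq> y"
  using irR by (auto simp: irreflp_def)

lemma finT [simp]: "finite \<T>" and finM [simp]: "finite M"
  using cfg_finite[OF cfg finV] by auto

lemma finI [simp]: "finite I"
  using finV by (simp add: I_def)

lemma T_facts:
  assumes "T \<in> \<T>"
  shows "T \<subseteq> V" "card T = 3" "finite T" "pairwise R T"
  using assms cfg by (auto simp: cfg_def card_ge_0_finite)

lemma M_facts:
  assumes "e \<in> M"
  shows "e \<subseteq> V" "card e = 2" "finite e" "pairwise R e"
  using assms cfg by (auto simp: cfg_def card_ge_0_finite)

lemma disj_TT: "T \<in> \<T> \<Longrightarrow> T' \<in> \<T> \<Longrightarrow> T \<noteq> T' \<Longrightarrow> T \<inter> T' = {}"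
  using cfg by (auto simp: cfg_def pairwise_def disjnt_def)

lemma disj_MM: "e \<in> M \<Longrightarrow> e' \<in> M \<Longrightarrow> e \<noteq> e' \<Longrightarrow> e \<inter> e' = {}"
  using cfg by (auto simp: cfg_def pairwise_def disjnt_def)

lemma disj_TM: "T \<in> \<T> \<Longrightarrow> e \<in> M \<Longrightarrow> T \<inter> e = {}"
  using cfg_separate[OF cfg] by auto

lemma disj_TI: "T \<in> \<T> \<Longrightarrow> T \<inter> I = {}"
  by (auto simp: I_def)

lemma disj_MI: "e \<in> M \<Longrightarrow> e \<inter> I = {}"
  by (auto simp: I_def)

text \<open>The vertices of \<open>\<A>\<close> and \<open>\<B>\<close> are freed and, together with
  \<open>I\<close>, refilled by the listed triangles and edges. The rest of the configuration lies
  on other vertices and is kept, so stability compares only what is given up with what is put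
  back.\<close>

lemma exchange:
  assumes A: "\<A> \<subseteq> \<T>" and B: "\<B> \<subseteq> M" "card \<B> \<le> 3"
    and d: "distinct (flat3 ts @ flat2 es)"
    and R3: "\<forall>(x, y, z)\<in>set ts. R x y \<and> R y z \<and> R x z" and R2: "\<forall>(x, y)\<in>set es. R x y"
    and sub: "set (flat3 ts) \<union> set (flat2 es) \<subseteq> \<Union>\<A> \<union> \<Union>\<B> \<union> I"
  shows "length ts \<le> card \<A>" "length ts = card \<A> \<Longrightarrow> length es \<le> card \<B>"
proof -
  let ?W = "\<Union>\<A> \<union> \<Union>\<B> \<union> I"
  obtain \<T>' M' where c': "cfg R ?W \<T>' M'" and l: "card \<T>' = length ts" "card M' = length es"
  proof -
    from cfg_flat[OF symR d R3 R2] obtain \<T>' M' where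
      "cfg R (set (flat3 ts) \<union> set (flat2 es)) \<T>' M'" "card \<T>' = length ts" "card M' = length es"
      by auto
    with cfg_mono[OF _ sub] that show ?thesis by metis
  qed
  have finA: "finite \<A>" and finB: "finite \<B>" using A B finite_subset finT finM by blast+
  let ?U = "\<Union>(\<T> - \<A>) \<union> \<Union>(M - \<B>)"
  have c0: "cfg R ?U (\<T> - \<A>) (M - \<B>)"
  proof -
    have "cfg R V (\<T> - \<A>) (M - \<B>)" by (rule cfg_subset[OF cfg]) auto
    then show ?thesis unfolding cfg_def by (simp add: Union_upper le_supI1 le_supI2)
  qed
  have dis: "?U \<inter> ?W = {}"
  proof -
    have "X \<inter> Y = {}" if "X \<in> (\<T> - \<A>) \<union> (M - \<B>)" "Y \<in> \<A> \<union> \<B>" for X Y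
      using that A B(1) disj_TT[of X Y] disj_MM[of X Y] disj_TM[of X Y] disj_TM[of Y X] by (auto simp: Int_commute)
    then have "?U \<inter> (\<Union>\<A> \<union> \<Union>\<B>) = {}" by blast
    moreover have "?U \<inter> I = {}" by (auto simp: I_def)
    ultimately show ?thesis by blast
  qed
  have W: "?U \<union> ?W \<subseteq> V"
  proof -
    have "\<Union>\<T> \<subseteq> V" "\<Union>M \<subseteq> V" using T_facts(1) M_facts(1) by blast+
    then show ?thesis using A B(1) unfolding I_def by blast
  qed
  have c: "cfg R V ((\<T> - \<A>) \<union> \<T>') ((M - \<B>) \<union> M')"
    using cfg_mono[OF cfg_union[OF c0 c' dis] W] .
  have finW: "finite ?W" using W finV finite_subset by blast
  have cT: "card ((\<T> - \<A>) \<union> \<T>') = card \<T> - card \<A> + length ts"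
    using cfg_disjoint[OF c0 c' dis] cfg_finite[OF c' finW] A l finA
    by (subst card_Un_disjoint) (auto simp: card_Diff_subset)
  have cM: "card ((M - \<B>) \<union> M') = card M - card \<B> + length es"
    using cfg_disjoint[OF c0 c' dis] cfg_finite[OF c' finW] B l finB
    by (subst card_Un_disjoint) (auto simp: card_Diff_subset)
  have "M - ((M - \<B>) \<union> M') \<subseteq> \<B>" by auto
  then have "card (M - ((M - \<B>) \<union> M')) \<le> 3"
    using card_mono[OF finB] B(2) le_trans by blast
  then have *: "card \<T> - card \<A> + length ts \<le> card \<T>"
     "card \<T> - card \<A> + length ts = card \<T> \<Longrightarrow> card M - card \<B> + length es \<le> card M"
    using stable c unfolding stable_def cT[symmetric] cM[symmetric] by blast+
  have "card \<A> \<le> card \<T>" "card \<B> \<le> card M" using A B by (auto intro: card_mono)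
  with * show "length ts \<le> card \<A>" "length ts = card \<A> \<Longrightarrow> length es \<le> card \<B>" by linarith+
qed

end

context stable_cfg
begin

lemma M_pair:
  assumes "e \<in> M"
  obtains x y where "e = {x, y}" "x \<noteq> y" "R x y" "R y x"
proof -
  obtain x y where "e = {x, y}" "x \<noteq> y"
    using M_facts(2)[OF assms] by (auto simp: card_2_iff)
  then show ?thesis
    using that M_facts(4)[OF assms] by (auto simp: pairwise_def)
qed

lemma T_adj: "T \<in> \<T> \<Longrightarrow> a \<in> T \<Longrightarrow> b \<in> T \<Longrightarrow> a \<noteq> b \<Longrightarrow> R a b"
  using T_facts(4) by (auto simp: pairwise_def)

lemma T_triple:
  assumes "T \<in> \<T>"
  obtains a b c where "T = {a, b, c}" "a \<noteq> b" "b \<noteq> c" "a \<noteq> c"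
  using T_facts(2)[OF assms] by (auto simp: card_3_iff)

lemma T_others:
  assumes "T \<in> \<T>" "a \<in> T"
  obtains b c where "T = {a, b, c}" "b \<noteq> a" "c \<noteq> a" "b \<noteq> c"
proof -
  obtain x y z where "T = {x, y, z}" "x \<noteq> y" "y \<noteq> z" "x \<noteq> z"
    using T_triple[OF assms(1)] .
  with assms(2) that show ?thesis by auto
qed

text \<open>Otherwise \<open>x\<close> and \<open>e\<close> would form an additional triangle, at
  the cost of at most two edges of \<open>M\<close>.\<close>

lemma not_rich:
  assumes "e \<in> M" "x \<in> I \<union> \<Union>M"
  shows "\<not> rich R x e"
proof
  assume r: "rich R x e"
  obtain p q where e: "e = {p, q}" "p \<noteq> q" "R p q" "R q p"
    using M_pair[OF assms(1)] .
  have x: "R x p" "R x q" "x \<noteq> p" "x \<noteq> q"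
    using r e irrefl by (auto simp: rich_def)
  show False
  proof (cases "x \<in> I")
    case True
    show False
      using exchange(1)[of "{}" "{e}" "[(x, p, q)]" "[]"] assms(1) e x True by auto
  next
    case False
    with assms(2) obtain e' where e': "e' \<in> M" "x \<in> e'" by auto
    have "card {e, e'} \<le> 3" by (simp add: card_insert_if)
    then show False
      using exchange(1)[of "{}" "{e, e'}" "[(x, p, q)]" "[]"] assms(1) e x e' by auto
  qed
qed

lemma ed_point_edge:
  assumes "e \<in> M"
  shows "ed R {x} e \<le> 1 + of_bool (rich R x e)"
proof -
  obtain p q where "e = {p, q}" "p \<noteq> q" using M_pair[OF assms] by metis
  then show ?thesis by (auto simp: ed_def rich_def)
qed

lemma ed_MM: "e \<in> M \<Longrightarrow> e' \<in> M \<Longrightarrow> ed R e e' \<le> 2"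
proof -
  assume e: "e \<in> M" "e' \<in> M"
  have "ed R e e' = (\<Sum>x\<in>e. ed R {x} e')"
    using M_facts(3)[OF e(1)] by (rule ed_split_left)
  also have "\<dots> \<le> (\<Sum>x\<in>e. 1)"
  proof (rule sum_mono)
    fix x assume "x \<in> e"
    with e(1) have "\<not> rich R x e'" by (intro not_rich[OF e(2)]) auto
    then show "ed R {x} e' \<le> 1" using ed_point_edge[OF e(2), of x] by simp
  qed
  finally show ?thesis using M_facts(2)[OF e(1)] by simp
qed

lemma ed_IM: "e \<in> M \<Longrightarrow> ed R I e \<le> int (card I)"
proof -
  assume e: "e \<in> M"
  have "ed R I e = (\<Sum>x\<in>I. ed R {x} e)"
    by (rule ed_split_left) simp
  also have "\<dots> \<le> (\<Sum>x\<in>I. 1)"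
  proof (rule sum_mono)
    fix x assume "x \<in> I"
    then have "\<not> rich R x e" by (intro not_rich[OF e]) auto
    then show "ed R {x} e \<le> 1" using ed_point_edge[OF e, of x] by simp
  qed
  finally show ?thesis by simp
qed

lemma I_indep: "x \<in> I \<Longrightarrow> y \<in> I \<Longrightarrow> \<not> R x y"
proof
  assume *: "x \<in> I" "y \<in> I" "R x y"
  show False
    using exchange(2)[of "{}" "{}" "[]" "[(x, y)]"] * irrefl by auto
qed

lemma ed_II: "ed R I I = 0"
  using I_indep by (simp add: ed_def)

lemma pd_M: "pairwise disjnt M" and pd_T: "pairwise disjnt \<T>"
  using disj_MM disj_TT by (simp_all add: pairwise_def disjnt_def)

lemma ed_UM_right: "ed R X (\<Union>M) = (\<Sum>e\<in>M. ed R X e)"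
  using M_facts(3) pd_M by (intro ed_Union_right) auto

lemma ed_UM_left: "ed R (\<Union>M) X = (\<Sum>e\<in>M. ed R e X)"
  using M_facts(3) pd_M by (intro ed_Union_left) auto

lemma ed_UT_right: "ed R X (\<Union>\<T>) = (\<Sum>T\<in>\<T>. ed R X T)"
  using T_facts(3) pd_T by (intro ed_Union_right) auto

lemma ed_UT_left: "ed R (\<Union>\<T>) X = (\<Sum>T\<in>\<T>. ed R T X)"
  using T_facts(3) pd_T by (intro ed_Union_left) auto

abbreviation "r \<equiv> int (card \<T>)"
abbreviation "m \<equiv> int (card M)"
abbreviation "i \<equiv> int (card I)"

lemma ed_UM_UM: "ed R (\<Union>M) (\<Union>M) \<le> 2 * m * m"
proof -
  have "ed R (\<Union>M) (\<Union>M) = (\<Sum>e\<in>M. \<Sum>e'\<in>M. ed R e e')"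
    by (subst ed_UM_left) (simp add: ed_UM_right)
  also have "\<dots> \<le> (\<Sum>e\<in>M. \<Sum>e'\<in>M. 2)"
    by (intro sum_mono ed_MM)
  finally show ?thesis by simp
qed

lemma ed_I_UM: "ed R I (\<Union>M) \<le> m * i"
proof -
  have "ed R I (\<Union>M) = (\<Sum>e\<in>M. ed R I e)"
    by (simp add: ed_UM_right)
  also have "\<dots> \<le> (\<Sum>e\<in>M. i)"
    by (intro sum_mono ed_IM)
  finally show ?thesis by simp
qed

lemma ed_TT_same: "T \<in> \<T> \<Longrightarrow> ed R T T = 6"
proof -
  assume T: "T \<in> \<T>"
  obtain a b c where abc: "T = {a, b, c}" "a \<noteq> b" "b \<noteq> c" "a \<noteq> c"
    using T_triple[OF T] .
  have "\<not> R a a" "\<not> R b b" "\<not> R c c" using irrefl by blast+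
  moreover have "R a b" "R b a" "R a c" "R c a" "R b c" "R c b"
    using T_adj[OF T] abc by auto
  ultimately show ?thesis using abc by (simp add: ed_def)
qed

lemma finite_Union: "finite (\<Union>M)" "finite (\<Union>\<T>)"
  using M_facts(3) T_facts(3) by auto

lemma card_UM: "int (card (\<Union>M)) = 2 * m"
  using card_Union_disjoint[OF pd_M] M_facts(2,3) by simp

lemma card_UT: "int (card (\<Union>\<T>)) = 3 * r"
  using card_Union_disjoint[OF pd_T] T_facts(2,3) by simp

lemma V_split: "V = \<Union>\<T> \<union> (\<Union>M \<union> I)" "\<Union>\<T> \<inter> (\<Union>M \<union> I) = {}" "\<Union>M \<inter> I = {}"
proof -
  have "\<Union>\<T> \<subseteq> V" "\<Union>M \<subseteq> V" using T_facts(1) M_facts(1) by blast+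
  then show "V = \<Union>\<T> \<union> (\<Union>M \<union> I)" by (auto simp: I_def)
  show "\<Union>\<T> \<inter> (\<Union>M \<union> I) = {}" using cfg_separate(1)[OF cfg] by (auto simp: I_def)
  show "\<Union>M \<inter> I = {}" by (auto simp: I_def)
qed

lemma card_V: "int (card V) = 3 * r + 2 * m + i"
proof -
  have "card V = card (\<Union>\<T>) + card (\<Union>M \<union> I)"
    using V_split finite_Union by (metis card_Un_disjoint finI finite_UnI)
  also have "card (\<Union>M \<union> I) = card (\<Union>M) + card I"
    using V_split finite_Union by (intro card_Un_disjoint) auto
  finally show ?thesis using card_UM card_UT by simp
qed

text \<open>The last term is the ordered count for a complete bipartite graph with sides of
  \<open>m\<close> and \<open>m + i\<close> vertices, which is what \<open>not_rich\<close> leaves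
  possible off the triangles.\<close>

lemma ed_total:
  "ed R V V \<le> (\<Sum>T\<in>\<T>. \<Sum>T'\<in>\<T>. ed R T T') + 2 * (\<Sum>T\<in>\<T>. ed R T (\<Union>M)) + 2 * (\<Sum>T\<in>\<T>. ed R T I)
     + 2 * m * (m + i)"
proof -
  let ?P = "\<Union>\<T>" and ?Q = "\<Union>M"
  have "ed R V V = ed R (?P \<union> (?Q \<union> I)) (?P \<union> (?Q \<union> I))"
    using V_split(1) by simp
  also have "\<dots> = ed R ?P ?P + ed R ?P ?Q + ed R ?P I + (ed R ?Q ?P + ed R ?Q ?Q + ed R ?Q I)
      + (ed R I ?P + ed R I ?Q + ed R I I)"
    using V_split(2,3) finite_Union
    by (simp add: ed_Un_left ed_Un_right)
  also have "\<dots> = ed R ?P ?P + 2 * ed R ?P ?Q + 2 * ed R ?P I + ed R ?Q ?Q + 2 * ed R I ?Q"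
    using ed_commute[OF symR, of ?Q ?P] ed_commute[OF symR, of I ?P] ed_commute[OF symR, of ?Q I] ed_II
    by simp
  also have "ed R ?P ?P = (\<Sum>T\<in>\<T>. \<Sum>T'\<in>\<T>. ed R T T')"
    by (subst ed_UT_left) (simp add: ed_UT_right)
  also have "ed R ?P ?Q = (\<Sum>T\<in>\<T>. ed R T ?Q)" by (rule ed_UT_left)
  also have "ed R ?P I = (\<Sum>T\<in>\<T>. ed R T I)" by (rule ed_UT_left)
  finally show ?thesis using ed_UM_UM ed_I_UM by (simp add: algebra_simps)
qed

text \<open>Otherwise \<open>v\<close> with \<open>e\<close> and \<open>v'\<close> with
  \<open>e'\<close> give two triangles in place of \<open>T\<close>.\<close>

lemma rich_unique:
  assumes "T \<in> \<T>" "v \<in> T" "v' \<in> T" "v \<noteq> v'" "e \<in> M" "e' \<in> M" "rich R v e" "rich R v' e'"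
  shows "e = e'"
proof (rule ccontr)
  assume ne: "e \<noteq> e'"
  obtain p q where e: "e = {p, q}" "p \<noteq> q" "R p q" using M_pair[OF assms(5)] by metis
  obtain p' q' where e': "e' = {p', q'}" "p' \<noteq> q'" "R p' q'" using M_pair[OF assms(6)] by metis
  have c: "card {e, e'} \<le> 3" by (simp add: card_insert_if)
  show False
    using exchange(1)[of "{T}" "{e, e'}" "[(v, p, q), (v', p', q')]" "[]"] assms c e e' ne
      disj_MM[OF assms(5,6) ne] disj_TM[OF assms(1,5)] disj_TM[OF assms(1,6)]
    by (auto simp: rich_def)
qed

text \<open>The triangle \<open>{a, b, x}\<close> would replace \<open>T\<close> and free
  \<open>c\<close> for the additional edge \<open>{c, y}\<close>.\<close>

lemma T_I_exclusive:
  assumes "T \<in> \<T>" "T = {a, b, c}" "a \<noteq> b" "c \<noteq> a" "c \<noteq> b" "x \<in> I" "y \<in> I" "x \<noteq> y" "R a x" "R b x"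
  shows "\<not> R c y"
proof
  assume "R c y"
  with exchange(2)[of "{T}" "{}" "[(a, b, x)]" "[(c, y)]"] assms disj_TI[OF assms(1)] T_adj[OF assms(1)]
  show False by auto
qed

definition inc :: "'a set \<Rightarrow> nat" where
  "inc T = card {(v, e). v \<in> T \<and> e \<in> M \<and> rich R v e}"

lemma inc_eq: "T \<in> \<T> \<Longrightarrow> int (inc T) = (\<Sum>e\<in>M. \<Sum>v\<in>T. of_bool (rich R v e))"
proof -
  assume T: "T \<in> \<T>"
  have "{(v, e). v \<in> T \<and> e \<in> M \<and> rich R v e} = (SIGMA v:T. {e \<in> M. rich R v e})" by auto
  then have "int (inc T) = (\<Sum>v\<in>T. \<Sum>e\<in>M. of_bool (rich R v e))"
    using T_facts(3)[OF T] by (simp add: inc_def Int_def)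
  then show ?thesis by (subst sum.swap) simp
qed

lemma ed_T_edge:
  assumes "T \<in> \<T>" "e \<in> M"
  shows "ed R T e \<le> 3 + (\<Sum>v\<in>T. of_bool (rich R v e))"
proof -
  have "ed R T e = (\<Sum>v\<in>T. ed R {v} e)"
    using T_facts(3)[OF assms(1)] by (rule ed_split_left)
  also have "\<dots> \<le> (\<Sum>v\<in>T. 1 + of_bool (rich R v e))"
    using ed_point_edge[OF assms(2)] by (intro sum_mono) auto
  also have "\<dots> = 3 + (\<Sum>v\<in>T. of_bool (rich R v e))"
    unfolding sum.distrib using T_facts(2)[OF assms(1)] by simp
  finally show ?thesis .
qed

lemma ed_T_UM:
  assumes "T \<in> \<T>"
  shows "ed R T (\<Union>M) \<le> 3 * m + int (inc T)"
proof -
  have "ed R T (\<Union>M) \<le> (\<Sum>e\<in>M. 3 + (\<Sum>v\<in>T. of_bool (rich R v e)))"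
    unfolding ed_UM_right by (intro sum_mono ed_T_edge assms)
  then show ?thesis by (simp only: inc_eq[OF assms] sum.distrib) simp
qed

text \<open>By \<open>rich_unique\<close> no two rich incidences of \<open>T\<close> are disjoint,
  so they form a star, centred at an edge of \<open>M\<close> or at a vertex of
  \<open>T\<close>.\<close>

lemma inc_cases:
  assumes "T \<in> \<T>"
  obtains e where "e \<in> M" "{(v, e). v \<in> T \<and> e \<in> M \<and> rich R v e} \<subseteq> T \<times> {e}"
  | v where "v \<in> T" "{(v, e). v \<in> T \<and> e \<in> M \<and> rich R v e} \<subseteq> {v} \<times> {e \<in> M. rich R v e}"
proof (cases "\<exists>v e v' e'. v \<in> T \<and> v' \<in> T \<and> e \<in> M \<and> e' \<in> M \<and> rich R v e \<and> rich R v' e' \<and> v \<noteq> v'")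
  case True
  then obtain v e v' e' where *: "v \<in> T" "v' \<in> T" "e \<in> M" "e' \<in> M" "rich R v e" "rich R v' e'" "v \<noteq> v'"
    by blast
  have "e' = e" using rich_unique[OF assms *(1,2,7,3,4,5,6)] by simp
  have "f = e" if "w \<in> T" "f \<in> M" "rich R w f" for w f
  proof (cases "w = v")
    case True
    then show ?thesis using rich_unique[OF assms, of v' w e f] * that \<open>e' = e\<close> by auto
  next
    case False
    then show ?thesis using rich_unique[OF assms, of v w e f] * that by auto
  qed
  then have "{(v, e). v \<in> T \<and> e \<in> M \<and> rich R v e} \<subseteq> T \<times> {e}" by auto
  with that(1) *(3) show ?thesis by blast
next
  case False
  show ?thesis
  proof (cases "\<exists>v e. v \<in> T \<and> e \<in> M \<and> rich R v e")
    case True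
    then obtain v e where "v \<in> T" "e \<in> M" "rich R v e" by blast
    with False have "{(v, e). v \<in> T \<and> e \<in> M \<and> rich R v e} \<subseteq> {v} \<times> {e \<in> M. rich R v e}" by blast
    with that(2) \<open>v \<in> T\<close> show ?thesis by blast
  next
    case False
    obtain v where "v \<in> T" using T_triple[OF assms] by auto
    with False that(2) show ?thesis by blast
  qed
qed

text \<open>The vertices \<open>a\<close>, \<open>b\<close> of such a triangle behave like two vertices of a clique inside one side
  of a bipartition, and \<open>I\<close> lies in the other side.\<close>

definition big :: "'a set \<Rightarrow> 'a \<Rightarrow> 'a \<Rightarrow> 'a \<Rightarrow> bool" where
  "big T a b c \<longleftrightarrow> T = {a, b, c} \<and> a \<noteq> b \<and> c \<noteq> a \<and> c \<noteq> b \<and>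
     (\<exists>x\<in>I. \<exists>y\<in>I. x \<noteq> y \<and> R a x \<and> R b x \<and> R a y \<and> R b y) \<and> (\<forall>z\<in>I. \<not> R c z)"

definition isbig :: "'a set \<Rightarrow> bool" where
  "isbig T \<longleftrightarrow> (\<exists>a b c. big T a b c)"

text \<open>Two common neighbours are demanded in \<open>big\<close> so that one remains when an
  exchange uses another vertex \<open>w\<close> of \<open>I\<close>.\<close>

lemma big_avoid:
  assumes "big T a b c"
  obtains x where "x \<in> I" "x \<noteq> w" "R a x" "R b x"
  using assms unfolding big_def by metis

end

section \<open>Adjacencies of a triangle to \<open>I\<close> and to other triangles\<close>

context stable_cfg
begin

lemma ed_T_point:
  assumes "T \<in> \<T>" "T = {a, b, c}" "a \<noteq> b" "b \<noteq> c" "a \<noteq> c"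
  shows "ed R T {x} = of_bool (R a x) + of_bool (R b x) + of_bool (R c x)"
  using assms(2-) by (simp add: ed_def)

lemma I_pos: "x \<in> I \<Longrightarrow> i \<ge> 1"
proof -
  assume "x \<in> I"
  then have "card I \<noteq> 0" by auto
  then show ?thesis by linarith
qed

text \<open>If a vertex of \<open>I\<close> is adjacent to all of \<open>T\<close>, then no other
  vertex of \<open>I\<close> is adjacent to any of it, which leaves 3 adjacencies. Otherwise each
  vertex of \<open>I\<close> contributes at most 2, and two vertices that contribute 2 must have the
  same neighbours in \<open>T\<close>, which makes \<open>T\<close> big.\<close>

lemma ed_T_I:
  assumes T: "T \<in> \<T>"
  shows "ed R T I \<le> 2 * i + 1" "\<not> isbig T \<Longrightarrow> i \<ge> 2 \<Longrightarrow> ed R T I \<le> i + 1"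
proof -
  have sum: "ed R T I = (\<Sum>x\<in>I. ed R T {x})" by (rule ed_split_right)
  have "ed R T I \<le> 2 * i + 1 \<and> (\<not> isbig T \<longrightarrow> i \<ge> 2 \<longrightarrow> ed R T I \<le> i + 1)"
  proof (cases "\<exists>x\<in>I. \<forall>v\<in>T. R v x")
    case True
    then obtain x where x: "x \<in> I" "\<forall>v\<in>T. R v x" by blast
    have "ed R T {y} = 0" if y: "y \<in> I" "y \<noteq> x" for y
    proof -
      have "\<not> R v y" if v: "v \<in> T" for v
      proof -
        obtain a b where "T = {v, a, b}" "a \<noteq> v" "b \<noteq> v" "a \<noteq> b"
          using T_others[OF T v] .
        then show ?thesis
          using T_I_exclusive[OF T, of a b v x y] x y by auto
      qed
      then show ?thesis by (simp add: ed_def)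
    qed
    moreover have "ed R T {x} \<le> 3"
      using ed_le_card[of T "{x}" R] T_facts(2,3)[OF T] by simp
    moreover have "ed R T I = ed R T {x} + (\<Sum>y\<in>I - {x}. ed R T {y})"
      unfolding sum by (rule sum.remove[OF finI x(1)])
    ultimately have "ed R T I \<le> 3" by simp
    moreover have "i \<ge> 1" using I_pos[OF x(1)] .
    ultimately show ?thesis by linarith
  next
    case False
    have le2: "ed R T {x} \<le> 2" if "x \<in> I" for x
    proof -
      obtain a b c where abc: "T = {a, b, c}" "a \<noteq> b" "b \<noteq> c" "a \<noteq> c"
        using T_triple[OF T] .
      with False that have "\<not> (R a x \<and> R b x \<and> R c x)" by auto
      then show ?thesis unfolding ed_T_point[OF T abc] by (auto simp: of_bool_def)
    qed
    have "ed R T I \<le> (\<Sum>x\<in>I. 2)" unfolding sum by (intro sum_mono le2)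
    then have 1: "ed R T I \<le> 2 * i + 1" by simp
    have "ed R T I \<le> i + 1" if nb: "\<not> isbig T"
    proof -
      have uniq: "x = y" if xy: "x \<in> I" "y \<in> I" "ed R T {x} = 2" "ed R T {y} = 2" for x y
      proof (rule ccontr)
        assume ne: "x \<noteq> y"
        obtain a b c where abc: "T = {a, b, c}" "a \<noteq> b" "c \<noteq> a" "c \<noteq> b" "R a x" "R b x" "\<not> R c x"
        proof -
          obtain a b c where t: "T = {a, b, c}" "a \<noteq> b" "b \<noteq> c" "a \<noteq> c"
            using T_triple[OF T] .
          have "of_bool (R a x) + of_bool (R b x) + of_bool (R c x) = (2::int)"
            using xy(3) ed_T_point[OF T t] by simp
          then have "R a x \<and> R b x \<and> \<not> R c x \<or> R a x \<and> R c x \<and> \<not> R b x \<or> R b x \<and> R c x \<and> \<not> R a x"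
            by (auto simp: of_bool_def split: if_splits)
          then show ?thesis
            using that[of a b c] that[of a c b] that[of b c a] t by auto
        qed
        have c: "\<not> R c z" if "z \<in> I" for z
          using T_I_exclusive[OF T abc(1-4) xy(1), of z] abc that by auto
        have "of_bool (R a y) + of_bool (R b y) + of_bool (R c y) = (2::int)"
          using xy(4) ed_T_point[OF T abc(1,2), of y] abc by auto
        then have "R a y" "R b y" using c[OF xy(2)] by (auto simp: of_bool_def split: if_splits)
        then have "big T a b c" unfolding big_def using abc c xy(1,2) ne by blast
        with nb show False by (auto simp: isbig_def)
      qed
      show ?thesis
      proof (cases "\<exists>x\<in>I. ed R T {x} = 2")
        case True
        then obtain x where x: "x \<in> I" "ed R T {x} = 2" by blast
        have "ed R T {y} \<le> 1" if "y \<in> I - {x}" for y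
          using uniq[of y x] x le2[of y] that by fastforce
        then have "(\<Sum>y\<in>I - {x}. ed R T {y}) \<le> (\<Sum>y\<in>I - {x}. 1)" by (intro sum_mono)
        moreover have "ed R T I = ed R T {x} + (\<Sum>y\<in>I - {x}. ed R T {y})"
          unfolding sum by (rule sum.remove[OF finI x(1)])
        moreover have "i \<ge> 1" using I_pos[OF x(1)] .
        ultimately show ?thesis using x by (simp add: of_nat_diff)
      next
        case False
        then have "ed R T {y} \<le> 1" if "y \<in> I" for y
          using le2[OF that] that by (metis int_one_le_iff_zero_less le_less one_add_one zle_add1_eq_le not_le linorder_not_less)
        then have "ed R T I \<le> (\<Sum>y\<in>I. 1)" unfolding sum by (intro sum_mono)
        then show ?thesis by simp
      qed
    qed
    with 1 show ?thesis by blast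
  qed
  then show "ed R T I \<le> 2 * i + 1" "\<not> isbig T \<Longrightarrow> i \<ge> 2 \<Longrightarrow> ed R T I \<le> i + 1" by blast+
qed

lemma big_ed_I:
  assumes "T \<in> \<T>" "isbig T"
  shows "ed R T I \<le> 2 * i" "ed R T I \<noteq> 0"
proof -
  obtain a b c where b: "big T a b c" using assms(2) by (auto simp: isbig_def)
  then have t: "T = {a, b, c}" "a \<noteq> b" "b \<noteq> c" "a \<noteq> c" by (auto simp: big_def)
  have "ed R T I = (\<Sum>x\<in>I. ed R T {x})" by (rule ed_split_right)
  also have "\<dots> \<le> (\<Sum>x\<in>I. 2)"
  proof (rule sum_mono)
    fix x assume "x \<in> I"
    then have "\<not> R c x" using b by (simp add: big_def)
    then show "ed R T {x} \<le> 2" by (simp add: ed_T_point[OF assms(1) t])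
  qed
  finally show "ed R T I \<le> 2 * i" by simp
  obtain x where x: "x \<in> I" "R a x" using big_avoid[OF b] by metis
  have "0 < ed R T {x}" unfolding ed_T_point[OF assms(1) t] using x by simp
  moreover have "ed R T I = ed R T {x} + (\<Sum>y\<in>I - {x}. ed R T {y})"
    unfolding ed_split_right[of R T I] by (rule sum.remove[OF finI x(1)])
  moreover have "0 \<le> (\<Sum>y\<in>I - {x}. ed R T {y})" by (intro sum_nonneg ed_nonneg)
  ultimately show "ed R T I \<noteq> 0" by linarith
qed

lemma ed_TT_le9: "T \<in> \<T> \<Longrightarrow> T' \<in> \<T> \<Longrightarrow> ed R T T' \<le> 9"
  using ed_le_card[of T T' R] T_facts(2,3) by force

lemma nineD:
  assumes "T \<in> \<T>" "T' \<in> \<T>" "ed R T T' = 9" "a \<in> T" "b \<in> T'"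
  shows "R a b" "R b a"
proof -
  have "card {(x, y). x \<in> T \<and> y \<in> T' \<and> \<not> R x y} = 0"
    using ed_compl[of T T' R] T_facts(2,3)[OF assms(1)] T_facts(2,3)[OF assms(2)] assms(3) by simp
  moreover have "{(x, y). x \<in> T \<and> y \<in> T' \<and> \<not> R x y} \<subseteq> T \<times> T'" by blast
  then have "finite {(x, y). x \<in> T \<and> y \<in> T' \<and> \<not> R x y}"
    using T_facts(3)[OF assms(1)] T_facts(3)[OF assms(2)] by (meson finite_SigmaI finite_subset)
  ultimately have "{(x, y). x \<in> T \<and> y \<in> T' \<and> \<not> R x y} = {}" by (simp only: card_0_eq)
  then show "R a b" using assms(4,5) by blast
  then show "R b a" by (rule sym)
qed

lemma nine_commute: "ed R T T' = 9 \<Longrightarrow> ed R T' T = 9"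
  using ed_commute[OF symR] by metis

text \<open>If \<open>u\<close> in \<open>T'\<close> had a neighbour \<open>z\<close> in
  \<open>I\<close>, then \<open>{a, b, x}\<close>, the triangle of \<open>c\<close> with the rest of
  \<open>T'\<close>, and the edge \<open>{u, z}\<close> could replace \<open>T\<close> and
  \<open>T'\<close>.\<close>

lemma big_nine_I:
  assumes "T \<in> \<T>" "T' \<in> \<T>" "T \<noteq> T'" "isbig T" "ed R T T' = 9"
  shows "ed R T' I = 0"
proof -
  have "\<not> R u z" if u: "u \<in> T'" and z: "z \<in> I" for u z
  proof
    assume uz: "R u z"
    obtain a b c where b: "big T a b c" using assms(4) by (auto simp: isbig_def)
    obtain x where x: "x \<in> I" "x \<noteq> z" "R a x" "R b x" using big_avoid[OF b] by metis
    obtain p q where t': "T' = {u, p, q}" "p \<noteq> u" "q \<noteq> u" "p \<noteq> q"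
      using T_others[OF assms(2) u] .
    have t: "T = {a, b, c}" "a \<noteq> b" "c \<noteq> a" "c \<noteq> b" using b by (auto simp: big_def)
    have "R c p" "R c q" using nineD(1)[OF assms(1,2,5)] t t' by auto
    moreover have "R a b" "R p q" using T_adj[OF assms(1)] T_adj[OF assms(2)] t t' by auto
    moreover have "card {T, T'} = 2" using assms(3) by simp
    ultimately show False
      using exchange(2)[of "{T, T'}" "{}" "[(a, b, x), (c, p, q)]" "[(u, z)]"]
        assms(1-3) x uz u z t t' disj_TT[OF assms(1-3)] disj_TI[OF assms(1)] disj_TI[OF assms(2)] by auto
  qed
  then show ?thesis by (simp add: ed_def)
qed

text \<open>If an edge splits a \<open>K\<^sub>6\<close> formed by two triangles, these can be rebuilt from the ends of the edge
  and four vertices of the \<open>K\<^sub>6\<close>, and the edge is replaced by the edge \<open>{c, g}\<close>. A third triangle must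
  then not be too well connected to \<open>c\<close> and \<open>g\<close>.\<close>

definition splits :: "'a set \<Rightarrow> 'a set \<Rightarrow> bool" where
  "splits e S \<longleftrightarrow> (\<exists>x y a b c d f g. e = {x, y} \<and> S = {a, b, c, d, f, g} \<and> distinct [a, b, c, d, f, g] \<and>
      R a x \<and> R b x \<and> R d y \<and> R f y)"

definition exch :: "'a set \<Rightarrow> 'a set \<Rightarrow> bool" where
  "exch T T' \<longleftrightarrow> T \<noteq> T' \<and> ed R T T' = 9 \<and> card {e \<in> M. splits e (T \<union> T')} \<ge> 2"

lemma nine_Un:
  assumes "T \<in> \<T>" "T' \<in> \<T>" "ed R T T' = 9" "a \<in> T \<union> T'" "b \<in> T \<union> T'" "a \<noteq> b"
  shows "R a b"
  using assms nineD[OF assms(1-3)] T_adj by blast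

text \<open>At most one pair is missing; \<open>u\<close> is its end in \<open>X\<close>.\<close>

lemma almost_complete:
  assumes "finite X" "finite Y" "ed R X Y \<ge> int (card X) * int (card Y) - 1"
  obtains u where "\<And>v w. v \<in> X \<Longrightarrow> v \<noteq> u \<Longrightarrow> w \<in> Y \<Longrightarrow> R v w"
proof -
  let ?B = "{(x, y). x \<in> X \<and> y \<in> Y \<and> \<not> R x y}"
  have "card ?B \<le> 1" using ed_compl[OF assms(1,2), of R] assms(3) by linarith
  moreover have "?B \<subseteq> X \<times> Y" by blast
  then have "finite ?B" using assms(1,2) by (meson finite_SigmaI finite_subset)
  moreover have "card ?B = 0 \<or> card ?B = 1" using \<open>card ?B \<le> 1\<close> by linarith
  ultimately have "?B = {} \<or> (\<exists>z. ?B = {z})"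
    using card_0_eq[of ?B] card_1_singletonE[of ?B] by meson
  then have "\<exists>u. \<forall>v w. v \<in> X \<longrightarrow> v \<noteq> u \<longrightarrow> w \<in> Y \<longrightarrow> R v w"
  proof
    assume "?B = {}"
    then show ?thesis by blast
  next
    assume "\<exists>z. ?B = {z}"
    then obtain u w where B: "?B = {(u, w)}" by auto
    have "R v w'" if "v \<in> X" "v \<noteq> u" "w' \<in> Y" for v w'
    proof (rule ccontr)
      assume "\<not> R v w'"
      then have "(v, w') \<in> ?B" using that by simp
      then show False using B that(2) by simp
    qed
    then show ?thesis by blast
  qed
  then show ?thesis using that by blast
qed

text \<open>Six triangles replace five. Each exchangeable pair is rebuilt around a splitting edge
  and leaves two adjacent vertices over. Since 17 of 18 adjacencies are present, all vertices of
  \<open>T5\<close> but one are joined to both of these, so distinct vertices of \<open>T5\<close>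
  complete the two leftover edges.\<close>

lemma exch_two:
  assumes T: "T1 \<in> \<T>" "T2 \<in> \<T>" "T3 \<in> \<T>" "T4 \<in> \<T>" "T5 \<in> \<T>" "distinct [T1, T2, T3, T4, T5]"
    and ex: "exch T1 T2" "exch T3 T4"
    and 17: "ed R T5 (T1 \<union> T2) \<ge> 17" "ed R T5 (T3 \<union> T4) \<ge> 17"
  shows False
proof -
  have nn: "ed R T1 T2 = 9" "ed R T3 T4 = 9" using ex by (auto simp: exch_def)
  have "card {e \<in> M. splits e (T1 \<union> T2)} \<ge> 2" "card {e \<in> M. splits e (T3 \<union> T4)} \<ge> 2"
    using ex by (auto simp: exch_def)
  then obtain e where e: "e \<in> M" "splits e (T1 \<union> T2)"
    by (metis (no_types, lifting) card.empty empty_Collect_eq not_numeral_le_zero)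
  \<comment> \<open>Here \<open>exch\<close> needs its two splitting edges: the second pair must use
    one other than \<open>e\<close>.\<close>
  have "\<not> {e \<in> M. splits e (T3 \<union> T4)} \<subseteq> {e}"
  proof
    assume "{e \<in> M. splits e (T3 \<union> T4)} \<subseteq> {e}"
    then have "card {e \<in> M. splits e (T3 \<union> T4)} \<le> card {e}" by (intro card_mono) auto
    with \<open>card {e \<in> M. splits e (T3 \<union> T4)} \<ge> 2\<close> show False by simp
  qed
  then obtain e' where e': "e' \<in> M" "splits e' (T3 \<union> T4)" "e' \<noteq> e" by blast
  obtain x y a b c d f g where s: "e = {x, y}" "T1 \<union> T2 = {a, b, c, d, f, g}" "distinct [a, b, c, d, f, g]"
      "R a x" "R b x" "R d y" "R f y"
    using e(2) unfolding splits_def by blast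
  obtain x' y' a' b' c' d' f' g' where s': "e' = {x', y'}" "T3 \<union> T4 = {a', b', c', d', f', g'}"
      "distinct [a', b', c', d', f', g']" "R a' x'" "R b' x'" "R d' y'" "R f' y'"
    using e'(2) unfolding splits_def by blast
  have xy: "x \<noteq> y" "x' \<noteq> y'" using s(1) s'(1) M_facts(2)[OF e(1)] M_facts(2)[OF e'(1)] by auto
  have c6: "card (T1 \<union> T2) = 6" "card (T3 \<union> T4) = 6" "finite (T1 \<union> T2)" "finite (T3 \<union> T4)"
    using s s' by auto
  obtain u where u: "\<And>v w. v \<in> T5 \<Longrightarrow> v \<noteq> u \<Longrightarrow> w \<in> T1 \<union> T2 \<Longrightarrow> R v w"
    using almost_complete[of T5 "T1 \<union> T2"] 17(1) c6 T_facts(2,3)[OF T(5)] by auto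
  obtain u' where u': "\<And>v w. v \<in> T5 \<Longrightarrow> v \<noteq> u' \<Longrightarrow> w \<in> T3 \<union> T4 \<Longrightarrow> R v w"
    using almost_complete[of T5 "T3 \<union> T4"] 17(2) c6 T_facts(2,3)[OF T(5)] by auto
  obtain v v' where v: "v \<in> T5" "v' \<in> T5" "v \<noteq> v'" "v \<noteq> u" "v' \<noteq> u'"
  proof -
    obtain p q s where "T5 = {p, q, s}" "p \<noteq> q" "q \<noteq> s" "p \<noteq> s" using T_triple[OF T(5)] .
    then show ?thesis
      using that[of p q] that[of q p] that[of p s] that[of s p] that[of q s] that[of s q] by auto
  qed
  have vc: "R v c" "R v g" "R v' c'" "R v' g'" using u[OF v(1,4)] u'[OF v(2,5)] s(2) s'(2) by auto
  have hub: "R a b" "R d f" "R c g" "R a' b'" "R d' f'" "R c' g'"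
    using nine_Un[OF T(1,2) nn(1)] nine_Un[OF T(3,4) nn(2)] s(2,3) s'(2,3) by auto
  have djT: "T5 \<inter> T1 = {}" "T5 \<inter> T2 = {}" "T5 \<inter> T3 = {}" "T5 \<inter> T4 = {}"
      "T1 \<inter> T3 = {}" "T1 \<inter> T4 = {}" "T2 \<inter> T3 = {}" "T2 \<inter> T4 = {}"
  proof -
    have ne: "T5 \<noteq> T1" "T5 \<noteq> T2" "T5 \<noteq> T3" "T5 \<noteq> T4" "T1 \<noteq> T3" "T1 \<noteq> T4" "T2 \<noteq> T3" "T2 \<noteq> T4"
      using T(6) by auto
    show "T5 \<inter> T1 = {}" "T5 \<inter> T2 = {}" "T5 \<inter> T3 = {}" "T5 \<inter> T4 = {}"
      "T1 \<inter> T3 = {}" "T1 \<inter> T4 = {}" "T2 \<inter> T3 = {}" "T2 \<inter> T4 = {}"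
      by (rule disj_TT[OF T(5,1) ne(1)] disj_TT[OF T(5,2) ne(2)] disj_TT[OF T(5,3) ne(3)]
        disj_TT[OF T(5,4) ne(4)] disj_TT[OF T(1,3) ne(5)] disj_TT[OF T(1,4) ne(6)]
        disj_TT[OF T(2,3) ne(7)] disj_TT[OF T(2,4) ne(8)])+
  qed
  have d5: "{v, v'} \<inter> {a, b, c, d, f, g} = {}" "{v, v'} \<inter> {a', b', c', d', f', g'} = {}"
    unfolding s(2)[symmetric] s'(2)[symmetric] using v(1,2) djT by blast+
  have d12: "{a, b, c, d, f, g} \<inter> {a', b', c', d', f', g'} = {}"
    unfolding s(2)[symmetric] s'(2)[symmetric] using djT by blast
  have de: "{x, y} \<inter> {x', y'} = {}" using disj_MM[OF e(1) e'(1)] e'(3) s(1) s'(1) by auto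
  have djM: "T \<inter> (e \<union> e') = {}" if "T \<in> {T1, T2, T3, T4, T5}" for T
  proof -
    have "T \<in> \<T>" using that T by blast
    then show ?thesis using disj_TM[OF _ e(1), of T] disj_TM[OF _ e'(1), of T] by blast
  qed
  have dm: "{x, y, x', y'} \<inter> {a, b, c, d, f, g} = {}" "{x, y, x', y'} \<inter> {a', b', c', d', f', g'} = {}"
    "{x, y, x', y'} \<inter> {v, v'} = {}"
    unfolding s(2)[symmetric] s'(2)[symmetric]
    using djM v(1,2) s(1) s'(1) by blast+
  let ?ts = "[(a, b, x), (d, f, y), (a', b', x'), (d', f', y'), (v, c, g), (v', c', g')]"
  \<comment> \<open>The same vertices grouped by origin, where distinctness follows from the
    disjointness of the groups. It passes to the order of \<open>?ts\<close> because both lists have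
    18 entries and the same set.\<close>
  let ?L = "[a, b, c, d, f, g] @ [a', b', c', d', f', g'] @ [v, v'] @ [x, y] @ [x', y']"
  have "distinct ([v, v'] @ [x, y] @ [x', y'])"
    using de dm(3) xy v(3) by auto
  moreover have "set [a', b', c', d', f', g'] \<inter> set ([v, v'] @ [x, y] @ [x', y']) = {}"
    using d5(2) dm(2) by auto
  moreover have "set [a, b, c, d, f, g] \<inter> set ([a', b', c', d', f', g'] @ [v, v'] @ [x, y] @ [x', y']) = {}"
    using d12 d5(1) dm(1) by auto
  ultimately have "distinct ?L"
    using s(3) s'(3) by (simp only: distinct_append)
  then have "card (set ?L) = 18" using distinct_card[of ?L] by simp
  moreover have "set (flat3 ?ts @ flat2 []) = set ?L" by auto
  ultimately have dist: "distinct (flat3 ?ts @ flat2 [])"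
    by (intro card_distinct) simp
  have adj: "\<forall>(x, y, z)\<in>set ?ts. R x y \<and> R y z \<and> R x z"
    using hub vc s(4-7) s'(4-7) by simp
  have "\<Union>{T1, T2, T3, T4, T5} \<union> \<Union>{e, e'} = (T1 \<union> T2) \<union> (T3 \<union> T4) \<union> T5 \<union> (e \<union> e')" by auto
  then have sub: "set (flat3 ?ts) \<union> set (flat2 []) \<subseteq> \<Union>{T1, T2, T3, T4, T5} \<union> \<Union>{e, e'} \<union> I"
    using v(1,2) by (simp add: s(1,2) s'(1,2))
  have "card {e, e'} \<le> 3" "card {T1, T2, T3, T4, T5} = 5"
    using T(6) by (simp_all add: card_insert_if)
  then show False
    using exchange(1)[OF _ _ _ dist adj _ sub] T e(1) e'(1) by simp
qed

text \<open>If \<open>T\<close> and \<open>T'\<close> have nine adjacencies, the end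
  \<open>x\<close> completes any two vertices of \<open>T\<close>, and also any vertex of
  \<open>T\<close> together with \<open>w\<close>, to a triangle.\<close>

definition hv :: "'a set \<Rightarrow> 'a set \<Rightarrow> 'a set set" where
  "hv T T' = {e \<in> M. \<exists>x\<in>e. (\<forall>v\<in>T. R v x) \<and> (\<exists>w\<in>T'. R w x)}"

text \<open>Four triangles replace three: one vertex of \<open>T1\<close> takes two vertices of
  \<open>T\<close>, one vertex of \<open>T2\<close> takes the third one with \<open>x\<close>, and
  the remaining pairs of \<open>T1\<close> and \<open>T2\<close> are completed by \<open>x1\<close>
  and \<open>x2\<close>. Three heavy edges are demanded so that \<open>e1\<close> can avoid the
  other two.\<close>

lemma heavy_unique:
  assumes T: "T1 \<in> \<T>" "T2 \<in> \<T>" "T \<in> \<T>" "distinct [T1, T2, T]"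
    and nn: "ed R T1 T = 9" "ed R T2 T = 9" and h: "card (hv T1 T) \<ge> 3" "card (hv T2 T) \<ge> 3"
  shows False
proof -
  have pick: "\<exists>e\<in>A. e \<notin> B" if "card A \<ge> 3" "card B \<le> 2" "finite B" for A B :: "'a set set"
    using that card_mono[of B A] by fastforce
  obtain e where e: "e \<in> hv T2 T" using pick[of "hv T2 T" "{}"] h by auto
  obtain e2 where e2: "e2 \<in> hv T2 T" "e2 \<noteq> e" using pick[of "hv T2 T" "{e}"] h by auto
  obtain e1 where e1: "e1 \<in> hv T1 T" "e1 \<noteq> e" "e1 \<noteq> e2"
  proof -
    have "card {e, e2} \<le> 2" by (simp add: card_insert_if)
    then show ?thesis using pick[of "hv T1 T" "{e, e2}"] h that by blast
  qed
  obtain x w where x: "x \<in> e" "\<forall>v\<in>T2. R v x" "w \<in> T" "R w x" using e unfolding hv_def by blast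
  obtain x1 where x1: "x1 \<in> e1" "\<forall>v\<in>T1. R v x1" using e1 unfolding hv_def by blast
  obtain x2 where x2: "x2 \<in> e2" "\<forall>v\<in>T2. R v x2" using e2 unfolding hv_def by blast
  have eM: "e \<in> M" "e1 \<in> M" "e2 \<in> M" using e e1 e2 by (auto simp: hv_def)
  obtain d f where t: "T = {w, d, f}" "d \<noteq> w" "f \<noteq> w" "d \<noteq> f" using T_others[OF T(3) x(3)] .
  obtain a1 b1 c1 where t1: "T1 = {a1, b1, c1}" "a1 \<noteq> b1" "b1 \<noteq> c1" "a1 \<noteq> c1" using T_triple[OF T(1)] .
  obtain a2 b2 c2 where t2: "T2 = {a2, b2, c2}" "a2 \<noteq> b2" "b2 \<noteq> c2" "a2 \<noteq> c2" using T_triple[OF T(2)] .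
  let ?ts = "[(a1, d, f), (a2, w, x), (b1, c1, x1), (b2, c2, x2)]"
  have adj: "\<forall>(x, y, z)\<in>set ?ts. R x y \<and> R y z \<and> R x z"
    using nineD(1)[OF T(1,3) nn(1)] nineD(1)[OF T(2,3) nn(2)] x x1 x2 t t1 t2
      T_adj[OF T(1)] T_adj[OF T(2)] T_adj[OF T(3)] by simp
  have dT: "T1 \<inter> T2 = {}" "T1 \<inter> T = {}" "T2 \<inter> T = {}" using T disj_TT by auto
  have "{a1, b1, c1, a2, b2, c2, w, d, f} \<inter> {x, x1, x2} = {}"
    using disj_TM[OF T(1) eM(1)] disj_TM[OF T(1) eM(2)] disj_TM[OF T(1) eM(3)]
      disj_TM[OF T(2) eM(1)] disj_TM[OF T(2) eM(2)] disj_TM[OF T(2) eM(3)]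
      disj_TM[OF T(3) eM(1)] disj_TM[OF T(3) eM(2)] disj_TM[OF T(3) eM(3)] t t1 t2 x(1) x1(1) x2(1) by auto
  moreover have "x \<noteq> x1" "x \<noteq> x2" "x1 \<noteq> x2"
    using disj_MM[OF eM(1,2)] disj_MM[OF eM(1,3)] disj_MM[OF eM(2,3)] e1 e2 x(1) x1(1) x2(1) by auto
  ultimately have dist: "distinct (flat3 ?ts @ flat2 [])"
    using t t1 t2 dT by auto
  have sub: "set (flat3 ?ts) \<union> set (flat2 []) \<subseteq> \<Union>{T1, T2, T} \<union> \<Union>{e, e1, e2} \<union> I"
    using t t1 t2 x(1) x1(1) x2(1) by auto
  have "card {e, e1, e2} \<le> 3" "card {T1, T2, T} = 3"
    using T(4) by (simp_all add: card_insert_if)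
  then show False
    using exchange(1)[OF _ _ _ dist adj _ sub] T eM by simp
qed

end

section \<open>An edge of \<open>M\<close> against two triangles\<close>

context stable_cfg
begin

text \<open>The triangle \<open>{a, b, x}\<close> with \<open>x\<close> in \<open>I\<close> frees
  \<open>c\<close>, which would form a second triangle with \<open>e\<close>.\<close>

lemma big_not_rich:
  assumes "T \<in> \<T>" "big T a b c" "e \<in> M"
  shows "\<not> rich R c e"
proof
  assume r: "rich R c e"
  obtain p q where e: "e = {p, q}" "p \<noteq> q" "R p q" using M_pair[OF assms(3)] by metis
  have cp: "R c p" "R c q" using r e by (auto simp: rich_def)
  obtain x where x: "x \<in> I" "R a x" "R b x" using big_avoid[OF assms(2)] by metis
  have t: "T = {a, b, c}" "a \<noteq> b" "c \<noteq> a" "c \<noteq> b" using assms(2) unfolding big_def by simp_all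
  have ab: "R a b" using T_adj[OF assms(1)] t by simp
  show False
    using exchange(1)[of "{T}" "{e}" "[(a, b, x), (c, p, q)]" "[]"] assms(1,3) cp e x t ab
      disj_TM[OF assms(1,3)] disj_TI[OF assms(1)] disj_MI[OF assms(3)] by auto
qed

text \<open>Without rich incidences each of the six vertices is adjacent to at most one end of
  \<open>e\<close>. If all six are adjacent to one, then either some end has at least five of them,
  hence all of one triangle and part of the other, or both ends have at least two and
  \<open>e\<close> splits the six. With \<open>k > 0\<close> rich incidences the plain bound 6 + k
  is at most 5 + 2 k.\<close>

lemma ed_edge_nine:
  assumes T: "T \<in> \<T>" "T' \<in> \<T>" "T \<noteq> T'" and e: "e \<in> M"
  shows "ed R T e + ed R T' e \<le> 5 + of_bool (e \<in> hv T T') + of_bool (e \<in> hv T' T) +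
     of_bool (splits e (T \<union> T')) + 2 * ((\<Sum>v\<in>T. of_bool (rich R v e)) + (\<Sum>v\<in>T'. of_bool (rich R v e)))"
    (is "?l \<le> 5 + ?a + ?b + ?s + 2 * (?i + ?i')")
proof (cases "?i + ?i' \<ge> 1")
  case True
  have aux: "l \<le> 5 + of_bool A + of_bool B + of_bool C + 2 * k" if "l \<le> 6 + k" "k \<ge> 1"
    for l k :: int and A B C using that by (simp add: of_bool_def)
  have "?l \<le> 6 + (?i + ?i')" using ed_T_edge[OF T(1) e] ed_T_edge[OF T(2) e] by simp
  then show ?thesis using True by (rule aux)
next
  case False
  have nn: "?i \<ge> 0" "?i' \<ge> 0" by (auto intro!: sum_nonneg)
  with False have 0: "?i = 0" "?i' = 0" by linarith+
  then have nr: "\<not> rich R v e" if "v \<in> T \<union> T'" for v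
    using that T_facts(3)[OF T(1)] T_facts(3)[OF T(2)] by (auto simp: sum_nonneg_eq_0_iff)
  show ?thesis
  proof (cases "?l \<le> 5")
    case True
    then show ?thesis using nn by simp
  next
    case False
    then have l6: "?l = 6" using ed_T_edge[OF T(1) e] ed_T_edge[OF T(2) e] 0 by linarith
    obtain x y where xy: "e = {x, y}" "x \<noteq> y" using M_pair[OF e] by metis
    let ?S = "T \<union> T'"
    have finS: "finite ?S" using T_facts(3)[OF T(1)] T_facts(3)[OF T(2)] by simp
    have dT: "T \<inter> T' = {}" by (rule disj_TT[OF T])
    have cS: "card ?S = 6"
      using T_facts(2,3)[OF T(1)] T_facts(2,3)[OF T(2)] dT by (simp add: card_Un_disjoint)
    let ?X = "{v \<in> ?S. R v x}" and ?Y = "{v \<in> ?S. R v y}"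
    have dXY: "?X \<inter> ?Y = {}" using nr xy by (auto simp: rich_def)
    have "?l = ed R ?S e"
      using T_facts(3)[OF T(1)] T_facts(3)[OF T(2)] dT by (simp add: ed_Un_left)
    also have "\<dots> = ed R ?S {x} + ed R ?S {y}"
      using xy by (subst ed_split_right) simp
    also have "\<dots> = int (card ?X) + int (card ?Y)"
      using finS by (simp only: ed_point_right)
    finally have cXY: "card ?X + card ?Y = 6" using l6 by linarith
    have "card (?X \<union> ?Y) = 6" using cXY dXY finS by (subst card_Un_disjoint) auto
    then have XY: "?X \<union> ?Y = ?S" using cS finS by (intro card_subset_eq) auto
    have XYor: "R v x \<or> R v y" if "v \<in> ?S" for v
    proof -
      have "v \<in> ?X \<union> ?Y" unfolding XY by (rule that)
      then show ?thesis by blast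
    qed
    have few: "e \<in> hv T T' \<or> e \<in> hv T' T"
      if z: "z \<in> e" "card {v \<in> ?S. \<not> R v z} \<le> 1" for z
    proof -
      have "finite {v \<in> ?S. \<not> R v z}" using finS by simp
      then have "{v \<in> ?S. \<not> R v z} = {} \<or> (\<exists>w. {v \<in> ?S. \<not> R v z} = {w})"
        using z(2) card_0_eq card_1_singletonE le_neq_implies_less less_one by (metis (no_types, lifting))
      then obtain w where w: "{v \<in> ?S. \<not> R v z} \<subseteq> {w}" by blast
      have Rz: "R v z" if "v \<in> ?S" "v \<noteq> w" for v using w that by blast
      obtain t where t: "t \<in> T" "t \<noteq> w" using T_triple[OF T(1)] by (metis insertCI)
      obtain t' where t': "t' \<in> T'" "t' \<noteq> w" using T_triple[OF T(2)] by (metis insertCI)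
      consider "w \<notin> T" | "w \<notin> T'" using dT by blast
      then show ?thesis
      proof cases
        case 1
        then have "\<forall>v\<in>T. R v z" using Rz by blast
        moreover have "R t' z" using Rz t' by blast
        ultimately show ?thesis using e z(1) t'(1) unfolding hv_def by blast
      next
        case 2
        then have "\<forall>v\<in>T'. R v z" using Rz by blast
        moreover have "R t z" using Rz t by blast
        ultimately show ?thesis using e z(1) t(1) unfolding hv_def by blast
      qed
    qed
    have "?a + ?b + ?s \<ge> 1"
    proof (cases "card ?X \<le> 1 \<or> card ?Y \<le> 1")
      case True
      have "{v \<in> ?S. \<not> R v x} \<subseteq> ?Y" "{v \<in> ?S. \<not> R v y} \<subseteq> ?X" using XYor by blast+
      then have "card {v \<in> ?S. \<not> R v x} \<le> card ?Y" "card {v \<in> ?S. \<not> R v y} \<le> card ?X"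
        using finS by (intro card_mono; simp)+
      then have "e \<in> hv T T' \<or> e \<in> hv T' T"
        using True few[of x] few[of y] xy by fastforce
      then show ?thesis by (auto simp: of_bool_def)
    next
      case False
      have two: "\<exists>p q. p \<in> Z \<and> q \<in> Z \<and> p \<noteq> q" if "card Z \<ge> 2" for Z :: "'a set"
      proof (rule ccontr)
        assume "\<not> ?thesis"
        moreover have "finite Z" by (rule card_ge_0_finite) (use that in simp)
        ultimately have "card Z \<le> Suc 0" using card_le_Suc0_iff_eq by blast
        then show False using that by simp
      qed
      obtain a b where ab: "a \<in> ?X" "b \<in> ?X" "a \<noteq> b" using two[of ?X] False by auto
      obtain d f where df: "d \<in> ?Y" "f \<in> ?Y" "d \<noteq> f" using two[of ?Y] False by auto
      have n4: "distinct [a, b, d, f]" using ab df dXY by auto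
      have "card (?S - {a, b, d, f}) = 2"
        using cS n4 ab df finS by (subst card_Diff_subset) auto
      then obtain c g where cg: "?S - {a, b, d, f} = {c, g}" "c \<noteq> g" by (auto simp: card_2_iff)
      have cn: "c \<notin> {a, b, d, f}" "g \<notin> {a, b, d, f}" using cg by blast+
      have "{a, b, d, f} \<subseteq> ?S" using ab df by simp
      then have "?S = {a, b, d, f} \<union> {c, g}" using Diff_partition[of "{a, b, d, f}" ?S] unfolding cg by metis
      then have "?S = {a, b, c, d, f, g}" by auto
      moreover have "distinct [a, b, c, d, f, g]" using n4 cn cg(2) by auto
      ultimately have "splits e ?S" unfolding splits_def using xy(1) ab df by blast
      then show ?thesis by simp
    qed
    moreover have "l \<le> 5 + a + b + s + 2 * (j + j')"
      if "a + b + s \<ge> 1" "l = 6" "j \<ge> 0" "j' \<ge> 0" for a b s j j' l :: int using that by simp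
    ultimately show ?thesis using l6 nn by blast
  qed
qed

end

section \<open>Edge bounds when each triangle vertex is rich for at most two edges\<close>

locale nonrich_cfg = stable_cfg +
  assumes nonrich: "v \<in> \<Union>\<T> \<Longrightarrow> card {e \<in> M. rich R v e} \<le> 2"
begin

text \<open>The star of \<open>inc_cases\<close> has at most three members if its centre is an edge,
  and at most two if it is a vertex.\<close>

lemma inc_le3: "T \<in> \<T> \<Longrightarrow> inc T \<le> 3"
proof -
  assume T: "T \<in> \<T>"
  then show ?thesis
  proof (cases rule: inc_cases)
    case (1 e)
    have "inc T \<le> card (T \<times> {e})"
      unfolding inc_def using 1(2) T_facts(3)[OF T] by (intro card_mono) auto
    then show ?thesis using T_facts(2)[OF T] by (simp add: card_cartesian_product)
  next
    case (2 v)
    have "inc T \<le> card ({v} \<times> {e \<in> M. rich R v e})"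
      unfolding inc_def using 2(2) by (intro card_mono) auto
    then show ?thesis using nonrich[of v] 2(1) T by (simp add: card_cartesian_product) force
  qed
qed

text \<open>In a big triangle \<open>c\<close> is not rich, so a star centred at an edge also has at
  most two members.\<close>

lemma inc_big: "T \<in> \<T> \<Longrightarrow> isbig T \<Longrightarrow> inc T \<le> 2"
proof -
  assume T: "T \<in> \<T>" and "isbig T"
  then obtain a b c where b: "big T a b c" by (auto simp: isbig_def)
  from T show ?thesis
  proof (cases rule: inc_cases)
    case (1 e)
    have t: "T = {a, b, c}" "a \<noteq> b" "c \<noteq> a" "c \<noteq> b" using b unfolding big_def by simp_all
    have "{(v, e). v \<in> T \<and> e \<in> M \<and> rich R v e} \<subseteq> {a, b} \<times> {e}"
      using 1(2) big_not_rich[OF T b] t(1) by blast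
    then have "inc T \<le> card ({a, b} \<times> {e})"
      unfolding inc_def by (intro card_mono) auto
    then show ?thesis using t by (simp add: card_cartesian_product)
  next
    case (2 v)
    have "inc T \<le> card ({v} \<times> {e \<in> M. rich R v e})"
      unfolding inc_def using 2(2) by (intro card_mono) auto
    then show ?thesis using nonrich[of v] 2(1) T by (simp add: card_cartesian_product) force
  qed
qed

lemma ed_T_UM_le: "T \<in> \<T> \<Longrightarrow> ed R T (\<Union>M) \<le> 3 * m + 3"
  using ed_T_UM[of T] inc_le3[of T] by linarith

lemma ed_T_UM_big: "T \<in> \<T> \<Longrightarrow> isbig T \<Longrightarrow> ed R T (\<Union>M) \<le> 3 * m + 2"
  using ed_T_UM[of T] inc_big[of T] by linarith

text \<open>\<open>ed_edge_nine\<close> is summed over \<open>M\<close>. The constant is 2 + 2 + 1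
  for heavy and splitting edges, plus 2 (3 + 3) for rich incidences.\<close>

lemma light_or_heavy:
  assumes T: "T \<in> \<T>" "T' \<in> \<T>" "T \<noteq> T'" and 9: "ed R T T' = 9" "\<not> exch T T'"
    and h: "card (hv T T') \<le> 2" "card (hv T' T) \<le> 2"
  shows "ed R T (\<Union>M) + ed R T' (\<Union>M) \<le> 5 * m + 17"
proof -
  have s: "card {e \<in> M. splits e (T \<union> T')} \<le> 1" using 9 T(3) by (auto simp: exch_def)
  have hvM: "hv T T' \<subseteq> M" "hv T' T \<subseteq> M" by (auto simp: hv_def)
  have of_b: "(\<Sum>e\<in>M. of_bool (P e)) = int (card {e \<in> M. P e})" for P
    by (simp add: Int_def)
  have "ed R T (\<Union>M) + ed R T' (\<Union>M) = (\<Sum>e\<in>M. ed R T e + ed R T' e)"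
    by (simp add: ed_UM_right sum.distrib)
  also have "\<dots> \<le> (\<Sum>e\<in>M. 5 + of_bool (e \<in> hv T T') + of_bool (e \<in> hv T' T) +
     of_bool (splits e (T \<union> T')) + 2 * ((\<Sum>v\<in>T. of_bool (rich R v e)) + (\<Sum>v\<in>T'. of_bool (rich R v e))))"
    by (intro sum_mono ed_edge_nine T)
  also have "\<dots> = 5 * m + int (card {e \<in> M. e \<in> hv T T'}) + int (card {e \<in> M. e \<in> hv T' T})
     + int (card {e \<in> M. splits e (T \<union> T')}) + 2 * (int (inc T) + int (inc T'))"
    by (simp only: sum.distrib sum_distrib_left[symmetric] inc_eq[OF T(1)] inc_eq[OF T(2)] of_b) simp
  also have "{e \<in> M. e \<in> hv T T'} = hv T T'" using hvM by blast
  also have "{e \<in> M. e \<in> hv T' T} = hv T' T" using hvM by blast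
  finally show ?thesis using s h inc_le3[OF T(1)] inc_le3[OF T(2)]
    by (simp only: zle_int[symmetric]) simp
qed

text \<open>\<open>wt T\<close> measures how much \<open>T\<close> loses in adjacencies to \<open>I\<close>, compared with \<open>2 i\<close>. Two triangles with
  nine adjacencies have positive total weight by \<open>big_nine_I\<close>, so this loss pays for them.\<close>

definition wt :: "'a set \<Rightarrow> int" where
  "wt T = (if ed R T I = 0 then 2 else if isbig T then 0 else 1)"

definition nines :: "('a set \<times> 'a set) set" where
  "nines = {(T, T'). T \<in> \<T> \<and> T' \<in> \<T> \<and> T \<noteq> T' \<and> ed R T T' = 9}"

lemma fin_nines: "finite nines"
  by (rule finite_subset[of _ "\<T> \<times> \<T>"]) (auto simp: nines_def)

text \<open>A triangle of weight 0 is big, so its partner in a pair of \<open>nines\<close> has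
  weight 2 by \<open>big_nine_I\<close>. Otherwise the first triangle itself has positive weight. In
  this way at most \<open>r\<close> ordered pairs are charged to each unit of weight.\<close>

lemma card_nines: "int (card nines) \<le> r * (\<Sum>T\<in>\<T>. wt T)"
proof -
  let ?N0 = "{T \<in> \<T>. ed R T I = 0}" and ?N1 = "{T \<in> \<T>. ed R T I \<noteq> 0 \<and> \<not> isbig T}"
  have "nines \<subseteq> (?N0 \<times> \<T> \<union> \<T> \<times> ?N0) \<union> ?N1 \<times> \<T>"
    using big_nine_I unfolding nines_def by blast
  then have "card nines \<le> card ((?N0 \<times> \<T> \<union> \<T> \<times> ?N0) \<union> ?N1 \<times> \<T>)"
    by (intro card_mono) auto
  also have "\<dots> \<le> card (?N0 \<times> \<T>) + card (\<T> \<times> ?N0) + card (?N1 \<times> \<T>)"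
    by (meson card_Un_le add_le_mono1 le_trans)
  also have "\<dots> = card \<T> * (2 * card ?N0 + card ?N1)"
    by (simp add: card_cartesian_product algebra_simps)
  finally have "int (card nines) \<le> int (card \<T> * (2 * card ?N0 + card ?N1))" by linarith
  moreover have "(\<Sum>T\<in>\<T>. wt T) = (\<Sum>T\<in>\<T>. 2 * of_bool (ed R T I = 0) + of_bool (ed R T I \<noteq> 0 \<and> \<not> isbig T))"
    by (intro sum.cong) (auto simp: wt_def)
  then have "(\<Sum>T\<in>\<T>. wt T) = 2 * int (card ?N0) + int (card ?N1)"
    by (simp add: sum.distrib sum_distrib_left[symmetric] Int_def)
  ultimately show ?thesis by simp
qed

lemma pair_sum:
  assumes "\<U> \<subseteq> \<T>"
  shows "(\<Sum>T\<in>\<U>. \<Sum>T'\<in>\<U>. ed R T T') \<le> 8 * int (card \<U>) * int (card \<U>) - 2 * int (card \<U>)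
     + int (card (nines \<inter> \<U> \<times> \<U>))"
proof -
  have fin: "finite \<U>" by (rule finite_subset[OF assms finT])
  have "(\<Sum>T\<in>\<U>. \<Sum>T'\<in>\<U>. ed R T T') \<le> (\<Sum>T\<in>\<U>. \<Sum>T'\<in>\<U>. 8 - 2 * of_bool (T = T') + of_bool ((T, T') \<in> nines))"
  proof (intro sum_mono)
    fix T T' assume "T \<in> \<U>" "T' \<in> \<U>"
    then have T: "T \<in> \<T>" "T' \<in> \<T>" using assms by auto
    show "ed R T T' \<le> 8 - 2 * of_bool (T = T') + of_bool ((T, T') \<in> nines)"
      using ed_TT_same[OF T(1)] ed_TT_le9[OF T] T by (cases "T = T'") (auto simp: nines_def)
  qed
  also have "\<dots> = 8 * int (card \<U>) * int (card \<U>) - 2 * int (card \<U>)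
      + (\<Sum>T\<in>\<U>. \<Sum>T'\<in>\<U>. of_bool ((T, T') \<in> nines))"
    using fin by (simp add: sum.distrib sum_subtractf of_bool_def sum.delta' sum_distrib_left[symmetric] algebra_simps)
  also have "(\<Sum>T\<in>\<U>. \<Sum>T'\<in>\<U>. of_bool ((T, T') \<in> nines)) = (\<Sum>z\<in>\<U> \<times> \<U>. of_bool (z \<in> nines))"
    unfolding sum.cartesian_product by (rule sum.cong) auto
  also have "\<dots> = int (card (nines \<inter> \<U> \<times> \<U>))"
    using fin by (simp add: Int_commute)
  finally show ?thesis .
qed

text \<open>Each unit of weight has to save \<open>r\<close>, the number of pairs charged to it by
  \<open>card_nines\<close>; for weight 1 this is exactly the assumption on \<open>i\<close>. In
  terms of n = 3 r + 2 m + i, twice the bound is n^2 + 8 r^2 + 4 r - (r - i)^2. At i = r this is the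
  count for a balanced complete bipartite graph with a clique on 2 r + 1 vertices inside one
  side.\<close>

lemma exact_bound:
  assumes "2 * i \<ge> r + 4"
  shows "ed R V V \<le> 2 * m * (m + i) + 2 * r * (3 * m + 2 * i + 2) + 8 * r * r - 2 * r"
proof -
  have per: "2 * ed R T (\<Union>M) + 2 * ed R T I \<le> 2 * (3 * m + 2 * i + 2) - r * wt T" if T: "T \<in> \<T>" for T
  proof -
    consider "ed R T I = 0" | "ed R T I \<noteq> 0" "isbig T" | "ed R T I \<noteq> 0" "\<not> isbig T" by blast
    then show ?thesis
    proof cases
      case 1
      then show ?thesis using ed_T_UM_le[OF T] assms by (simp add: wt_def)
    next
      case 2
      then show ?thesis using ed_T_UM_big[OF T] big_ed_I(1)[OF T] by (simp add: wt_def)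
    next
      case 3
      then show ?thesis using ed_T_UM_le[OF T] ed_T_I(2)[OF T] assms by (simp add: wt_def)
    qed
  qed
  have "2 * (\<Sum>T\<in>\<T>. ed R T (\<Union>M)) + 2 * (\<Sum>T\<in>\<T>. ed R T I) = (\<Sum>T\<in>\<T>. 2 * ed R T (\<Union>M) + 2 * ed R T I)"
    by (simp add: sum.distrib sum_distrib_left)
  also have "\<dots> \<le> (\<Sum>T\<in>\<T>. 2 * (3 * m + 2 * i + 2) - r * wt T)"
    by (intro sum_mono per)
  also have "\<dots> = 2 * r * (3 * m + 2 * i + 2) - r * (\<Sum>T\<in>\<T>. wt T)"
    by (simp add: sum_subtractf sum_distrib_left[symmetric])
  finally have "2 * (\<Sum>T\<in>\<T>. ed R T (\<Union>M)) + 2 * (\<Sum>T\<in>\<T>. ed R T I)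
      \<le> 2 * r * (3 * m + 2 * i + 2) - r * (\<Sum>T\<in>\<T>. wt T)" .
  moreover have "nines \<inter> \<T> \<times> \<T> = nines" by (auto simp: nines_def)
  then have "(\<Sum>T\<in>\<T>. \<Sum>T'\<in>\<T>. ed R T T') \<le> 8 * r * r - 2 * r + r * (\<Sum>T\<in>\<T>. wt T)"
    using pair_sum[of \<T>] card_nines by simp
  ultimately show ?thesis using ed_total by linarith
qed

text \<open>Allowing nine adjacencies everywhere is good enough while \<open>r\<close> is bounded,
  since the terms in \<open>r\<close> are then small against \<open>n\<close>.\<close>

lemma crude_bound:
  "ed R V V \<le> 9 * r * r + 2 * r * (3 * m + 3) + 2 * r * (2 * i + 1) + 2 * m * (m + i)"
proof -
  have "(\<Sum>T\<in>\<T>. \<Sum>T'\<in>\<T>. ed R T T') \<le> (\<Sum>T\<in>\<T>. \<Sum>T'\<in>\<T>. 9)" by (intro sum_mono ed_TT_le9)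
  moreover have "(\<Sum>T\<in>\<T>. ed R T (\<Union>M)) \<le> (\<Sum>T\<in>\<T>. 3 * m + 3)" by (intro sum_mono ed_T_UM_le)
  moreover have "(\<Sum>T\<in>\<T>. ed R T I) \<le> (\<Sum>T\<in>\<T>. 2 * i + 1)" by (intro sum_mono ed_T_I(1))
  ultimately show ?thesis using ed_total by simp
qed

end

section \<open>Disjoint exchangeable pairs, light triangles and the rough bound\<close>

context nonrich_cfg
begin

text \<open>A matching in the graph of exchangeable pairs, each pair taken in one of its two
  orders.\<close>

definition matched :: "('a set \<times> 'a set) set \<Rightarrow> bool" where
  "matched Q \<longleftrightarrow> (\<forall>p\<in>Q. fst p \<in> \<T> \<and> snd p \<in> \<T> \<and> exch (fst p) (snd p)) \<and>
     (\<forall>p\<in>Q. \<forall>q\<in>Q. p \<noteq> q \<longrightarrow> {fst p, snd p} \<inter> {fst q, snd q} = {})"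

definition supp :: "('a set \<times> 'a set) set \<Rightarrow> 'a set set" where
  "supp Q = (\<Union>p\<in>Q. {fst p, snd p})"

lemma matchedD:
  assumes "matched Q"
  shows "\<And>p. p \<in> Q \<Longrightarrow> fst p \<in> \<T>" "\<And>p. p \<in> Q \<Longrightarrow> snd p \<in> \<T>" "\<And>p. p \<in> Q \<Longrightarrow> exch (fst p) (snd p)"
    "\<And>p q. p \<in> Q \<Longrightarrow> q \<in> Q \<Longrightarrow> p \<noteq> q \<Longrightarrow> {fst p, snd p} \<inter> {fst q, snd q} = {}"
  using assms unfolding matched_def by blast+

lemma matched_max:
  "\<exists>Q. finite Q \<and> matched Q \<and> (\<forall>T\<in>\<T> - supp Q. \<forall>T'\<in>\<T> - supp Q. \<not> exch T T')"
proof -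
  let ?F = "{Q. Q \<subseteq> \<T> \<times> \<T> \<and> matched Q}"
  have "?F \<subseteq> Pow (\<T> \<times> \<T>)" by blast
  then have "finite ?F" by (rule finite_subset) simp
  moreover have "{} \<in> ?F" by (simp add: matched_def)
  ultimately obtain Q where "Q \<in> ?F" and max: "\<forall>Q'\<in>?F. Q \<subseteq> Q' \<longrightarrow> Q = Q'"
    using finite_has_maximal[of ?F] by blast
  then have Q: "Q \<subseteq> \<T> \<times> \<T>" "matched Q" by simp_all
  have "\<not> exch T T'" if T: "T \<in> \<T> - supp Q" "T' \<in> \<T> - supp Q" for T T'
  proof
    assume ex: "exch T T'"
    have dis: "{T, T'} \<inter> {fst q, snd q} = {}" if "q \<in> Q" for q
    proof -
      have "fst q \<in> supp Q" "snd q \<in> supp Q" using that unfolding supp_def by blast+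
      then show ?thesis using T by blast
    qed
    have "matched (insert (T, T') Q)"
      unfolding matched_def
    proof (intro conjI ballI impI)
      fix p assume "p \<in> insert (T, T') Q"
      then show "fst p \<in> \<T>" "snd p \<in> \<T>" "exch (fst p) (snd p)"
        using matchedD(1-3)[OF Q(2)] T ex by (elim insertE; simp)+
      fix q assume "q \<in> insert (T, T') Q" "p \<noteq> q"
      with \<open>p \<in> insert (T, T') Q\<close> consider "p \<in> Q" "q \<in> Q" | "p = (T, T')" "q \<in> Q" | "q = (T, T')" "p \<in> Q"
        by blast
      then show "{fst p, snd p} \<inter> {fst q, snd q} = {}"
      proof cases
        case 1
        then show ?thesis using matchedD(4)[OF Q(2)] \<open>p \<noteq> q\<close> by blast
      next
        case 2
        then show ?thesis using dis[of q] by simp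
      next
        case 3
        then show ?thesis using dis[of p] by (simp add: Int_commute)
      qed
    qed
    moreover have "insert (T, T') Q \<subseteq> \<T> \<times> \<T>" using Q(1) T by simp
    ultimately have "Q = insert (T, T') Q" using max by blast
    then have "(T, T') \<in> Q" by blast
    then show False using dis[of "(T, T')"] by simp
  qed
  moreover have "finite Q" using Q(1) finite_subset[of Q "\<T> \<times> \<T>"] by simp
  ultimately show ?thesis using Q(2) by blast
qed

lemma sum_supp:
  assumes "finite Q" "matched Q"
  shows "(\<Sum>T\<in>supp Q. f T) = (\<Sum>p\<in>Q. f (fst p) + f (snd p) :: int)"
proof -
  have "(\<Sum>T\<in>supp Q. f T) = (\<Sum>p\<in>Q. \<Sum>T\<in>{fst p, snd p}. f T)"
    unfolding supp_def by (rule sum.UNION_disjoint) (use assms(1) matchedD(4)[OF assms(2)] in auto)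
  also have "\<dots> = (\<Sum>p\<in>Q. f (fst p) + f (snd p))"
    using matchedD(3)[OF assms(2)] by (intro sum.cong) (auto simp: exch_def)
  finally show ?thesis .
qed

lemma card_supp: "finite Q \<Longrightarrow> matched Q \<Longrightarrow> int (card (supp Q)) = 2 * int (card Q)"
  using sum_supp[of Q "\<lambda>_. 1"] by simp

text \<open>By \<open>exch_two\<close> at most one pair of \<open>Q\<close> has more than 16
  adjacencies with \<open>T\<close>, and none has more than 18.\<close>

lemma supp_row_avoiding:
  assumes "finite Q" "matched Q" "T \<in> \<T>" "T \<notin> supp Q"
  shows "(\<Sum>T'\<in>supp Q. ed R T T') \<le> 16 * int (card Q) + 2"
proof -
  let ?h = "\<lambda>p. ed R T (fst p) + ed R T (snd p)"
  have hU: "?h p = ed R T (fst p \<union> snd p)" if "p \<in> Q" for p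
  proof -
    have p: "fst p \<in> \<T>" "snd p \<in> \<T>" "fst p \<noteq> snd p"
      using matchedD(1-3)[OF assms(2) that] by (auto simp: exch_def)
    show ?thesis
      using T_facts(3)[OF p(1)] T_facts(3)[OF p(2)] disj_TT[OF p] by (simp add: ed_Un_right)
  qed
  have h18: "?h p \<le> 18" if "p \<in> Q" for p
    using ed_TT_le9[OF assms(3) matchedD(1)[OF assms(2) that]]
      ed_TT_le9[OF assms(3) matchedD(2)[OF assms(2) that]] by simp
  have uniq: "p = q" if pq: "p \<in> Q" "q \<in> Q" "?h p \<ge> 17" "?h q \<ge> 17" for p q
  proof (rule ccontr)
    assume ne: "p \<noteq> q"
    have d: "distinct [fst p, snd p, fst q, snd q, T]"
      using matchedD(3,4)[OF assms(2)] pq(1,2) ne assms(4) by (auto simp: exch_def supp_def)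
    show False
      using exch_two[OF matchedD(1,2)[OF assms(2) pq(1)] matchedD(1,2)[OF assms(2) pq(2)] assms(3) d
          matchedD(3)[OF assms(2) pq(1)] matchedD(3)[OF assms(2) pq(2)]] pq(3,4) hU pq(1,2) by simp
  qed
  have "(\<Sum>T'\<in>supp Q. ed R T T') = (\<Sum>p\<in>Q. ?h p)" by (rule sum_supp[OF assms(1,2)])
  also have "\<dots> \<le> (\<Sum>p\<in>Q. 16 + 2 * of_bool (?h p \<ge> 17))"
  proof (rule sum_mono)
    fix p assume "p \<in> Q"
    then show "?h p \<le> 16 + 2 * of_bool (?h p \<ge> 17)" using h18[of p] by auto
  qed
  also have "\<dots> = 16 * int (card Q) + 2 * int (card {p \<in> Q. ?h p \<ge> 17})"
    using assms(1) by (simp add: sum.distrib sum_distrib_left[symmetric] Int_def)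
  also have "card {p \<in> Q. ?h p \<ge> 17} \<le> 1"
    using uniq assms(1) card_le_Suc0_iff_eq[of "{p \<in> Q. ?h p \<ge> 17}"] by fastforce
  finally show ?thesis by simp
qed

text \<open>A pair that contains \<open>T\<close> contributes at most 6 + 9 = 15, less than the 16
  allowed for it, so it can be removed from \<open>Q\<close>.\<close>

lemma supp_row:
  assumes "finite Q" "matched Q" "T \<in> \<T>"
  shows "(\<Sum>T'\<in>supp Q. ed R T T') \<le> 16 * int (card Q) + 2"
proof (cases "T \<in> supp Q")
  case True
  then obtain p where p: "p \<in> Q" "T = fst p \<or> T = snd p" unfolding supp_def by auto
  let ?Q = "Q - {p}"
  have m: "matched ?Q" using assms(2) unfolding matched_def by blast
  have "T \<notin> supp ?Q" using matchedD(4)[OF assms(2), of p] p unfolding supp_def by fastforce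
  then have "(\<Sum>T'\<in>supp ?Q. ed R T T') \<le> 16 * int (card ?Q) + 2"
    using supp_row_avoiding[OF _ m assms(3)] assms(1) by simp
  moreover have "(\<Sum>T'\<in>supp Q. ed R T T') = (ed R T (fst p) + ed R T (snd p)) + (\<Sum>T'\<in>supp ?Q. ed R T T')"
    unfolding sum_supp[OF assms(1,2)] sum_supp[OF finite_Diff[OF assms(1)] m]
    by (rule sum.remove[OF assms(1) p(1)])
  moreover have "ed R T (fst p) + ed R T (snd p) \<le> 15"
    using p(2) ed_TT_same[OF assms(3)] ed_TT_le9[OF assms(3) matchedD(1)[OF assms(2) p(1)]]
      ed_TT_le9[OF assms(3) matchedD(2)[OF assms(2) p(1)]] by auto
  moreover have "int (card Q) = int (card ?Q) + 1"
    using card.remove[OF assms(1) p(1)] by simp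
  ultimately show ?thesis by simp
next
  case False
  then show ?thesis by (rule supp_row_avoiding[OF assms])
qed

text \<open>The set \<open>light\<close> covers all pairs of triangles with nine adjacencies that are neither
  exchangeable nor heavy.\<close>

definition light :: "'a set set" where
  "light = {T \<in> \<T>. 2 * ed R T (\<Union>M) \<le> 5 * m + 17}"

text \<open>By \<open>heavy_unique\<close> the second triangle determines the first.\<close>

lemma heavy_card:
  "card {(T, T'). (T, T') \<in> nines \<and> card (hv T T') \<ge> 3} \<le> card \<T>"
proof (rule card_inj_on_le)
  show "inj_on snd {(T, T'). (T, T') \<in> nines \<and> card (hv T T') \<ge> 3}"
  proof (rule inj_onI)
    fix p q
    assume p: "p \<in> {(T, T'). (T, T') \<in> nines \<and> card (hv T T') \<ge> 3}"
      and q: "q \<in> {(T, T'). (T, T') \<in> nines \<and> card (hv T T') \<ge> 3}" and eq: "snd p = snd q"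
    obtain T1 T where pp: "p = (T1, T)" by (cases p)
    obtain T2 where qq: "q = (T2, T)" using eq pp by (cases q) simp
    show "p = q"
    proof (rule ccontr)
      assume "p \<noteq> q"
      then have d: "distinct [T1, T2, T]" using p q pp qq by (auto simp: nines_def)
      show False
        using heavy_unique[OF _ _ _ d] p q pp qq by (auto simp: nines_def)
    qed
  qed
qed (auto simp: nines_def)

text \<open>Such a pair is heavy in one of its two orders, which allows \<open>2 * r\<close> pairs,
  or it meets \<open>light\<close>. With l light triangles, r^2 - (r - l)^2 ordered pairs meet
  \<open>light\<close>.\<close>

lemma nonexch_nines_card:
  assumes "\<U> \<subseteq> \<T>" "\<And>T T'. T \<in> \<U> \<Longrightarrow> T' \<in> \<U> \<Longrightarrow> \<not> exch T T'"
  shows "int (card (nines \<inter> \<U> \<times> \<U>)) \<le> 2 * r + 2 * r * int (card light) - int (card light) ^ 2"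
proof -
  let ?H = "{(T, T'). (T, T') \<in> nines \<and> card (hv T T') \<ge> 3}"
  let ?C = "(\<T> - light) \<times> (\<T> - light)"
  have fH: "finite ?H" by (rule finite_subset[OF _ fin_nines]) auto
  have sub: "nines \<inter> \<U> \<times> \<U> \<subseteq> ?H \<union> prod.swap ` ?H \<union> (\<T> \<times> \<T> - ?C)"
  proof
    fix z assume z: "z \<in> nines \<inter> \<U> \<times> \<U>"
    obtain T T' where zz: "z = (T, T')" by (cases z)
    have T: "T \<in> \<T>" "T' \<in> \<T>" "T \<noteq> T'" "ed R T T' = 9" "\<not> exch T T'"
      using z zz assms by (auto simp: nines_def)
    have sw: "(T', T) \<in> nines" using T nine_commute by (auto simp: nines_def)
    consider "card (hv T T') \<ge> 3" | "card (hv T' T) \<ge> 3" | "card (hv T T') \<le> 2" "card (hv T' T) \<le> 2"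
      by linarith
    then show "z \<in> ?H \<union> prod.swap ` ?H \<union> (\<T> \<times> \<T> - ?C)"
    proof cases
      case 1
      then show ?thesis using z zz by simp
    next
      case 2
      then have "(T', T) \<in> ?H" using sw by simp
      then have "prod.swap (T', T) \<in> prod.swap ` ?H" by (rule imageI)
      then show ?thesis using zz by simp
    next
      case 3
      then have "ed R T (\<Union>M) + ed R T' (\<Union>M) \<le> 5 * m + 17" by (rule light_or_heavy[OF T])
      then have "T \<in> light \<or> T' \<in> light" using T by (auto simp: light_def)
      then show ?thesis using zz T by simp
    qed
  qed
  have fin: "finite light" "light \<subseteq> \<T>" by (auto simp: light_def)
  have "card (nines \<inter> \<U> \<times> \<U>) \<le> card (?H \<union> prod.swap ` ?H \<union> (\<T> \<times> \<T> - ?C))"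
    using fH by (intro card_mono[OF _ sub]) auto
  also have "\<dots> \<le> card ?H + card (prod.swap ` ?H) + card (\<T> \<times> \<T> - ?C)"
    by (meson card_Un_le add_le_mono1 le_trans)
  also have "\<dots> \<le> card \<T> + card \<T> + card (\<T> \<times> \<T> - ?C)"
    using heavy_card card_image_le[OF fH, of prod.swap] by linarith
  finally have "int (card (nines \<inter> \<U> \<times> \<U>)) \<le> 2 * r + int (card (\<T> \<times> \<T> - ?C))" by simp
  moreover have "int (card (\<T> \<times> \<T> - ?C)) = r * r - (r - int (card light)) * (r - int (card light))"
  proof -
    have "card (\<T> \<times> \<T> - ?C) = card (\<T> \<times> \<T>) - card ?C" by (rule card_Diff_subset) auto
    moreover have "card ?C \<le> card (\<T> \<times> \<T>)" by (rule card_mono) auto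
    ultimately have "int (card (\<T> \<times> \<T> - ?C)) = int (card (\<T> \<times> \<T>)) - int (card ?C)" by simp
    moreover have "int (card (\<T> - light)) = r - int (card light)"
      using fin card_mono[OF finT fin(2)] by (simp add: card_Diff_subset of_nat_diff)
    ultimately show ?thesis by (simp add: card_cartesian_product)
  qed
  ultimately show ?thesis by (simp add: algebra_simps power2_eq_square)
qed

text \<open>\<open>l\<close> is the number of light triangles, \<open>W\<close> the total weight,
  and \<open>g\<close> counts the pairs in \<open>nines\<close> outside a maximal family of disjoint
  exchangeable pairs. Within this family a row of the double sum exceeds 8 per triangle by at most 2
  in all, so only the pairs in \<open>g\<close> are a quadratic gain.\<close>

lemma rough_bound:
  "\<exists>g l W. 0 \<le> g \<and> g \<le> r * W \<and> g \<le> 2 * r + 2 * r * l - l ^ 2 \<and> 0 \<le> l \<and> l \<le> r \<and> 0 \<le> W \<and> W \<le> 2 * r \<and>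
    ed R V V \<le> 8 * r * r + 2 * r + g + (2 * r * (3 * m + 3) - l * (m - 11))
      + (2 * r * (2 * i + 1) - 2 * (i - 1) * W) + 2 * m * (m + i)"
proof -
  obtain Q where Q: "finite Q" "matched Q" "\<forall>T\<in>\<T> - supp Q. \<forall>T'\<in>\<T> - supp Q. \<not> exch T T'"
    using matched_max by blast
  let ?S = "supp Q" and ?U = "\<T> - supp Q"
  have S: "?S \<subseteq> \<T>" using matchedD(1,2)[OF Q(2)] unfolding supp_def by blast
  then have finS: "finite ?S" using finite_subset[OF _ finT] by blast
  let ?s = "int (card ?S)" and ?u = "int (card ?U)"
  have su: "r = ?s + ?u"
    using S finS card_mono[OF finT S] by (simp add: card_Diff_subset of_nat_diff)
  have s2: "?s = 2 * int (card Q)" by (rule card_supp[OF Q(1,2)])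
  define g where "g = int (card (nines \<inter> ?U \<times> ?U))"
  define l where "l = int (card light)"
  define W where "W = (\<Sum>T\<in>\<T>. wt T)"
  have row: "(\<Sum>T'\<in>?S. ed R T T') \<le> 8 * ?s + 2" if "T \<in> \<T>" for T
    using supp_row[OF Q(1,2) that] s2 by simp
  have split: "(\<Sum>T\<in>\<T>. f T) = (\<Sum>T\<in>?S. f T) + (\<Sum>T\<in>?U. f T)" for f :: "'a set \<Rightarrow> int"
    using sum.subset_diff[OF S finT, of f] by simp
  have "(\<Sum>T\<in>\<T>. \<Sum>T'\<in>\<T>. ed R T T') = (\<Sum>T\<in>\<T>. \<Sum>T'\<in>?S. ed R T T') + (\<Sum>T\<in>\<T>. \<Sum>T'\<in>?U. ed R T T')"
    by (subst split) (simp add: sum.distrib)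
  also have "(\<Sum>T\<in>\<T>. \<Sum>T'\<in>?U. ed R T T') = (\<Sum>T\<in>?S. \<Sum>T'\<in>?U. ed R T T') + (\<Sum>T\<in>?U. \<Sum>T'\<in>?U. ed R T T')"
    by (rule split)
  also have "(\<Sum>T\<in>?S. \<Sum>T'\<in>?U. ed R T T') = (\<Sum>T'\<in>?U. \<Sum>T\<in>?S. ed R T' T)"
    by (subst sum.swap) (simp add: ed_commute[OF symR])
  finally have "(\<Sum>T\<in>\<T>. \<Sum>T'\<in>\<T>. ed R T T') = (\<Sum>T\<in>\<T>. \<Sum>T'\<in>?S. ed R T T')
     + ((\<Sum>T'\<in>?U. \<Sum>T\<in>?S. ed R T' T) + (\<Sum>T\<in>?U. \<Sum>T'\<in>?U. ed R T T'))" .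
  moreover have "(\<Sum>T\<in>\<T>. \<Sum>T'\<in>?S. ed R T T') \<le> (\<Sum>T\<in>\<T>. 8 * ?s + 2)"
    by (intro sum_mono row)
  moreover have "(\<Sum>T'\<in>?U. \<Sum>T\<in>?S. ed R T' T) \<le> (\<Sum>T\<in>?U. 8 * ?s + 2)"
    by (intro sum_mono row) auto
  moreover have "(\<Sum>T\<in>?U. \<Sum>T'\<in>?U. ed R T T') \<le> 8 * ?u * ?u - 2 * ?u + g"
    using pair_sum[of ?U] by (simp add: g_def)
  ultimately have "(\<Sum>T\<in>\<T>. \<Sum>T'\<in>\<T>. ed R T T') \<le> r * (8 * ?s + 2) + (?u * (8 * ?s + 2) + (8 * ?u * ?u - 2 * ?u + g))"
    by simp
  also have "\<dots> = 8 * r * r + 2 * r + g" unfolding su by (simp add: algebra_simps)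
  finally have TT: "(\<Sum>T\<in>\<T>. \<Sum>T'\<in>\<T>. ed R T T') \<le> 8 * r * r + 2 * r + g" .
  have "2 * (\<Sum>T\<in>\<T>. ed R T (\<Union>M)) = (\<Sum>T\<in>\<T>. 2 * ed R T (\<Union>M))" by (rule sum_distrib_left)
  \<comment> \<open>A light triangle loses 2 (3 m + 3) - (5 m + 17) = m - 11.\<close>
  also have "\<dots> \<le> (\<Sum>T\<in>\<T>. 2 * (3 * m + 3) - of_bool (T \<in> light) * (m - 11))"
  proof (rule sum_mono)
    fix T assume T: "T \<in> \<T>"
    show "2 * ed R T (\<Union>M) \<le> 2 * (3 * m + 3) - of_bool (T \<in> light) * (m - 11)"
      using ed_T_UM_le[OF T] by (cases "T \<in> light") (auto simp: light_def)
  qed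
  also have "\<dots> = 2 * r * (3 * m + 3) - l * (m - 11)"
  proof -
    have "{T \<in> \<T>. T \<in> light} = light" by (auto simp: light_def)
    then have "(\<Sum>T\<in>\<T>. of_bool (T \<in> light)) = l" by (simp add: l_def Int_def)
    then have "(\<Sum>T\<in>\<T>. of_bool (T \<in> light) * (m - 11)) = l * (m - 11)"
      by (simp only: sum_distrib_right[symmetric])
    then show ?thesis by (simp only: sum_subtractf) simp
  qed
  finally have TM: "2 * (\<Sum>T\<in>\<T>. ed R T (\<Union>M)) \<le> 2 * r * (3 * m + 3) - l * (m - 11)" .
  have "2 * (\<Sum>T\<in>\<T>. ed R T I) = (\<Sum>T\<in>\<T>. 2 * ed R T I)" by (rule sum_distrib_left)
  also have "\<dots> \<le> (\<Sum>T\<in>\<T>. 2 * (2 * i + 1) - 2 * (i - 1) * wt T)"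
  proof (rule sum_mono)
    fix T assume T: "T \<in> \<T>"
    consider "ed R T I = 0" | "ed R T I \<noteq> 0" "isbig T" | "ed R T I \<noteq> 0" "\<not> isbig T" by blast
    then show "2 * ed R T I \<le> 2 * (2 * i + 1) - 2 * (i - 1) * wt T"
    proof cases
      case 1
      then show ?thesis by (simp add: wt_def)
    next
      case 2
      then show ?thesis using big_ed_I(1)[OF T] by (simp add: wt_def)
    next
      case 3
      then have "I \<noteq> {}" by auto
      then have "i \<ge> 1" using I_pos by blast
      \<comment> \<open>For \<open>i = 1\<close> only the weaker bound of \<open>ed_T_I\<close> is
        available, but then the factor \<open>i - 1\<close> vanishes.\<close>
      then show ?thesis using 3 ed_T_I[OF T] by (cases "i \<ge> 2") (simp_all add: wt_def)
    qed
  qed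
  also have "\<dots> = 2 * r * (2 * i + 1) - 2 * (i - 1) * W"
    by (simp add: W_def sum_subtractf sum_distrib_left)
  finally have TI: "2 * (\<Sum>T\<in>\<T>. ed R T I) \<le> 2 * r * (2 * i + 1) - 2 * (i - 1) * W" .
  have "g \<le> int (card nines)"
    unfolding g_def using fin_nines by (simp add: card_mono)
  then have gW: "g \<le> r * W" using card_nines by (simp add: W_def)
  have gl: "g \<le> 2 * r + 2 * r * l - l ^ 2"
    unfolding g_def l_def using Q(3) by (intro nonexch_nines_card) auto
  have "0 \<le> W" unfolding W_def by (intro sum_nonneg) (simp add: wt_def)
  moreover have "W \<le> (\<Sum>T\<in>\<T>. 2)" unfolding W_def by (intro sum_mono) (simp add: wt_def)
  ultimately have W: "0 \<le> W" "W \<le> 2 * r" by simp_all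
  have l: "0 \<le> l" "l \<le> r" unfolding l_def light_def by (auto intro: card_mono)
  have "ed R V V \<le> 8 * r * r + 2 * r + g + (2 * r * (3 * m + 3) - l * (m - 11))
      + (2 * r * (2 * i + 1) - 2 * (i - 1) * W) + 2 * m * (m + i)"
    using ed_total TT TM TI by linarith
  moreover have "0 \<le> g" by (simp add: g_def)
  ultimately show ?thesis using gW gl W l by blast
qed

end

text \<open>In units of \<open>r\<^sup>2\<close>, with \<open>u = i / r\<close> and \<open>x = l / r\<close>: the loss caused by light triangles and by an
  unbalanced bipartition always exceeds the gain from pairs of triangles with nine adjacencies.\<close>

lemma loss_exceeds_gain:
  fixes u x :: real
  assumes "0 \<le> u" "u \<le> 1/2" "0 \<le> x"
  shows "(1 - u)^2 + x * (3/2 - u) - (2 - 4 * u) * (2 * x - x^2) \<ge> 17/100"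
proof -
  \<comment> \<open>At u = 0 this completes the square in 2 x^2 - 5/2 x + 1. Without the terms in x
    the minimum is 175/1024, at u = 7/32.\<close>
  have "(1 - u)^2 + x * (3/2 - u) - (2 - 4 * u) * (2 * x - x^2)
      = (1 - 2 * u) * (2 * (x - 5/8)^2 + 7/32) + 2 * u * x + u^2"
    by (simp add: power2_eq_square field_simps)
  moreover have "(1 - 2 * u) * (2 * (x - 5/8)^2 + 7/32) \<ge> (1 - 2 * u) * (7/32)"
    using assms by (intro mult_left_mono) auto
  moreover have "(1 - 2 * u) * (7/32) + u^2 = (u - 7/32)^2 + (7/32 - (7/32)^2)"
    by (simp add: power2_eq_square field_simps)
  moreover have "2 * u * x \<ge> 0" using assms by simp
  moreover have "(7/32 - (7/32)^2) \<ge> (17/100 :: real)" by (simp add: power2_eq_square)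
  moreover have "(u - 7/32)^2 \<ge> 0" by simp
  ultimately show ?thesis by linarith
qed

text \<open>By \<open>g \<le> r * W\<close> every gain is tied to weight, which costs 4 (i - 1) per
  unit. For \<open>2 * i \<ge> r\<close> this pays for the gain up to linear terms. Otherwise a
  fraction 1 - 2 i / r of it remains, which is bounded through \<open>l\<close>. In both cases a
  multiple of \<open>r^2\<close> is left that exceeds the linear terms for
  \<open>r \<ge> 1000\<close>. The hypothesis on \<open>m\<close> stems from 2 n \<ge> 9 r with n =
  3 r + 2 m + i.\<close>

lemma rough_arith:
  fixes r m i g l W n :: real
  assumes r: "r \<ge> 1000" and m: "2 * m \<ge> 3/2 * r - i" and i: "0 \<le> i" "2 * i \<le> r + 3"
    and g: "0 \<le> g" "g \<le> r * W" "g \<le> 2 * r + 2 * r * l - l^2" and l: "0 \<le> l" "l \<le> r"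
    and W: "0 \<le> W" "W \<le> 2 * r"
  shows "(r - i)^2 + 2 * l * m + 4 * (i - 1) * W > 14 * r + 22 * l + 2 * g + 7"
proof -
  have rr: "1000 * r \<le> r^2" using r mult_right_mono[of 1000 r r] by (simp add: power2_eq_square)
  have lm: "2 * l * m \<ge> l * (3/2 * r - i)"
    using mult_left_mono[OF m l(1)] by (simp add: algebra_simps)
  show ?thesis
  proof (cases "2 * i \<ge> r")
    case True
    have "W \<ge> g / r" using g(2) r by (simp add: divide_le_eq algebra_simps)
    then have "4 * (i - 1) * W \<ge> 4 * (i - 1) * (g / r)"
      using True r by (intro mult_left_mono) auto
    moreover have "4 * (i - 1) * (g / r) = 2 * g * ((2 * i) / r) - 4 * (g / r)"
      using r by (simp add: field_simps)
    moreover have "2 * g * ((2 * i) / r) \<ge> 2 * g * 1"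
      using True r g(1) by (intro mult_left_mono) auto
    ultimately have "4 * (i - 1) * W \<ge> 2 * g - 4 * (g / r)" by simp
    moreover note \<open>g / r \<le> W\<close>
    moreover have "(r - i)^2 \<ge> ((r - 3) / 2)^2" using i r by (intro power_mono) auto
    then have "(r - i)^2 \<ge> r^2 / 4 - 3/2 * r" by (simp add: power2_eq_square field_simps)
    moreover have "l * (3/2 * r - i) \<ge> 0" using l i r by (intro mult_nonneg_nonneg) auto
    moreover have "14 * r + 22 * l + 2 * g + 7 < a + b + c"
      if "2 * g - 4 * d \<le> c" "d \<le> W" "r^2 / 4 - 3/2 * r \<le> a" "0 \<le> f" "f \<le> b" for a b c d f
      using that W(2) l rr r by linarith
    ultimately show ?thesis using lm by blast
  next
    case False
    define u where "u = i / r"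
    define x where "x = l / r"
    have ux: "0 \<le> u" "u \<le> 1/2" "0 \<le> x" using False i l r by (auto simp: u_def x_def field_simps)
    have iu: "i = u * r" and lx: "l = x * r" using r by (auto simp: u_def x_def)
    have "r^2 * ((1 - u)^2 + x * (3/2 - u) - (2 - 4 * u) * (2 * x - x^2)) \<ge> r^2 * (17/100)"
      by (intro mult_left_mono loss_exceeds_gain ux) simp
    then have main: "(r - i)^2 + l * (3/2 * r - i) - (2 - 4 * u) * (2 * r * l - l^2) \<ge> 17/100 * r^2"
      unfolding iu lx by (simp add: power2_eq_square algebra_simps)
    have W4: "4 * (i - 1) * W \<ge> 4 * u * g - 4 * W"
    proof -
      have "u * g \<le> u * (r * W)" using ux g by (intro mult_left_mono) auto
      then show ?thesis unfolding iu by (simp add: algebra_simps)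
    qed
    have "(2 - 4 * u) * g \<le> (2 - 4 * u) * (2 * r + 2 * r * l - l^2)"
      using ux g by (intro mult_left_mono) auto
    also have "\<dots> = (2 - 4 * u) * (2 * r) + (2 - 4 * u) * (2 * r * l - l^2)"
      by (simp add: algebra_simps)
    also have "(2 - 4 * u) * (2 * r) \<le> 2 * (2 * r)" using ux r by (intro mult_right_mono) auto
    finally have "2 * g - 4 * u * g \<le> 4 * r + (2 - 4 * u) * (2 * r * l - l^2)"
      by (simp add: algebra_simps)
    moreover have "14 * r + 22 * l + 2 * g + 7 < a + b + c"
      if "2 * g - d \<le> 4 * r + e" "a + f - e \<ge> 17/100 * r^2" "c \<ge> d - 4 * W" "f \<le> b" for a b c d e f
      using that W(2) l rr r by linarith
    ultimately show ?thesis using main W4 lm by blast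
  qed
qed

context nonrich_cfg
begin

text \<open>The right-hand side is twice what the colouring forces: \<open>F2_lower\<close> with
  \<open>r - 1\<close> in place of \<open>j\<close>, where 7 = 2 * 4 - 1. The crude bound serves
  small \<open>r\<close>; for large \<open>r\<close> the exact or the rough bound applies according
  to the size of \<open>i\<close>.\<close>

lemma edge_bound:
  assumes r2: "r \<ge> 2" and n: "2 * int (card V) \<ge> 9 * r + 15" "int (card V) \<ge> 10000000"
  shows "2 * ed R V V < int (card V)^2 + 2 * (r - 1) * int (card V) - (r - 1)^2 - 2 * (r - 1) + 7"
proof -
  define n where "n = int (card V)"
  have nV: "n = 3 * r + 2 * m + i" unfolding n_def by (rule card_V)
  have pos: "0 \<le> m" "0 \<le> i" by simp_all
  have n9: "2 * n \<ge> 9 * r + 15" "n \<ge> 10000000" using n by (simp_all add: n_def)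
  \<comment> \<open>Equality holds at 2 n = 9 r + 15. The exact bound has 8 r^2 + 4 r against this;
    the rough one has larger linear terms, but a quadratic loss.\<close>
  have low: "2 * (r - 1) * n - (r - 1)^2 - 2 * (r - 1) + 7 \<ge> 8 * r^2 + 6 * r - 7"
  proof -
    have "(r - 1) * (2 * n) \<ge> (r - 1) * (9 * r + 15)" using n9(1) r2 by (intro mult_left_mono) auto
    then show ?thesis by (simp add: power2_eq_square algebra_simps)
  qed
  consider "r < 1000" | "r \<ge> 1000" "2 * i \<ge> r + 4" | "r \<ge> 1000" "2 * i \<le> r + 3" by linarith
  then have "2 * ed R V V < n^2 + 2 * (r - 1) * n - (r - 1)^2 - 2 * (r - 1) + 7"
  proof cases
    case 1
    have "2 * ed R V V \<le> n^2 + 10 * r^2 + 16 * r - (r - i)^2"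
      using crude_bound unfolding nV by (simp add: power2_eq_square algebra_simps)
    moreover have "(r - i)^2 \<ge> 0" by simp
    moreover have "r^2 \<le> 1000 * r" using 1 r2 by (simp add: power2_eq_square)
    moreover have "(r - 1) * n \<ge> (r - 1) * 10000000" using n9(2) r2 by (intro mult_left_mono) auto
    then have "r * n - n \<ge> 10000000 * r - 10000000" by (simp add: algebra_simps)
    moreover have "2 * (r - 1) * n = 2 * (r * n) - 2 * n" by (simp add: algebra_simps)
    moreover have "(r - 1)^2 \<le> r^2" using r2 by (intro power_mono) auto
    moreover have "e < s + p - q - 2 * (r - 1) + 7"
      if "e \<le> s + 10 * r^2 + 16 * r - y" "0 \<le> y" "r^2 \<le> 1000 * r" "10000000 * r - 10000000 \<le> z - n"
        "p = 2 * z - 2 * n" "q \<le> r^2" for e s p q y z :: int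
      using that 1 r2 by simp
    ultimately show ?thesis by blast
  next
    case 2
    have "2 * ed R V V \<le> n^2 + 8 * r^2 + 4 * r - (r - i)^2"
      using exact_bound[OF 2(2)] unfolding nV by (simp add: power2_eq_square algebra_simps)
    moreover have "(r - i)^2 \<ge> 0" by simp
    moreover have "e < s + z" if "e \<le> s + 8 * r^2 + 4 * r - y" "0 \<le> y" "z \<ge> 8 * r^2 + 6 * r - 7" for e s y z
      using that 2(1) by linarith
    ultimately have "2 * ed R V V < n^2 + (2 * (r - 1) * n - (r - 1)^2 - 2 * (r - 1) + 7)"
      using low by blast
    then show ?thesis by simp
  next
    case 3
    obtain g l W where gl: "0 \<le> g" "g \<le> r * W" "g \<le> 2 * r + 2 * r * l - l^2" "0 \<le> l" "l \<le> r" "0 \<le> W" "W \<le> 2 * r"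
      and e: "ed R V V \<le> 8 * r * r + 2 * r + g + (2 * r * (3 * m + 3) - l * (m - 11))
      + (2 * r * (2 * i + 1) - 2 * (i - 1) * W) + 2 * m * (m + i)"
      using rough_bound by blast
    have "2 * ed R V V \<le> n^2 + 8 * r^2 + 20 * r + 22 * l + 2 * g - 2 * l * m - 4 * (i - 1) * W - (r - i)^2"
      using e unfolding nV by (simp add: power2_eq_square algebra_simps)
    moreover have "(r - i)^2 + 2 * l * m + 4 * (i - 1) * W > 14 * r + 22 * l + 2 * g + 7"
    proof -
      have "real_of_int (14 * r + 22 * l + 2 * g + 7) < real_of_int ((r - i)^2 + 2 * l * m + 4 * (i - 1) * W)"
      proof -
        have "(real_of_int r - real_of_int i)^2 + 2 * real_of_int l * real_of_int m
            + 4 * (real_of_int i - 1) * real_of_int W > 14 * real_of_int r + 22 * real_of_int l + 2 * real_of_int g + 7"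
        proof (rule rough_arith)
          show "1000 \<le> real_of_int r" using 3(1) by linarith
          have "2 * real_of_int n \<ge> 9 * real_of_int r + 15" using n9(1) by linarith
          then show "3/2 * real_of_int r - real_of_int i \<le> 2 * real_of_int m" unfolding nV by simp
          show "0 \<le> real_of_int i" "2 * real_of_int i \<le> real_of_int r + 3" using 3(2) by linarith+
          show "0 \<le> real_of_int g" "0 \<le> real_of_int l" "real_of_int l \<le> real_of_int r" "0 \<le> real_of_int W"
            "real_of_int W \<le> 2 * real_of_int r"
            using gl by linarith+
          show "real_of_int g \<le> real_of_int r * real_of_int W"
            using gl(2) by (metis of_int_le_iff of_int_mult)
          have "real_of_int g \<le> real_of_int (2 * r + 2 * r * l - l^2)" using gl(3) by (simp only: of_int_le_iff)
          then show "real_of_int g \<le> 2 * real_of_int r + 2 * real_of_int r * real_of_int l - (real_of_int l)^2"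
            by simp
        qed
        then show ?thesis by simp
      qed
      then show ?thesis by (simp only: of_int_less_iff)
    qed
    moreover have "e < s + z"
      if "e \<le> s + 8 * r^2 + 20 * r + 22 * l + 2 * g - p - q - y" "y + p + q > 14 * r + 22 * l + 2 * g + 7"
        "z \<ge> 8 * r^2 + 6 * r - 7" for e s y z p q :: int
      using that by linarith
    ultimately have "2 * ed R V V < n^2 + (2 * (r - 1) * n - (r - 1)^2 - 2 * (r - 1) + 7)"
      using low by blast
    then show ?thesis by simp
  qed
  then show ?thesis by (simp add: n_def)
qed

end

section \<open>Mantel's theorem and two rainbow triangles\<close>

lemma max_cfg_edges:
  assumes "finite V" "cfg R V \<T>0 M0"
  obtains \<T> M where "cfg R V \<T> M" "card \<T> = card \<T>0"
    "\<And>\<T>' M'. cfg R V \<T>' M' \<Longrightarrow> card \<T>' = card \<T>0 \<Longrightarrow> card M' \<le> card M"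
proof -
  let ?P = "\<lambda>z. cfg R V (fst z) (snd z) \<and> card (fst z) = card \<T>0"
  have "\<exists>z. ?P z \<and> (\<forall>y. ?P y \<longrightarrow> card (snd y) \<le> card (snd z))"
  proof (rule Lattices_Big.ex_has_greatest_nat)
    show "?P (\<T>0, M0)" using assms(2) by simp
    show "\<forall>y. ?P y \<longrightarrow> card (snd y) < Suc (card (Pow V))"
    proof (intro allI impI)
      fix y assume "?P y"
      then have "snd y \<subseteq> Pow V" using cfgD(4)[of R V "fst y" "snd y"] by blast
      then show "card (snd y) < Suc (card (Pow V))" using assms(1) by (simp only: less_Suc_eq_le) (intro card_mono, auto)
    qed
  qed
  then obtain z where z: "?P z" "\<forall>y. ?P y \<longrightarrow> card (snd y) \<le> card (snd z)" by blast
  show ?thesis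
  proof (rule that[of "fst z" "snd z"])
    fix \<T>' M' assume "cfg R V \<T>' M'" "card \<T>' = card \<T>0"
    then show "card M' \<le> card (snd z)" using z(2)[rule_format, of "(\<T>', M')"] by simp
  qed (use z(1) in simp_all)
qed

text \<open>A largest matching is a stable configuration without triangles, and twice the bound of
  \<open>ed_total\<close> is then 4 m (m + i) = n^2 - i^2.\<close>

lemma mantel:
  assumes "finite V" "symp R" "irreflp R" "\<And>T. \<not> cfg R V {T} {}"
  shows "2 * ed R V V \<le> int (card V) ^ 2"
proof -
  have none: "\<T>' = {}" if "cfg R V \<T>' M'" for \<T>' M'
  proof (rule ccontr)
    assume "\<T>' \<noteq> {}"
    then obtain T where "T \<in> \<T>'" by blast
    then have "cfg R V {T} {}" by (intro cfg_subset[OF that]) auto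
    with assms(4) show False by blast
  qed
  obtain \<T> M where M: "cfg R V \<T> M" "\<And>\<T>' M'. cfg R V \<T>' M' \<Longrightarrow> card \<T>' = card ({} :: 'a set set) \<Longrightarrow> card M' \<le> card M"
    using max_cfg_edges[OF assms(1) cfg_empty] by metis
  have T: "\<T> = {}" by (rule none[OF M(1)])
  interpret stable_cfg R V "{}" M
  proof
    show "stable 3 R V {} M"
      unfolding stable_def
    proof (intro allI impI)
      fix \<T>' M' assume c: "cfg R V \<T>' M'"
      then have "\<T>' = {}" by (rule none)
      then show "card \<T>' \<le> card ({} :: 'a set set) \<and> (card \<T>' = card ({} :: 'a set set) \<longrightarrow> card M' \<le> card M)"
        using M(2)[OF c] by simp
    qed
  qed (use assms M T in auto)
  have "ed R V V \<le> 2 * m * (m + i)" using ed_total by simp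
  then have "2 * ed R V V \<le> 2 * (2 * m * (m + i))" by simp
  also have "2 * (2 * m * (m + i)) \<le> 2 * (2 * m * (m + i)) + i ^ 2" by simp
  also have "\<dots> = (2 * m + i) ^ 2" by (simp add: power2_eq_square algebra_simps)
  also have "2 * m + i = int (card V)" using card_V by simp
  finally show ?thesis .
qed

section \<open>Edge sets and rainbow families of triangles\<close>

definition pairs :: "'a set \<Rightarrow> 'a set set" where
  "pairs W = {e. e \<subseteq> W \<and> card e = 2}"

abbreviation adj :: "'a set set \<Rightarrow> 'a \<Rightarrow> 'a \<Rightarrow> bool" where
  "adj E x y \<equiv> {x, y} \<in> E"

lemma pairs_finite: "finite W \<Longrightarrow> finite (pairs W)"
  by (rule finite_subset[of _ "Pow W"]) (auto simp: pairs_def)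

lemma pairs_mono: "W \<subseteq> W' \<Longrightarrow> pairs W \<subseteq> pairs W'"
  by (auto simp: pairs_def)

lemma pairs_doubleton: "{x, y} \<in> pairs W \<longleftrightarrow> x \<in> W \<and> y \<in> W \<and> x \<noteq> y"
  by (auto simp: pairs_def card_insert_if)

lemma pairs_triple:
  assumes "x \<noteq> y" "y \<noteq> z" "x \<noteq> z"
  shows "pairs {x, y, z} = {{x, y}, {y, z}, {x, z}}"
proof
  show "pairs {x, y, z} \<subseteq> {{x, y}, {y, z}, {x, z}}"
  proof
    fix e assume e: "e \<in> pairs {x, y, z}"
    then obtain p q where "e = {p, q}" "p \<noteq> q" by (auto simp: pairs_def card_2_iff)
    with e show "e \<in> {{x, y}, {y, z}, {x, z}}" by (auto simp: pairs_doubleton insert_commute)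
  qed
  show "{{x, y}, {y, z}, {x, z}} \<subseteq> pairs {x, y, z}" using assms by (simp add: pairs_doubleton)
qed

lemma adj_sym: "symp (adj E)"
  by (simp add: symp_def insert_commute)

lemma adj_irrefl: "E \<subseteq> pairs W \<Longrightarrow> irreflp (adj E)"
  by (auto simp: irreflp_def pairs_def)

lemma ed_adj:
  assumes "finite W" "E \<subseteq> pairs V"
  shows "ed (adj E) W W = 2 * int (card (E \<inter> pairs W))"
proof -
  have "ed (adj E) W W = 2 * int (card {e \<in> E. e \<subseteq> W})"
    using assms by (intro ed_edges) (auto simp: pairs_def)
  also have "{e \<in> E. e \<subseteq> W} = E \<inter> pairs W" using assms(2) by (auto simp: pairs_def)
  finally show ?thesis .
qed

text \<open>The edges are those of the complete graph, so a member may use edges outside a chosen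
  set of representatives of the colours.\<close>

definition rainbow_pack :: "('a set \<Rightarrow> nat) \<Rightarrow> 'a set \<Rightarrow> 'a set set \<Rightarrow> bool" where
  "rainbow_pack c W \<T> \<longleftrightarrow> (\<forall>T\<in>\<T>. T \<subseteq> W \<and> card T = 3) \<and> pairwise disjnt \<T> \<and>
     inj_on c (\<Union>T\<in>\<T>. pairs T)"

lemma cfg_adj_pairs:
  assumes "cfg (adj E) W \<T> M" "T \<in> \<T>"
  shows "pairs T \<subseteq> E"
proof
  fix e assume e: "e \<in> pairs T"
  then obtain p q where "e = {p, q}" "p \<noteq> q" by (auto simp: pairs_def card_2_iff)
  with e cfgD(3)[OF assms] show "e \<in> E" by (auto simp: pairs_doubleton pairwise_def)
qed

lemma cfg_rainbow:
  assumes "cfg (adj E) W \<T> M" "inj_on c E"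
  shows "rainbow_pack c W \<T>"
proof -
  have "(\<Union>T\<in>\<T>. pairs T) \<subseteq> E" using cfg_adj_pairs[OF assms(1)] by blast
  then have "inj_on c (\<Union>T\<in>\<T>. pairs T)" using assms(2) inj_on_subset by blast
  moreover have "pairwise disjnt \<T>"
    using cfgD(7)[OF assms(1)] pairwise_subset by blast
  ultimately show ?thesis using cfgD(1,2)[OF assms(1)] by (simp add: rainbow_pack_def)
qed

section \<open>Common neighbours and two disjoint rainbow triangles\<close>

definition codeg :: "('a \<Rightarrow> 'a \<Rightarrow> bool) \<Rightarrow> 'a set \<Rightarrow> 'a \<Rightarrow> 'a \<Rightarrow> 'a set" where
  "codeg R Z a b = {z \<in> Z. R a z \<and> R b z}"

text \<open>A vertex joined to \<open>d \<ge> 1\<close> of the three lies in at least d - 1 of the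
  three common neighbourhoods.\<close>

lemma codeg_triple:
  assumes "finite Z" "a \<noteq> b" "b \<noteq> c" "a \<noteq> c" "ed R {a, b, c} Z > int (card Z) + 3 * int k"
  shows "card (codeg R Z a b) > k \<or> card (codeg R Z b c) > k \<or> card (codeg R Z a c) > k"
proof (rule ccontr)
  assume "\<not> ?thesis"
  then have le: "card (codeg R Z a b) \<le> k" "card (codeg R Z b c) \<le> k" "card (codeg R Z a c) \<le> k"
    by simp_all
  have "ed R {a, b, c} Z = (\<Sum>z\<in>Z. ed R {a, b, c} {z})" by (rule ed_split_right)
  also have "\<dots> \<le> (\<Sum>z\<in>Z. 1 + of_bool (R a z \<and> R b z) + of_bool (R b z \<and> R c z) + of_bool (R a z \<and> R c z))"
    using assms(2-4) by (intro sum_mono) (simp add: ed_def)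
  also have "\<dots> = int (card Z) + int (card (codeg R Z a b)) + int (card (codeg R Z b c)) + int (card (codeg R Z a c))"
    using assms(1) by (simp add: sum.distrib codeg_def Int_def)
  finally show False using le assms(5) by linarith
qed

lemma codeg_mono: "Z \<subseteq> Z' \<Longrightarrow> codeg R Z a b \<subseteq> codeg R Z' a b"
  by (auto simp: codeg_def)

lemma codeg_finite: "finite Z \<Longrightarrow> finite (codeg R Z a b)"
  by (simp add: codeg_def)

lemma pick_outside:
  assumes "finite B" "card B < card A"
  shows "\<exists>x. x \<in> A \<and> x \<notin> B"
proof (rule ccontr)
  assume "\<not> ?thesis"
  then have "A \<subseteq> B" by blast
  then have "card A \<le> card B" by (rule card_mono[OF assms(1)])
  then show False using assms(2) by simp
qed

text \<open>Mantel gives a triangle \<open>T\<close>, and the rest is triangle-free. So the rest has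
  at most (n - 3)^2 / 4 edges, and \<open>T\<close> has about 3 n / 2 adjacencies to it; the excess
  of about n / 2 over one per vertex forces common neighbours.\<close>

lemma triangle_edge_codeg:
  assumes W: "finite W" "card W \<ge> 200" and E: "E \<subseteq> pairs W" "4 * card E > card W ^ 2"
    and no: "\<And>T1 T2. cfg (adj E) W {T1, T2} {} \<Longrightarrow> T1 = T2"
  shows "\<exists>a b. {a, b} \<in> E \<and> card (codeg (adj E) W a b) > 20"
proof -
  let ?R = "adj E" and ?n = "int (card W)"
  have s: "symp ?R" by (rule adj_sym)
  have ir: "irreflp ?R" by (rule adj_irrefl[OF E(1)])
  have "E \<inter> pairs W = E" using E(1) by blast
  then have edW: "ed ?R W W = 2 * int (card E)" using ed_adj[OF W(1) E(1)] by simp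
  have E4: "4 * int (card E) \<ge> ?n ^ 2 + 1"
  proof -
    have "int (card W ^ 2) < int (4 * card E)" using E(2) by (simp only: of_nat_less_iff)
    then show ?thesis by simp
  qed
  have "\<exists>T. cfg ?R W {T} {}"
  proof (rule ccontr)
    assume "\<nexists>T. cfg ?R W {T} {}"
    then have "2 * ed ?R W W \<le> ?n ^ 2" by (intro mantel W s ir) blast
    with edW E4 show False by linarith
  qed
  then obtain T where T: "cfg ?R W {T} {}" by blast
  have TW: "T \<subseteq> W" "card T = 3" "pairwise ?R T" using cfgD[OF T] by auto
  then have fT: "finite T" by (simp add: card_ge_0_finite)
  let ?H = "W - T"
  have "2 * ed ?R ?H ?H \<le> int (card ?H) ^ 2"
  proof (rule mantel[OF _ s ir])
    show "finite ?H" using W(1) by simp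
    show "\<not> cfg ?R ?H {T'} {}" for T'
    proof
      assume T': "cfg ?R ?H {T'} {}"
      have "cfg ?R T {T} {}" using TW by (intro cfgI) auto
      then have "cfg ?R (T \<union> ?H) ({T} \<union> {T'}) ({} \<union> {})" by (rule cfg_union[OF _ T']) auto
      then have "cfg ?R (T \<union> ?H) {T, T'} {}" by (simp add: insert_commute)
      then have "cfg ?R W {T, T'} {}" by (rule cfg_mono) (use TW in auto)
      then have "T = T'" by (rule no)
      moreover have "T' \<subseteq> ?H" using cfgD(1)[OF T'] by simp
      moreover have "T \<noteq> {}" using TW(2) by auto
      ultimately show False by blast
    qed
  qed
  moreover have cH: "int (card ?H) = ?n - 3"
    using TW card_mono[OF W(1) TW(1)] fT by (simp add: card_Diff_subset of_nat_diff)
  moreover have "ed ?R W W = ed ?R T T + 2 * ed ?R T ?H + ed ?R ?H ?H"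
  proof -
    have "ed ?R (T \<union> ?H) (T \<union> ?H) = ed ?R T T + ed ?R T ?H + (ed ?R ?H T + ed ?R ?H ?H)"
      using fT W(1) by (simp only: ed_Un_left ed_Un_right finite_Diff finite_Un Diff_disjoint)
    moreover have "T \<union> ?H = W" using TW(1) by blast
    ultimately show ?thesis using ed_commute[OF s, of ?H T] by simp
  qed
  moreover have "ed ?R T T \<le> 6"
  proof -
    obtain x y z where xyz: "T = {x, y, z}" "x \<noteq> y" "y \<noteq> z" "x \<noteq> z"
      using TW(2) by (auto simp: card_3_iff)
    have "\<not> ?R w w" for w using ir by (simp add: irreflp_def)
    then show ?thesis using xyz by (simp add: ed_def)
  qed
  ultimately have "2 * (6 + 2 * ed ?R T ?H) + (?n - 3) ^ 2 \<ge> ?n ^ 2 + 1"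
    using edW E4 by simp
  then have big: "ed ?R T ?H > int (card ?H) + 3 * int 20"
    unfolding cH using W(2) by (simp add: power2_eq_square algebra_simps)
  obtain x y z where xyz: "T = {x, y, z}" "x \<noteq> y" "y \<noteq> z" "x \<noteq> z"
    using TW(2) by (auto simp: card_3_iff)
  have E3: "{x, y} \<in> E" "{y, z} \<in> E" "{x, z} \<in> E"
    using TW(3) xyz by (auto simp: pairwise_def)
  have "card (codeg ?R ?H x y) > 20 \<or> card (codeg ?R ?H y z) > 20 \<or> card (codeg ?R ?H x z) > 20"
    using codeg_triple[of ?H x y z 20 ?R] W(1) xyz big by simp
  moreover have "card (codeg ?R ?H p q) \<le> card (codeg ?R W p q)" for p q
    using W(1) by (intro card_mono codeg_finite codeg_mono) auto
  ultimately show ?thesis using E3 by (meson less_le_trans)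
qed

text \<open>The average degree exceeds n / 2, so more than a tenth of the vertices have degree at
  least 2 n / 5. Three of these have 6 n / 5 adjacencies together, hence two of them many common
  neighbours. The two need not be adjacent in \<open>E\<close>.\<close>

lemma codeg_avoiding:
  assumes W: "finite W" "card W \<ge> 1000" and E: "E \<subseteq> pairs W" "4 * card E > card W ^ 2"
    and S: "finite S" "card S \<le> 4"
  obtains u v where "u \<noteq> v" "u \<in> W - S" "v \<in> W - S" "card (codeg (adj E) W u v) > 20"
proof -
  let ?R = "adj E" and ?n = "int (card W)"
  have "E \<inter> pairs W = E" using E(1) by blast
  then have edW: "ed ?R W W = 2 * int (card E)" using ed_adj[OF W(1) E(1)] by simp
  have E4: "4 * int (card E) > ?n ^ 2"
  proof -
    have "int (card W ^ 2) < int (4 * card E)" using E(2) by (simp only: of_nat_less_iff)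
    then show ?thesis by simp
  qed
  let ?D = "{v \<in> W. 5 * ed ?R {v} W \<ge> 2 * ?n}"
  have "5 * ed ?R W W = (\<Sum>v\<in>W. 5 * ed ?R {v} W)"
    by (simp only: ed_split_left[OF W(1)] sum_distrib_left)
  also have "\<dots> \<le> (\<Sum>v\<in>W. 2 * ?n + 5 * ?n * of_bool (v \<in> ?D))"
  proof (rule sum_mono)
    fix v assume "v \<in> W"
    have "ed ?R {v} W \<le> ?n" using ed_le_card[of "{v}" W ?R] W(1) by simp
    then show "5 * ed ?R {v} W \<le> 2 * ?n + 5 * ?n * of_bool (v \<in> ?D)"
      using \<open>v \<in> W\<close> by auto
  qed
  also have "\<dots> = ?n * (2 * ?n) + 5 * ?n * int (card ?D)"
  proof -
    have "{v \<in> W. v \<in> ?D} = ?D" by blast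
    then have "(\<Sum>v\<in>W. of_bool (v \<in> ?D)) = int (card ?D)"
      using W(1) by (simp add: Int_def)
    then have "(\<Sum>v\<in>W. 5 * ?n * of_bool (v \<in> ?D)) = 5 * ?n * int (card ?D)"
      by (simp only: sum_distrib_left[symmetric])
    then show ?thesis by (simp only: sum.distrib) simp
  qed
  finally have "5 * ?n ^ 2 < 4 * ?n ^ 2 + 10 * ?n * int (card ?D)"
    using edW E4 by (simp add: power2_eq_square)
  then have "?n * ?n < ?n * (10 * int (card ?D))" by (simp add: power2_eq_square)
  then have "?n < 10 * int (card ?D)" using W(2) by (simp add: mult_less_cancel_left)
  then have D: "card ?D > 6" using W(2) by linarith
  have "card S < card ?D" using S D by linarith
  then obtain u where u: "u \<in> ?D" "u \<notin> S" using pick_outside[OF S(1)] by blast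
  have "card (insert u S) < card ?D" using S D by (simp add: card_insert_if)
  moreover have "finite (insert u S)" using S by simp
  ultimately obtain v where v: "v \<in> ?D" "v \<notin> insert u S" using pick_outside by blast
  have "card (insert u (insert v S)) < card ?D" using S D by (simp add: card_insert_if)
  moreover have "finite (insert u (insert v S))" using S by simp
  ultimately obtain w where w: "w \<in> ?D" "w \<notin> insert u (insert v S)" using pick_outside by blast
  have d: "u \<noteq> v" "v \<noteq> w" "u \<noteq> w" using v w by auto
  have "ed ?R {u, v, w} W = ed ?R {u} W + ed ?R {v} W + ed ?R {w} W"
    using d by (simp add: ed_def)
  then have "5 * ed ?R {u, v, w} W \<ge> 6 * ?n" using u(1) v(1) w(1) by simp
  then have "ed ?R {u, v, w} W > ?n + 3 * int 20" using W(2) by linarith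
  then have "card (codeg ?R W u v) > 20 \<or> card (codeg ?R W v w) > 20 \<or> card (codeg ?R W u w) > 20"
    by (rule codeg_triple[OF W(1) d])
  then show ?thesis using that d u v w by blast
qed

lemma inj_on_insert_new: "f x \<notin> f ` X \<Longrightarrow> inj_on f X \<Longrightarrow> inj_on f (insert x X)"
  by (simp add: inj_on_insert) blast

text \<open>The edge \<open>{u, v}\<close> is taken from the complete graph, and its colour occurs
  on at most one edge \<open>g\<close> of \<open>E\<close>. If the third vertices \<open>w\<close>
  and \<open>z\<close> avoid \<open>g\<close>, only \<open>{a, b}\<close> could repeat this colour,
  which \<open>col\<close> excludes. At most five vertices have to be avoided, so 20 is
  generous.\<close>

lemma two_triangles_from_edges:
  assumes W: "finite W" and E: "E \<subseteq> pairs W" "inj_on c E"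
    and ab: "{a, b} \<in> E" "card (codeg (adj E) W a b) > 20"
    and uv: "u \<noteq> v" "u \<in> W - {a, b}" "v \<in> W - {a, b}" "card (codeg (adj E) W u v) > 20"
    and col: "c {u, v} \<noteq> c {a, b}"
  shows "\<exists>T1 T2. T1 \<noteq> T2 \<and> rainbow_pack c W {T1, T2}"
proof -
  let ?G = "{g \<in> E. c g = c {u, v}}"
  have "\<exists>g. ?G \<subseteq> {g}"
  proof (cases "?G = {}")
    case False
    then obtain g where "g \<in> ?G" by blast
    then have "?G \<subseteq> {g}" using E(2) by (auto simp: inj_on_def)
    then show ?thesis by blast
  qed blast
  then obtain g where g: "?G \<subseteq> {g}" by blast
  \<comment> \<open>If the colour of \<open>{u, v}\<close> does not occur in \<open>E\<close>, then
    \<open>g\<close> is arbitrary and possibly not an edge; the empty set takes its place in that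
    case.\<close>
  define F where "F = (if g \<in> E then g else {})"
  have F2: "finite F" "card F \<le> 2"
  proof -
    have "card g = 2" if "g \<in> E" using E(1) that by (auto simp: pairs_def)
    then show "finite F" "card F \<le> 2" by (auto simp: F_def card_ge_0_finite)
  qed
  have GF: "h \<subseteq> F" if "h \<in> E" "c h = c {u, v}" for h
    using that g by (auto simp: F_def)
  have abW: "a \<in> W" "b \<in> W" "a \<noteq> b" using ab(1) E(1) pairs_doubleton[of a b W] by auto
  have ne: "x \<noteq> y" if "{x, y} \<in> E" for x y using that E(1) pairs_doubleton[of x y W] by auto
  have "card ({a, b} \<union> F) \<le> 4" using card_Un_le[of "{a, b}" F] F2 abW by simp
  then have "card ({a, b} \<union> F) < card (codeg (adj E) W u v)" using uv(4) by linarith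
  moreover have "finite ({a, b} \<union> F)" using F2 by simp
  ultimately obtain w where w: "w \<in> codeg (adj E) W u v" "w \<notin> {a, b} \<union> F" using pick_outside by blast
  have "card {u, v, w} \<le> 3" by (simp add: card_insert_if)
  then have "card ({u, v, w} \<union> F) < card (codeg (adj E) W a b)"
    using card_Un_le[of "{u, v, w}" F] F2 ab(2) by linarith
  moreover have "finite ({u, v, w} \<union> F)" using F2 by simp
  ultimately obtain z where z: "z \<in> codeg (adj E) W a b" "z \<notin> {u, v, w} \<union> F" using pick_outside by blast
  have e: "{u, w} \<in> E" "{v, w} \<in> E" "{a, z} \<in> E" "{b, z} \<in> E" "w \<in> W" "z \<in> W"
    using w(1) z(1) by (auto simp: codeg_def)
  have d1: "a \<noteq> b" "b \<noteq> z" "a \<noteq> z" and d2: "u \<noteq> v" "v \<noteq> w" "u \<noteq> w"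
    using ne[OF e(1)] ne[OF e(2)] ne[OF e(3)] ne[OF e(4)] abW uv(1) by auto
  let ?T1 = "{a, b, z}" and ?T2 = "{u, v, w}"
  have dis: "?T1 \<inter> ?T2 = {}" using uv(2,3) w(2) z(2) by auto
  let ?X = "{{a, b}, {b, z}, {a, z}, {v, w}, {u, w}}"
  have XE: "?X \<subseteq> E" using e ab(1) by simp
  have "c {u, v} \<notin> c ` ?X"
  proof
    assume "c {u, v} \<in> c ` ?X"
    then obtain h where h: "c {u, v} = c h" "h \<in> ?X" by (rule imageE)
    have "h \<in> E" using XE h(2) by (rule subsetD)
    then have "h \<subseteq> F" using GF h(1) by simp
    then have "z \<notin> h" "w \<notin> h" using w(2) z(2) by blast+
    then have "h = {a, b}" using h(2) by blast
    then show False using h(1) col by simp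
  qed
  moreover have "inj_on c ?X" by (rule inj_on_subset[OF E(2) XE])
  ultimately have inj: "inj_on c (insert {u, v} ?X)" by (rule inj_on_insert_new)
  have "pairs ?T1 \<union> pairs ?T2 \<subseteq> insert {u, v} ?X"
    unfolding pairs_triple[OF d1] pairs_triple[OF d2] by simp
  then have "inj_on c (pairs ?T1 \<union> pairs ?T2)" by (rule inj_on_subset[OF inj])
  then have "inj_on c (\<Union>T\<in>{?T1, ?T2}. pairs T)" by simp
  moreover have "?T1 \<subseteq> W" "?T2 \<subseteq> W" using abW e(5,6) uv(2,3) by auto
  moreover have "card ?T1 = 3" "card ?T2 = 3" using d1 d2 by simp_all
  moreover have "pairwise disjnt {?T1, ?T2}"
    using dis unfolding pairwise_def disjnt_def by blast
  ultimately have "rainbow_pack c W {?T1, ?T2}" unfolding rainbow_pack_def by simp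
  moreover have "?T1 \<noteq> ?T2" using dis by blast
  ultimately show ?thesis by (intro exI[of _ ?T1] exI[of _ ?T2] conjI)
qed

text \<open>The second edge above n^2 / 4 allows \<open>{a, b}\<close> to be removed and another
  edge \<open>{a', b'}\<close> with many common neighbours to be found. The colours of these two
  differ, so at least one of them differs from that of \<open>{u, v}\<close>.\<close>

lemma two_rainbow_triangles:
  assumes W: "finite W" "card W \<ge> 1000" and E: "E \<subseteq> pairs W" "inj_on c E" "card E \<ge> card W ^ 2 div 4 + 2"
  shows "\<exists>T1 T2. T1 \<noteq> T2 \<and> rainbow_pack c W {T1, T2}"
proof (rule ccontr)
  assume no: "\<not> ?thesis"
  have no_cfg: "T1 = T2" if "cfg (adj E') W {T1, T2} {}" "E' \<subseteq> E" for E' T1 T2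
    using cfg_rainbow[OF that(1), of c] no inj_on_subset[OF E(2) that(2)] by blast
  have big: "4 * k > N ^ 2" if "k \<ge> N ^ 2 div 4 + 1" for k N :: nat using that by linarith
  have n200: "card W \<ge> 200" using W(2) by simp
  have bigE: "4 * card E > card W ^ 2" by (rule big) (use E(3) in simp)
  obtain a b where ab: "{a, b} \<in> E" "card (codeg (adj E) W a b) > 20"
    using triangle_edge_codeg[OF W(1) n200 E(1) bigE] no_cfg[OF _ order_refl] by blast
  let ?E' = "E - {{a, b}}"
  have finE: "finite E" by (rule finite_subset[OF E(1) pairs_finite[OF W(1)]])
  have bigE': "4 * card ?E' > card W ^ 2"
    by (rule big) (use E(3) ab(1) finE in \<open>simp add: card_Diff_singleton\<close>)
  have E'W: "?E' \<subseteq> pairs W" using E(1) by blast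
  obtain a' b' where ab': "{a', b'} \<in> ?E'" "card (codeg (adj ?E') W a' b') > 20"
    using triangle_edge_codeg[OF W(1) n200 E'W bigE'] no_cfg[OF _ Diff_subset] by blast
  have "codeg (adj ?E') W a' b' \<subseteq> codeg (adj E) W a' b'" by (auto simp: codeg_def)
  then have ab'2: "card (codeg (adj E) W a' b') > 20"
    using ab'(2) card_mono[OF codeg_finite[OF W(1)]] by (meson less_le_trans)
  have "c {a, b} \<noteq> c {a', b'}" using E(2) ab(1) ab'(1) by (auto simp: inj_on_def)
  have "card {a, b, a', b'} \<le> 4" by (simp add: card_insert_if)
  then obtain u v where uv: "u \<noteq> v" "u \<in> W - {a, b, a', b'}" "v \<in> W - {a, b, a', b'}"
      "card (codeg (adj E) W u v) > 20"
    using codeg_avoiding[OF W E(1) bigE, of "{a, b, a', b'}"] by blast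
  show False
  proof (cases "c {u, v} = c {a, b}")
    case True
    then have "c {u, v} \<noteq> c {a', b'}" using \<open>c {a, b} \<noteq> c {a', b'}\<close> by simp
    then show False
      using two_triangles_from_edges[OF W(1) E(1,2) _ ab'2 uv(1) _ _ uv(4)] ab'(1) uv(2,3) no by blast
  next
    case False
    then show False
      using two_triangles_from_edges[OF W(1) E(1,2) ab uv(1) _ _ uv(4)] uv(2,3) no by blast
  qed
qed

section \<open>Removing rich vertices\<close>

text \<open>\<open>X\<close> stands for the edges of \<open>M\<close> that an exchange spends or
  that must be avoided for their colours.\<close>

definition completable :: "nat \<Rightarrow> ('a \<Rightarrow> 'a \<Rightarrow> bool) \<Rightarrow> 'a set \<Rightarrow> 'a set set \<Rightarrow> bool" where
  "completable D R A M \<longleftrightarrow> (\<forall>X. X \<subseteq> M \<longrightarrow> card X \<le> D \<longrightarrow>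
     (\<exists>g. inj_on g A \<and> g ` A \<subseteq> M - X \<and> (\<forall>a\<in>A. rich R a (g a))))"

text \<open>\<open>A\<close> is the set of deleted vertices. As every vertex of \<open>A\<close> can be completed to a triangle after
  \<open>D\<close> edges of \<open>M\<close> are spent, an improvement in \<open>V - A\<close> is one in \<open>V\<close>.\<close>

definition state :: "nat \<Rightarrow> ('a \<Rightarrow> 'a \<Rightarrow> bool) \<Rightarrow> 'a set \<Rightarrow> nat \<Rightarrow> nat \<Rightarrow> 'a set \<Rightarrow> 'a set set \<Rightarrow> 'a set set \<Rightarrow> bool" where
  "state D R V p k A \<T> M \<longleftrightarrow> A \<subseteq> V \<and> cfg R (V - A) \<T> M \<and> completable D R A M \<and>
     card A + card \<T> = p \<and> card M = k + card A"

lemma completableD: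
  assumes "completable D R A M" "X \<subseteq> M" "card X \<le> D"
  shows "\<exists>g. inj_on g A \<and> g ` A \<subseteq> M - X \<and> (\<forall>a\<in>A. rich R a (g a))"
  using assms by (simp add: completable_def)

lemma stateD:
  assumes "state D R V p k A \<T> M"
  shows "A \<subseteq> V" "cfg R (V - A) \<T> M" "completable D R A M" "card A + card \<T> = p" "card M = k + card A"
  using assms by (simp_all add: state_def)

lemma state_antimono: "state D R V p k A \<T> M \<Longrightarrow> D' \<le> D \<Longrightarrow> state D' R V p k A \<T> M"
  unfolding state_def completable_def by (meson le_trans)

lemma state_start:
  assumes "cfg R V \<T> M" "card \<T> = p" "card M = k"
  shows "state D R V p k {} \<T> M"
  using assms by (simp add: state_def completable_def)

lemma cfg_region: "cfg R V \<T> M \<Longrightarrow> cfg R (\<Union>\<T> \<union> \<Union>M) \<T> M"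
  by (rule cfgI) (use cfgD[of R V \<T> M] in auto)

lemma cfg_complete:
  assumes V: "finite V" "symp R" and A: "A \<subseteq> V" and c: "cfg R (V - A) \<T> M"
    and g: "inj_on g A" "g ` A \<subseteq> M" "\<And>a. a \<in> A \<Longrightarrow> rich R a (g a)"
  defines "h \<equiv> \<lambda>a. insert a (g a)"
  shows "cfg R V (\<T> \<union> h ` A) (M - g ` A)" "card (\<T> \<union> h ` A) = card \<T> + card A"
    "card (M - g ` A) = card M - card A" "card A \<le> card M"
proof -
  have finA: "finite A" using A V finite_subset by blast
  have fins: "finite \<T>" "finite M" using cfg_finite[OF c] V by auto
  have ga: "g a \<in> M" "g a \<subseteq> V - A" "card (g a) = 2" "pairwise R (g a)" if "a \<in> A" for a
  proof -
    show "g a \<in> M" using g(2) that by blast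
    then show "g a \<subseteq> V - A" "card (g a) = 2" "pairwise R (g a)" using cfgD(4-6)[OF c] by simp_all
  qed
  have hA: "h a \<inter> A = {a}" if "a \<in> A" for a using ga(2)[OF that] that by (auto simp: h_def)
  have injh: "inj_on h A"
  proof (rule inj_onI)
    fix a b assume "a \<in> A" "b \<in> A" "h a = h b"
    then have "{a} = {b}" using hA by metis
    then show "a = b" by simp
  qed
  have ch: "cfg R (\<Union>(h ` A)) (h ` A) {}"
  proof (rule cfgI)
    fix T assume "T \<in> h ` A"
    then obtain a where a: "a \<in> A" "T = insert a (g a)" by (auto simp: h_def)
    have "a \<notin> g a" using ga(2)[OF a(1)] a(1) by blast
    moreover have "finite (g a)" using ga(3)[OF a(1)] by (simp add: card_ge_0_finite)
    ultimately have "card T = 3" using ga(3)[OF a(1)] a(2) by simp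
    moreover have "R a x \<and> R x a" if "x \<in> g a" for x
      using g(3)[OF a(1)] that V(2) by (auto simp: rich_def symp_def)
    then have "pairwise R T"
      using ga(4)[OF a(1)] a(2) by (auto simp: pairwise_insert)
    moreover have "T \<subseteq> \<Union>(h ` A)" using \<open>T \<in> h ` A\<close> by blast
    ultimately show "T \<subseteq> \<Union>(h ` A) \<and> card T = 3 \<and> pairwise R T" by blast
  next
    have "disjnt (h a) (h b)" if "a \<in> A" "b \<in> A" "a \<noteq> b" for a b
    proof -
      have "g a \<noteq> g b" using g(1) that by (auto simp: inj_on_def)
      then have "disjnt (g a) (g b)"
        using cfgD(7)[OF c] ga(1) that by (auto simp: pairwise_def)
      then show ?thesis using ga(2) that unfolding h_def disjnt_def by blast
    qed
    then show "pairwise disjnt (h ` A \<union> {})" unfolding pairwise_def by auto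
  qed simp
  let ?M = "M - g ` A"
  have c': "cfg R (\<Union>\<T> \<union> \<Union>?M) \<T> ?M"
    by (rule cfg_region[OF cfg_subset[OF c]]) auto
  have dis: "(\<Union>\<T> \<union> \<Union>?M) \<inter> \<Union>(h ` A) = {}"
  proof -
    have "Y \<inter> h a = {}" if Y: "Y \<in> \<T> \<union> ?M" and a: "a \<in> A" for Y a
    proof -
      have "Y \<subseteq> V - A" using Y cfgD(1,4)[OF c] by blast
      moreover have "Y \<noteq> g a"
        using Y a ga(3)[OF a] cfgD(2)[OF c, of Y] by auto
      then have "disjnt Y (g a)"
        using cfgD(7)[OF c] Y ga(1)[OF a] by (auto simp: pairwise_def)
      ultimately show ?thesis using a unfolding h_def disjnt_def by blast
    qed
    then show ?thesis by blast
  qed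
  have "cfg R ((\<Union>\<T> \<union> \<Union>?M) \<union> \<Union>(h ` A)) (\<T> \<union> h ` A) (?M \<union> {})"
    by (rule cfg_union[OF c' ch dis])
  moreover have "(\<Union>\<T> \<union> \<Union>?M) \<union> \<Union>(h ` A) \<subseteq> V"
  proof -
    have "\<Union>\<T> \<subseteq> V" "\<Union>?M \<subseteq> V" using cfgD(1,4)[OF c] by blast+
    moreover have "\<Union>(h ` A) \<subseteq> V" using ga(2) A unfolding h_def by blast
    ultimately show ?thesis by blast
  qed
  ultimately show "cfg R V (\<T> \<union> h ` A) (M - g ` A)" using cfg_mono by fastforce
  have "\<T> \<inter> h ` A = {}" by (rule cfg_disjoint(1)[OF c' ch dis])
  then show "card (\<T> \<union> h ` A) = card \<T> + card A"
    using fins finA injh by (simp add: card_Un_disjoint card_image)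
  show "card A \<le> card M" using card_mono[OF fins(2) g(2)] g(1) by (simp add: card_image)
  show "card (M - g ` A) = card M - card A"
    using g(1,2) fins finA by (simp add: card_Diff_subset card_image)
qed

text \<open>With \<open>X = M - M'\<close> the completing edges lie in \<open>M'\<close>. So
  \<open>\<T>'\<close> and \<open>M'\<close> extend to a configuration of the whole graph with
  \<open>card A\<close> more triangles and \<open>card A\<close> fewer edges, to which the
  maximality of \<open>p\<close> and \<open>k\<close> applies.\<close>

lemma state_stable:
  assumes V: "finite V" "symp R" and s: "state D R V p k A \<T> M"
    and max: "\<And>\<T>' M'. cfg R V \<T>' M' \<Longrightarrow> card \<T>' \<le> p"
      "\<And>\<T>' M'. cfg R V \<T>' M' \<Longrightarrow> card \<T>' = p \<Longrightarrow> card M' \<le> k"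
  shows "stable D R (V - A) \<T> M"
  unfolding stable_def
proof (intro allI impI)
  fix \<T>' M' assume c: "cfg R (V - A) \<T>' M'" and le: "card (M - M') \<le> D"
  obtain g where g: "inj_on g A" "g ` A \<subseteq> M - (M - M')" "\<forall>a\<in>A. rich R a (g a)"
    using completableD[OF stateD(3)[OF s] Diff_subset le] by metis
  then have g2: "g ` A \<subseteq> M'" by blast
  note cc = cfg_complete[OF V stateD(1)[OF s] c g(1) g2 bspec[OF g(3)]]
  have "card \<T>' + card A \<le> p" using max(1)[OF cc(1)] cc(2) by simp
  moreover have "card M' - card A \<le> k" if "card \<T>' = card \<T>"
    using max(2)[OF cc(1)] cc(2,3) stateD(4)[OF s] that by simp
  ultimately show "card \<T>' \<le> card \<T> \<and> (card \<T>' = card \<T> \<longrightarrow> card M' \<le> card M)"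
    using stateD(4,5)[OF s] by auto
qed

text \<open>The edge \<open>T - {a}\<close> completes \<open>a\<close> unless it lies in
  \<open>X\<close>. If it does, \<open>X\<close> has fewer than \<open>D\<close> other edges, so one
  of the \<open>D\<close> edges for which \<open>a\<close> is rich is free. Forbidding that edge to
  \<open>A\<close> in place of \<open>T - {a}\<close> keeps the forbidden set within
  \<open>D\<close> edges.\<close>

lemma state_step:
  assumes V: "finite V" and s: "state D R V p k A \<T> M" and T: "T \<in> \<T>" "a \<in> T"
    and rich: "card {e \<in> M. rich R a e} \<ge> D" "D \<ge> 1"
  shows "state D R V p k (insert a A) (\<T> - {T}) (insert (T - {a}) M)"
proof -
  note c = stateD(2)[OF s]
  have fins: "finite \<T>" "finite M" using cfg_finite[OF c] V by auto
  have finA: "finite A" using stateD(1)[OF s] V finite_subset by blast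
  let ?e = "T - {a}"
  have TV: "T \<subseteq> V - A" "card T = 3" "pairwise R T" using cfgD(1-3)[OF c T(1)] by auto
  have finT: "finite T" using TV(2) by (simp add: card_ge_0_finite)
  have ce: "card ?e = 2" using TV(2) T(2) finT by simp
  have disj: "disjnt X T" if "X \<in> \<T> \<union> M" "X \<noteq> T" for X
    using cfgD(7)[OF c] that T(1) by (auto simp: pairwise_def)
  have aM: "a \<notin> X" if "X \<in> (\<T> - {T}) \<union> M" for X
  proof -
    have "X \<noteq> T" using that cfgD(5)[OF c, of X] TV(2) by auto
    then show ?thesis using disj[of X] that T(2) by (auto simp: disjnt_def)
  qed
  have eM: "?e \<notin> M"
  proof
    assume "?e \<in> M"
    moreover have "?e \<noteq> T" using T(2) by blast
    ultimately have "disjnt ?e T" using disj by blast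
    then have "?e = {}" by (auto simp: disjnt_def)
    then have "card ?e = 0" by (simp only: card.empty)
    then show False using ce by (simp only:)
  qed
  have cfg': "cfg R (V - insert a A) (\<T> - {T}) (insert ?e M)"
  proof (rule cfgI)
    fix X assume "X \<in> \<T> - {T}"
    then show "X \<subseteq> V - insert a A \<and> card X = 3 \<and> pairwise R X"
      using cfgD(1-3)[OF c, of X] aM[of X] by blast
  next
    fix e assume e: "e \<in> insert ?e M"
    have "pairwise R ?e" using TV(3) by (rule pairwise_subset) blast
    moreover have "?e \<subseteq> V - insert a A" using TV(1) by blast
    moreover have "e \<subseteq> V - insert a A" if "e \<in> M" using cfgD(4)[OF c that] aM[of e] that by blast
    ultimately show "e \<subseteq> V - insert a A \<and> card e = 2 \<and> pairwise R e"
      using e cfgD(5,6)[OF c, of e] ce by (cases "e = ?e") simp_all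
  next
    have p: "pairwise disjnt ((\<T> - {T}) \<union> M)" by (rule pairwise_subset[OF cfgD(7)[OF c]]) blast
    have d: "disjnt ?e X" if "X \<in> (\<T> - {T}) \<union> M" for X
    proof -
      have "X \<noteq> T" using that cfgD(5)[OF c, of X] TV(2) by auto
      then have "disjnt X T" using disj that by blast
      then show ?thesis by (auto simp: disjnt_def)
    qed
    have "pairwise disjnt (insert ?e ((\<T> - {T}) \<union> M))"
      unfolding pairwise_insert using p d disjnt_sym by blast
    then show "pairwise disjnt ((\<T> - {T}) \<union> insert ?e M)" by (simp only: Un_insert_right)
  qed
  have aA: "a \<notin> A" using TV(1) T(2) by blast
  have rich_e: "rich R a ?e" unfolding rich_def using pairwiseD(1)[OF TV(3) T(2)] by (intro ballI) auto
  have comp: "completable D R (insert a A) (insert ?e M)"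
    unfolding completable_def
  proof (intro allI impI)
    fix X assume X: "X \<subseteq> insert ?e M" "card X \<le> D"
    have finX: "finite X" using X(1) fins finite_subset by blast
    show "\<exists>g. inj_on g (insert a A) \<and> g ` insert a A \<subseteq> insert ?e M - X \<and> (\<forall>b\<in>insert a A. rich R b (g b))"
    proof -
      obtain e Y where e: "e \<in> insert ?e M - X" "rich R a e" "e \<notin> M - Y" "Y \<subseteq> M" "card Y \<le> D" "X \<inter> M \<subseteq> Y"
      proof (cases "?e \<in> X")
        case False
        then have "X \<subseteq> M" using X(1) by (simp add: subset_insert)
        show ?thesis
          by (rule that[of ?e X]) (use False rich_e eM X(2) \<open>X \<subseteq> M\<close> in simp_all)
      next
        case True
        then have "card (X - {?e}) < D" using X(2) finX rich(2) by (simp add: card_Diff_singleton)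
        then have "card (X - {?e}) < card {e \<in> M. rich R a e}" using rich(1) by simp
        then obtain e where e: "e \<in> {e \<in> M. rich R a e}" "e \<notin> X - {?e}"
          using pick_outside[of "X - {?e}"] finX by blast
        have "e \<noteq> ?e" using e(1) eM by auto
        have "card (insert e (X - {?e})) \<le> Suc (card (X - {?e}))" using finX by (simp add: card_insert_if)
        also have "\<dots> \<le> D" using \<open>card (X - {?e}) < D\<close> by simp
        finally have "card (insert e (X - {?e})) \<le> D" .
        moreover have "insert e (X - {?e}) \<subseteq> M" using X(1) e(1) True by (simp add: subset_insert_iff)
        moreover have "X \<inter> M \<subseteq> insert e (X - {?e})" using eM by auto
        moreover have "e \<in> insert ?e M - X" using e \<open>e \<noteq> ?e\<close> by simp
        ultimately show ?thesis using e(1) by (intro that[of e "insert e (X - {?e})"]) simp_all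
      qed
      obtain g where g: "inj_on g A" "g ` A \<subseteq> M - Y" "\<forall>b\<in>A. rich R b (g b)"
        using completableD[OF stateD(3)[OF s] e(4,5)] by metis
      let ?g = "g(a := e)"
      have gA: "?g b = g b" if "b \<in> A" for b using that aA by auto
      then have im: "?g ` A = g ` A" by (rule image_cong[OF refl])
      have "inj_on ?g A" using g(1) gA by (simp add: inj_on_def)
      moreover have "?g a \<notin> ?g ` A" unfolding im using g(2) e(3) by auto
      ultimately have "inj_on ?g (insert a A)" by (intro inj_on_insert_new)
      moreover have "?g ` insert a A \<subseteq> insert ?e M - X"
      proof -
        have "g ` A \<subseteq> insert ?e M - X" using g(2) e(6) by blast
        then show ?thesis using e(1) unfolding image_insert im by simp
      qed
      moreover have "\<forall>b\<in>insert a A. rich R b (?g b)" using g(3) gA e(2) by simp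
      ultimately show ?thesis by (intro exI[of _ ?g] conjI)
    qed
  qed
  have "card (insert a A) = Suc (card A)" using aA finA by simp
  moreover have "card (\<T> - {T}) = card \<T> - 1" using T(1) fins by simp
  moreover have "card \<T> > 0" using T(1) fins by (auto simp: card_gt_0_iff)
  moreover have "card (insert ?e M) = Suc (card M)" using eM fins by simp
  moreover have "insert a A \<subseteq> V" using stateD(1)[OF s] TV(1) T(2) by blast
  ultimately show ?thesis
    using cfg' comp stateD(4,5)[OF s] by (simp add: state_def)
qed

section \<open>The upper bound\<close>

text \<open>Twice the size of the extremal graph, as a polynomial up to rounding.\<close>

definition F2 :: "int \<Rightarrow> int \<Rightarrow> int" where
  "F2 n j = j * (j - 1) + 2 * j * (n - j) + 2 * ((n - j)^2 div 4)"

lemma square_div_4: "4 * (x^2 div 4) \<ge> x^2 - 1" for x :: int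
proof -
  have "x^2 mod 4 = 0 \<or> x^2 mod 4 = 1"
  proof (cases "even x")
    case True
    then obtain y where "x = 2 * y" by blast
    then show ?thesis by (simp add: power2_eq_square)
  next
    case False
    then obtain y where "x = 2 * y + 1" by (rule oddE)
    then have "x^2 = 1 + 4 * (y * y + y)" by (simp add: power2_eq_square algebra_simps)
    then have "x^2 mod 4 = 1" by (simp only: mod_mult_self2) simp
    then show ?thesis by blast
  qed
  then show ?thesis by (simp add: minus_mod_eq_mult_div[symmetric]) linarith
qed

lemma F2_step:
  assumes "j \<le> n - 2"
  shows "F2 n j \<le> F2 n (j + 1)"
proof -
  define m where "m = n - j"
  have "m^2 \<le> (m - 1)^2 + 4 * (m - 1)"
    using assms by (simp add: m_def power2_eq_square algebra_simps)
  then have "m^2 div 4 \<le> ((m - 1)^2 + 4 * (m - 1)) div 4" by (rule zdiv_mono1) simp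
  then have "m^2 div 4 \<le> (m - 1)^2 div 4 + (m - 1)" by simp
  moreover have n: "n = m + j" by (simp add: m_def)
  ultimately show ?thesis unfolding F2_def n by (simp add: algebra_simps)
qed

lemma F2_mono:
  assumes "i \<le> j" "j \<le> n - 1"
  shows "F2 n i \<le> F2 n j"
  using assms
proof (induction j rule: int_ge_induct)
  case (step j)
  then have "F2 n i \<le> F2 n j" by simp
  also have "\<dots> \<le> F2 n (j + 1)" by (rule F2_step) (use step in simp)
  finally show ?case .
qed simp

text \<open>The added terms are twice the number of pairs that meet a given set of \<open>s\<close>
  vertices. So deleting \<open>s\<close> vertices costs no more edges than the extremal number
  loses.\<close>

lemma F2_split: "F2 n (s + j) = F2 (n - s) j + s * (s - 1) + 2 * s * (n - s)"
proof -
  have "n - (s + j) = n - s - j" by simp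
  then show ?thesis unfolding F2_def by (simp only:) (simp add: algebra_simps)
qed

lemma F2_lower: "2 * F2 n j \<ge> n^2 + 2 * j * n - j^2 - 2 * j - 1"
proof -
  have "2 * F2 n j = 2 * j * (j - 1) + 4 * j * (n - j) + 4 * ((n - j)^2 div 4)"
    by (simp add: F2_def algebra_simps)
  moreover have "2 * j * (j - 1) + 4 * j * (n - j) + ((n - j)^2 - 1) = n^2 + 2 * j * n - j^2 - 2 * j - 1"
    by (simp add: power2_eq_square algebra_simps)
  ultimately show ?thesis using square_div_4[of "n - j"] by linarith
qed

lemma rainbow_pack_subset:
  "rainbow_pack c V \<T> \<Longrightarrow> \<T>' \<subseteq> \<T> \<Longrightarrow> rainbow_pack c V \<T>'"
  unfolding rainbow_pack_def
  by (meson UN_mono inj_on_subset order_refl pairwise_subset subsetD)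

lemma card_meeting_le:
  assumes "finite S" "pairwise disjnt F" "\<And>e. e \<in> F \<Longrightarrow> e \<inter> S \<noteq> {}"
  shows "card F \<le> card S"
proof -
  have "\<forall>e\<in>F. \<exists>x. x \<in> e \<inter> S" using assms(3) by blast
  then obtain h where h: "\<forall>e\<in>F. h e \<in> e \<inter> S" by (rule bchoice[THEN exE])
  have "inj_on h F"
  proof (rule inj_onI)
    fix e e' assume "e \<in> F" "e' \<in> F" "h e = h e'"
    then have "\<not> disjnt e e'" using h by (auto simp: disjnt_def)
    then show "e = e'" using assms(2) \<open>e \<in> F\<close> \<open>e' \<in> F\<close> by (auto simp: pairwise_def)
  qed
  moreover have "h ` F \<subseteq> S" using h by blast
  ultimately show ?thesis using assms(1) by (metis card_image card_mono)
qed

text \<open>\<open>max_pack\<close> speaks of the whole colouring, \<open>max_match\<close> only of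
  the graph \<open>E\<close> of representatives. The 4 in \<open>many\<close> is twice the 2 of the
  theorem, as \<open>F2\<close> is twice the extremal number.\<close>

locale extremal_colouring =
  fixes V :: "'a set" and c :: "'a set \<Rightarrow> nat" and E :: "'a set set" and p k t :: nat
  assumes fin_V: "finite V" and E: "E \<subseteq> pairs V" and injE: "inj_on c E"
    and max_pack: "\<And>\<T>. rainbow_pack c V \<T> \<Longrightarrow> card \<T> \<le> p"
    and max_match: "\<And>\<T> M. cfg (adj E) V \<T> M \<Longrightarrow> card \<T> = p \<Longrightarrow> card M \<le> k"
    and p: "1 \<le> p" "p \<le> t + 1" and large: "card V \<ge> 20000000" "2 * card V \<ge> 9 * t + 24"
    and many: "2 * int (card E) \<ge> F2 (int (card V)) (int t) + 4"
begin

abbreviation "R \<equiv> adj E"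
abbreviation "n \<equiv> int (card V)"

lemma symR: "symp R" and irR: "irreflp R"
  by (rule adj_sym, rule adj_irrefl[OF E])

lemma max_cfg: "cfg R V \<T> M \<Longrightarrow> card \<T> \<le> p"
  using max_pack cfg_rainbow[OF _ injE] by blast

lemma st_cfg:
  assumes "state D R V p k A \<T> M" "D \<ge> 3"
  shows "stable_cfg R (V - A) \<T> M"
proof
  show "stable 3 R (V - A) \<T> M"
  proof (rule stable_mono[OF _ assms(2)], rule state_stable[OF fin_V symR assms(1)])
    show "card \<T>' \<le> p" if "cfg R V \<T>' M'" for \<T>' M' by (rule max_cfg[OF that])
    show "card M' \<le> k" if "cfg R V \<T>' M'" "card \<T>' = p" for \<T>' M' by (rule max_match[OF that])
  qed
qed (use fin_V symR irR stateD(2)[OF assms(1)] in auto)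

lemma st_card:
  assumes "state D R V p k A \<T> M"
  shows "int (card (V - A)) = n - int (card A)" "int p = int (card A) + int (card \<T>)"
proof -
  have A: "A \<subseteq> V" "finite A" using stateD(1)[OF assms] fin_V finite_subset by auto
  show "int (card (V - A)) = n - int (card A)"
    using A card_mono[OF fin_V A(1)] by (simp add: card_Diff_subset of_nat_diff)
  show "int p = int (card A) + int (card \<T>)" using stateD(4)[OF assms] by simp
qed

text \<open>Each deletion lowers 2 n by 2 but 9 r by 9. At most \<open>t + 1\<close> vertices are
  deleted, fewer than a quarter of \<open>V\<close>.\<close>

lemma st_large:
  assumes "state D R V p k A \<T> M"
  shows "2 * int (card (V - A)) \<ge> 9 * int (card \<T>) + 15" "int (card (V - A)) \<ge> 10000000"
  using st_card[OF assms] p large by linarith+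

text \<open>By \<open>F2_split\<close> the excess survives the deletion of \<open>A\<close> even if
  \<open>A\<close> is joined to everything. Each missing adjacency between \<open>A\<close> and the
  rest is therefore gained by the rest.\<close>

lemma dense:
  assumes s: "state D R V p k A \<T> M" and r: "card \<T> \<ge> 1"
  shows "ed R (V - A) (V - A) \<ge> F2 (int (card (V - A))) (int (card \<T>) - 1) + 4
     + 2 * (int (card A) * int (card (V - A)) - ed R A (V - A))"
proof -
  let ?W = "V - A" and ?s = "int (card A)"
  have A: "A \<subseteq> V" "finite A" using stateD(1)[OF s] fin_V finite_subset by auto
  have "E \<inter> pairs V = E" using E by blast
  then have VV: "ed R V V = 2 * int (card E)" using ed_adj[OF fin_V E] by simp
  have "ed R (A \<union> ?W) (A \<union> ?W) = ed R A A + ed R A ?W + (ed R ?W A + ed R ?W ?W)"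
    using A fin_V by (simp only: ed_Un_left ed_Un_right finite_Diff finite_Un Diff_disjoint)
  moreover have "A \<union> ?W = V" using A by blast
  ultimately have sp: "ed R V V = ed R A A + 2 * ed R A ?W + ed R ?W ?W"
    using ed_commute[OF symR, of ?W A] by simp
  have "ed R A A = (\<Sum>a\<in>A. ed R {a} A)" by (rule ed_split_left[OF A(2)])
  also have "\<dots> \<le> (\<Sum>a\<in>A. ?s - 1)"
  proof (rule sum_mono)
    fix a assume a: "a \<in> A"
    have "{x \<in> A. R a x} \<subseteq> A - {a}" using irR by (auto simp: irreflp_def)
    then have "card {x \<in> A. R a x} \<le> card (A - {a})" using A by (intro card_mono) auto
    moreover have "card (A - {a}) = card A - 1" using a A by simp
    moreover have "card A \<noteq> 0" using a A by auto
    then have "card A \<ge> 1" by linarith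
    ultimately show "ed R {a} A \<le> ?s - 1" using ed_point_left[OF A(2), of R a] by linarith
  qed
  finally have AA: "ed R A A \<le> ?s * (?s - 1)" by simp
  have "F2 n (int p - 1) \<le> F2 n (int t)" using p large by (intro F2_mono) auto
  then have "2 * int (card E) \<ge> F2 n (int p - 1) + 4" using many by linarith
  moreover have "int p - 1 = ?s + (int (card \<T>) - 1)" using st_card(2)[OF s] by simp
  ultimately have "2 * int (card E) \<ge> F2 (n - ?s) (int (card \<T>) - 1) + ?s * (?s - 1) + 2 * ?s * (n - ?s) + 4"
    by (simp only: F2_split)
  then show ?thesis using VV sp AA unfolding st_card(1)[OF s] by (simp add: algebra_simps)
qed

lemma st_fin: "state D R V p k A \<T> M \<Longrightarrow> finite A"
  using stateD(1) fin_V finite_subset by metis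

lemma dense_simple:
  assumes s: "state D R V p k A \<T> M" and r: "card \<T> \<ge> 1"
  shows "ed R (V - A) (V - A) \<ge> F2 (int (card (V - A))) (int (card \<T>) - 1) + 4"
proof -
  have "ed R A (V - A) \<le> int (card A) * int (card (V - A))"
    using st_fin[OF s] fin_V by (intro ed_le_card) simp_all
  then have "x \<le> x + 2 * (int (card A) * int (card (V - A)) - ed R A (V - A))" for x by simp
  then show ?thesis using dense[OF s r] by (rule order_trans)
qed

lemma no_rich_two:
  assumes s: "state 3 R V p k A \<T> M" and r: "card \<T> \<ge> 2"
    and nr: "\<And>v. v \<in> \<Union>\<T> \<Longrightarrow> card {e \<in> M. rich R v e} \<le> 2"
  shows False
proof -
  interpret stable_cfg R "V - A" \<T> M by (rule st_cfg[OF s]) simp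
  interpret nonrich_cfg R "V - A" \<T> M by unfold_locales (rule nr)
  let ?N = "int (card (V - A))" and ?j = "int (card \<T>) - 1"
  have "2 * ed R (V - A) (V - A) < ?N^2 + 2 * ?j * ?N - ?j^2 - 2 * ?j + 7"
    by (rule edge_bound) (use st_large[OF s] r in auto)
  moreover have "ed R (V - A) (V - A) \<ge> F2 ?N ?j + 4"
    by (rule dense_simple[OF s]) (use r in simp)
  ultimately show False using F2_lower[of ?N ?j] by linarith
qed

lemma one_triangle_rich:
  assumes s1: "state D R V p k A1 \<T>1 M1" "card \<T>1 \<ge> 2"
    and nr: "\<And>v. v \<in> \<Union>\<T>1 \<Longrightarrow> card {e \<in> M1. rich R v e} \<le> 17"
    and s: "state 3 R V p k A \<T> M" "card \<T> = 1"
    and ext: "A1 \<subseteq> A" "A \<subseteq> A1 \<union> \<Union>\<T>1" "\<T> \<subseteq> \<T>1" "M1 \<subseteq> M"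
  shows False
proof -
  interpret stable_cfg R "V - A" \<T> M by (rule st_cfg[OF s(1)]) simp
  let ?W = "V - A"
  define N where "N = int (card ?W)"
  define d where "d = int (card \<T>1) - 1"
  define m1 where "m1 = int (card M1)"
  have finA: "finite A" by (rule st_fin[OF s(1)])
  have cA: "int (card A) = int (card A1) + d"
    using st_card(2)[OF s1(1)] st_card(2)[OF s(1)] s(2) by (simp add: d_def)
  have cM: "m = m1 + d"
    using stateD(5)[OF s1(1)] stateD(5)[OF s(1)] cA by (simp add: m1_def)
  have d1: "d \<ge> 1" using s1(2) by (simp add: d_def)
  obtain T where T: "\<T> = {T}" using s(2) by (auto simp: card_1_singleton_iff)
  then have TT: "T \<in> \<T>" "T \<in> \<T>1" using ext(3) by auto
  have NV: "N = 3 + 2 * m + i" unfolding N_def using card_V s(2) by simp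
  have finM1: "finite M1" using ext(4) finM finite_subset by blast
  have "inc T \<le> card (SIGMA v:T. {e \<in> M. rich R v e})"
    unfolding inc_def by (intro card_mono) (auto intro: T_facts(3)[OF TT(1)])
  also have "\<dots> = (\<Sum>v\<in>T. card {e \<in> M. rich R v e})"
    by (rule card_SigmaI) (use T_facts(3)[OF TT(1)] in auto)
  finally have "int (inc T) \<le> int (\<Sum>v\<in>T. card {e \<in> M. rich R v e})" by (simp only: of_nat_le_iff)
  also have "\<dots> = (\<Sum>v\<in>T. int (card {e \<in> M. rich R v e}))" by (rule of_nat_sum)
  \<comment> \<open>At most 17 edges come from \<open>M1\<close>, and \<open>d\<close> edges have
    been added to it.\<close>
  also have "\<dots> \<le> (\<Sum>v\<in>T. 17 + d)"
  proof (rule sum_mono)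
    fix v assume v: "v \<in> T"
    have "{e \<in> M. rich R v e} \<subseteq> {e \<in> M1. rich R v e} \<union> (M - M1)" by blast
    then have "card {e \<in> M. rich R v e} \<le> card ({e \<in> M1. rich R v e} \<union> (M - M1))"
      using finM1 finM by (intro card_mono) simp_all
    also have "\<dots> \<le> card {e \<in> M1. rich R v e} + card (M - M1)" by (rule card_Un_le)
    finally have "card {e \<in> M. rich R v e} \<le> card {e \<in> M1. rich R v e} + card (M - M1)" .
    moreover have "card {e \<in> M1. rich R v e} \<le> 17" by (rule nr) (use v TT(2) in blast)
    moreover have "int (card (M - M1)) = d"
      using card_mono[OF finM ext(4)] cM finM1 ext(4) by (simp add: card_Diff_subset of_nat_diff m1_def)
    ultimately show "int (card {e \<in> M. rich R v e}) \<le> 17 + d" by linarith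
  qed
  also have "\<dots> = 51 + 3 * d" using T_facts(2)[OF TT(1)] by simp
  finally have TM: "ed R T (\<Union>M) \<le> 3 * m + 51 + 3 * d" using ed_T_UM[OF TT(1)] by linarith
  have up: "ed R ?W ?W \<le> 6 + 2 * (3 * m + 51 + 3 * d) + 2 * (2 * i + 1) + 2 * m * (m + i)"
    using ed_total TM ed_T_I(1)[OF TT(1)] ed_TT_same[OF TT(1)] by (simp add: T)
  have UM1: "\<Union>M1 \<subseteq> ?W" using ext(4) M_facts(1) by blast
  have pd1: "pairwise disjnt M1" using pd_M ext(4) pairwise_subset by blast
  have fin1: "finite (\<Union>M1)" using UM1 fin_V finite_subset by blast
  have cUM1: "int (card (\<Union>M1)) = 2 * m1"
    using card_Union_disjoint[OF pd1] M_facts(2,3) ext(4) by (simp add: m1_def subset_iff)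
  have low1: "ed R {a} ?W \<le> N - of_bool (a \<in> A - A1) * (m1 - 17)" if a: "a \<in> A" for a
  proof (cases "a \<in> A1")
    case True
    then show ?thesis using ed_le_card[of "{a}" ?W R] fin_V by (simp add: N_def)
  next
    case False
    then have aT: "a \<in> \<Union>\<T>1" using a ext(2) by blast
    have "?W = \<Union>M1 \<union> (?W - \<Union>M1)" using UM1 by blast
    then have "ed R {a} ?W = ed R {a} (\<Union>M1) + ed R {a} (?W - \<Union>M1)"
      using ed_Un_right[of "\<Union>M1" "?W - \<Union>M1" R "{a}"] fin1 fin_V by (metis Diff_disjoint finite_Diff)
    moreover have "ed R {a} (?W - \<Union>M1) \<le> N - 2 * m1"
    proof -
      have "ed R {a} (?W - \<Union>M1) \<le> int (card (?W - \<Union>M1))"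
        using ed_le_card[of "{a}" "?W - \<Union>M1" R] fin_V by simp
      also have "\<dots> = N - 2 * m1"
        using card_mono[OF finite_Diff[OF fin_V] UM1] fin1 UM1 cUM1 by (simp add: card_Diff_subset of_nat_diff N_def)
      finally show ?thesis .
    qed
    moreover have "ed R {a} (\<Union>M1) \<le> m1 + 17"
    proof -
      have "ed R {a} (\<Union>M1) = (\<Sum>e\<in>M1. ed R {a} e)"
        using pd1 M_facts(3) ext(4) by (intro ed_Union_right) auto
      also have "\<dots> \<le> (\<Sum>e\<in>M1. 1 + of_bool (rich R a e))"
      proof (rule sum_mono)
        fix e assume "e \<in> M1"
        then have "e \<in> M" using ext(4) by blast
        then show "ed R {a} e \<le> 1 + of_bool (rich R a e)" by (rule ed_point_edge)
      qed
      also have "\<dots> = m1 + int (card {e \<in> M1. rich R a e})"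
        unfolding sum.distrib using finM1 by (simp add: Int_def m1_def)
      finally show ?thesis using nr[OF aT] by linarith
    qed
    ultimately show ?thesis using False a by simp
  qed
  have "ed R A ?W = (\<Sum>a\<in>A. ed R {a} ?W)" by (rule ed_split_left[OF finA])
  also have "\<dots> \<le> (\<Sum>a\<in>A. N - of_bool (a \<in> A - A1) * (m1 - 17))" by (intro sum_mono low1)
  also have "\<dots> = int (card A) * N - d * (m1 - 17)"
  proof -
    have "{a \<in> A. a \<in> A - A1} = A - A1" by blast
    then have "(\<Sum>a\<in>A. of_bool (a \<in> A - A1)) = int (card (A - A1))" using finA by (simp add: Int_def)
    also have "\<dots> = d"
      using cA ext(1) finA finite_subset[OF ext(1) finA] card_mono[OF finA ext(1)]
      by (simp add: card_Diff_subset of_nat_diff)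
    finally have "(\<Sum>a\<in>A. of_bool (a \<in> A - A1)) = d" .
    then show ?thesis by (simp only: sum_subtractf sum_distrib_right[symmetric]) simp
  qed
  finally have "d * (m1 - 17) \<le> int (card A) * N - ed R A ?W" by simp
  then have "ed R ?W ?W \<ge> F2 N 0 + 4 + 2 * (d * (m1 - 17))"
    using dense[OF s(1)] s(2) unfolding N_def by simp
  moreover have "2 * F2 N 0 \<ge> N^2 - 1" using F2_lower[of N 0] by simp
  ultimately have low: "2 * ed R ?W ?W \<ge> N^2 + 7 + 4 * (d * (m1 - 17))" by linarith
  \<comment> \<open>The term \<open>12 * d\<close> of the upper bound turns 17 into 20, and 204 =
    211 - 7.\<close>
  have key: "4 * (d * (m1 - 20)) + i^2 - 2 * i \<le> 204"
  proof -
    have "2 * (6 + 2 * (3 * m + 51 + 3 * d) + 2 * (2 * i + 1) + 2 * m * (m + i)) = N^2 + 211 + 12 * d + 2 * i - i^2"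
      unfolding NV by (simp add: power2_eq_square algebra_simps)
    moreover have "x \<le> z" if "2 * y = z" "e \<le> y" "x \<le> 2 * e" for x y z e :: int using that by simp
    ultimately have "N^2 + 7 + 4 * (d * (m1 - 17)) \<le> N^2 + 211 + 12 * d + 2 * i - i^2"
      using up low by blast
    then show ?thesis by (simp add: algebra_simps)
  qed
  show False
  \<comment> \<open>72 is the least value for which 4 (m1 - 20) - 1 exceeds 204.\<close>
  proof (cases "m1 \<ge> 72")
    case True
    have "d * (m1 - 20) \<ge> 1 * 52" using True d1 by (intro mult_mono) auto
    moreover have "i^2 - 2 * i = (i - 1)^2 - 1" by (simp add: power2_eq_square algebra_simps)
    moreover have "(i - 1)^2 \<ge> 0" by simp
    ultimately show False using key by linarith
  next
    case False
    have "i = N - 3 - 2 * m1 - 2 * d" using NV cM by simp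
    moreover have "N = int (card (V - A1)) - d" using st_card(1)[OF s1(1)] st_card(1)[OF s(1)] cA by (simp add: N_def)
    moreover have "2 * int (card (V - A1)) \<ge> 9 * d + 24" "int (card (V - A1)) \<ge> 10000000"
      using st_large[OF s1(1)] by (simp_all add: d_def)
    ultimately have i: "i \<ge> 1000000" "i \<ge> d" using False by linarith+
    have "i * i \<ge> 1000000 * i" using i(1) by (intro mult_right_mono) auto
    moreover have "d * (m1 - 20) \<ge> d * (-20)" using d1 by (intro mult_left_mono) (auto simp: m1_def)
    then have "d * (m1 - 20) \<ge> - 20 * d" by simp
    ultimately show False using key i unfolding power2_eq_square by linarith
  qed
qed

text \<open>The number 18 counts the 6 vertices of the two new triangles and the at most 12 vertices of
  the edges in \<open>E\<close> that share a colour with them.\<close>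

lemma one_triangle:
  assumes s: "state 18 R V p k A \<T> M" "card \<T> = 1"
  shows False
proof -
  let ?W = "V - A"
  note c0 = stateD(2)[OF s(1)]
  have A: "A \<subseteq> V" by (rule stateD(1)[OF s(1)])
  have finW: "finite ?W" using fin_V by simp
  let ?E = "E \<inter> pairs ?W"
  have finE: "finite E" by (rule finite_subset[OF E pairs_finite[OF fin_V]])
  have big: "int (card ?E) \<ge> int (card ?W) ^ 2 div 4 + 2"
    using dense_simple[OF s(1)] s(2) ed_adj[OF finW E] by (simp add: F2_def)
  have "card ?E \<ge> card ?W ^ 2 div 4 + 2"
  proof -
    have "int (card ?W ^ 2 div 4 + 2) \<le> int (card ?E)" using big by (simp add: zdiv_int)
    then show ?thesis by (simp only: of_nat_le_iff)
  qed
  moreover have "card ?W \<ge> 1000" using st_large(2)[OF s(1)] by linarith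
  moreover have "inj_on c ?E" using injE by (rule inj_on_subset) blast
  ultimately obtain T1 T2 where T12: "T1 \<noteq> T2" "rainbow_pack c ?W {T1, T2}"
    using two_rainbow_triangles[of ?W ?E c] finW by blast
  have T: "T1 \<subseteq> ?W" "T2 \<subseteq> ?W" "card T1 = 3" "card T2 = 3" "T1 \<inter> T2 = {}"
    using T12 by (auto simp: rainbow_pack_def pairwise_def disjnt_def)
  define P where "P = pairs T1 \<union> pairs T2"
  have injP: "inj_on c P" using T12(2) by (simp add: rainbow_pack_def P_def)
  have card_pairs: "finite (pairs T) \<and> card (pairs T) = 3" if c3: "card T = 3" for T :: "'a set"
  proof -
    obtain x y z where xyz: "T = {x, y, z}" "x \<noteq> y" "y \<noteq> z" "x \<noteq> z"
      using c3 by (auto simp: card_3_iff)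
    have "{x, y} \<noteq> {y, z}" "{x, y} \<noteq> {x, z}" "{y, z} \<noteq> {x, z}"
      using xyz by (auto simp: doubleton_eq_iff)
    then show ?thesis unfolding xyz(1) pairs_triple[OF xyz(2-4)] by simp
  qed
  have P6: "finite P" "card P \<le> 6"
    using card_pairs[OF T(3)] card_pairs[OF T(4)] card_Un_le[of "pairs T1" "pairs T2"] by (simp_all add: P_def)
  \<comment> \<open>\<open>T1\<close> and \<open>T2\<close> may use edges outside \<open>E\<close>,
    so the edges of \<open>E\<close> that carry the same colours have to be avoided as well.\<close>
  define G where "G = {e \<in> E. c e \<in> c ` P}"
  have finG: "finite G" using finE by (simp add: G_def)
  have "inj_on c G" using injE by (rule inj_on_subset) (auto simp: G_def)
  then have "card G = card (c ` G)" by (simp add: card_image)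
  also have "\<dots> \<le> card (c ` P)" using P6(1) by (intro card_mono) (auto simp: G_def)
  also have "\<dots> \<le> 6" using card_image_le[OF P6(1), of c] P6(2) by linarith
  finally have G6: "card G \<le> 6" .
  have G2: "card e = 2" if "e \<in> G" for e using that E by (auto simp: G_def pairs_def)
  have UG: "finite (\<Union>G)" "card (\<Union>G) \<le> 12"
  proof -
    show "finite (\<Union>G)" using finG G2 by (auto simp: card_ge_0_finite)
    have "card (\<Union>G) \<le> (\<Sum>e\<in>G. card e)" by (rule card_Union_le_sum_card)
    also have "\<dots> = card G * 2" using G2 by simp
    finally show "card (\<Union>G) \<le> 12" using G6 by linarith
  qed
  define S where "S = T1 \<union> T2 \<union> \<Union>G"
  have S: "finite S" "card S \<le> 18"
  proof -
    show "finite S" using T UG by (auto simp: S_def card_ge_0_finite)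
    have "card S \<le> card (T1 \<union> T2) + card (\<Union>G)" unfolding S_def by (rule card_Un_le)
    also have "card (T1 \<union> T2) \<le> card T1 + card T2" by (rule card_Un_le)
    finally show "card S \<le> 18" using T(3,4) UG(2) by linarith
  qed
  let ?X = "{e \<in> M. e \<inter> S \<noteq> {}}"
  have pd: "pairwise disjnt ?X" by (rule pairwise_subset[OF cfgD(7)[OF c0]]) blast
  have "card ?X \<le> card S" by (rule card_meeting_le[OF S(1) pd]) blast
  then have "card ?X \<le> 18" using S(2) by simp
  then obtain g where g: "inj_on g A" "g ` A \<subseteq> M - ?X" "\<forall>a\<in>A. rich R a (g a)"
    using completableD[OF stateD(3)[OF s(1)], of ?X] by (metis (no_types, lifting) mem_Collect_eq subsetI)
  have gM: "g ` A \<subseteq> M" using g(2) by blast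
  have c1: "cfg R ?W {} M" using c0 by (rule cfg_subset) auto
  define \<H> where "\<H> = (\<lambda>a. insert a (g a)) ` A"
  have ch: "cfg R V \<H> (M - g ` A)" and cardh: "card \<H> = card A"
    using cfg_complete(1,2)[OF fin_V symR A c1 g(1) gM bspec[OF g(3)]] by (simp_all add: \<H>_def)
  have gS: "g a \<inter> S = {}" if "a \<in> A" for a using g(2) that by blast
  have hd: "H \<inter> T' = {}" if H: "H \<in> \<H>" and T': "T' \<in> {T1, T2}" for H T'
  proof -
    obtain a where a: "a \<in> A" "H = insert a (g a)" using H by (auto simp: \<H>_def)
    have "T' \<subseteq> S" "a \<notin> T'" using T' T(1,2) a(1) by (auto simp: S_def)
    then show ?thesis using gS[OF a(1)] a(2) by blast
  qed
  define Q where "Q = (\<Union>H\<in>\<H>. pairs H)"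
  have QE: "Q \<subseteq> E" unfolding Q_def using cfg_adj_pairs[OF ch] by blast
  \<comment> \<open>An edge of \<open>E\<close> with a colour of \<open>P\<close> lies inside
    \<open>S\<close>, whereas a completed triangle meets \<open>S\<close> at most in its deleted
    vertex.\<close>
  have sep: "c e \<notin> c ` P" if eQ: "e \<in> Q" for e
  proof
    assume "c e \<in> c ` P"
    then have "e \<in> G" using eQ QE by (auto simp: G_def)
    then have eS: "e \<subseteq> S" by (auto simp: S_def)
    obtain a where a: "a \<in> A" "e \<in> pairs (insert a (g a))" using eQ by (auto simp: Q_def \<H>_def)
    then have "e \<subseteq> {a}" using eS gS[OF a(1)] by (auto simp: pairs_def)
    then have "card e \<le> card {a}" by (intro card_mono) auto
    then show False using a(2) by (simp add: pairs_def)
  qed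
  have "inj_on c (P \<union> Q)"
  proof -
    have "x \<notin> c ` P" if "x \<in> c ` Q" for x using that sep by (elim imageE) simp
    then have "c ` P \<inter> c ` Q = {}" by blast
    then have "c ` (P - Q) \<inter> c ` (Q - P) = {}" by blast
    then show ?thesis using injP inj_on_subset[OF injE QE] by (simp add: inj_on_Un)
  qed
  moreover have "(\<Union>H\<in>{T1, T2} \<union> \<H>. pairs H) = P \<union> Q" by (auto simp: P_def Q_def)
  moreover have "\<forall>H\<in>{T1, T2} \<union> \<H>. H \<subseteq> V \<and> card H = 3"
    using T cfgD(1,2)[OF ch] by auto
  moreover have "pairwise disjnt ({T1, T2} \<union> \<H>)"
  proof (rule pairwiseI)
    fix X Y assume XY: "X \<in> {T1, T2} \<union> \<H>" "Y \<in> {T1, T2} \<union> \<H>" "X \<noteq> Y"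
    show "disjnt X Y"
    proof (cases "X \<in> \<H> \<longleftrightarrow> Y \<in> \<H>")
      case True
      then consider "X \<in> \<H>" "Y \<in> \<H>" | "X \<in> {T1, T2}" "Y \<in> {T1, T2}" using XY by blast
      then show ?thesis
      proof cases
        case 1
        then show ?thesis using cfgD(7)[OF ch] XY(3) by (simp add: pairwise_def)
      next
        case 2
        then show ?thesis using T(5) XY(3) by (auto simp: disjnt_def)
      qed
    next
      case False
      then show ?thesis using hd[of X Y] hd[of Y X] XY by (auto simp: disjnt_def)
    qed
  qed
  ultimately have "rainbow_pack c V ({T1, T2} \<union> \<H>)" by (simp add: rainbow_pack_def)
  then have "card ({T1, T2} \<union> \<H>) \<le> p" by (rule max_pack)
  moreover have "card ({T1, T2} \<union> \<H>) = 2 + card A"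
  proof -
    have "{T1, T2} \<inter> \<H> = {}"
    proof -
      have "T1 \<noteq> {}" "T2 \<noteq> {}" using T(3,4) by auto
      then show ?thesis using hd by blast
    qed
    moreover have "finite \<H>" using cfg_finite(1)[OF ch fin_V] .
    ultimately show ?thesis using T12(1) cardh by (simp add: card_Un_disjoint)
  qed
  ultimately show False using stateD(4)[OF s(1)] s(2) by simp
qed

text \<open>The cap \<open>p - 1\<close> on \<open>card A\<close> keeps one triangle. So at a state
  with \<open>card A\<close> maximal either a single triangle is left, or no further vertex is rich
  enough to be deleted.\<close>

lemma contradiction:
  assumes "cfg R V \<T>0 M0" "card \<T>0 = p" "card M0 = k"
  shows False
proof -
  let ?P = "\<lambda>z. state 18 R V p k (fst z) (fst (snd z)) (snd (snd z)) \<and> card (fst z) \<le> p - 1"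
  have "\<exists>z. ?P z \<and> (\<forall>y. ?P y \<longrightarrow> card (fst y) \<le> card (fst z))"
  proof (rule Lattices_Big.ex_has_greatest_nat)
    show "?P ({}, \<T>0, M0)" using state_start[OF assms, of 18] by simp
    show "\<forall>y. ?P y \<longrightarrow> card (fst y) < p" using p by auto
  qed
  then obtain A1 \<T>1 M1 where s1: "state 18 R V p k A1 \<T>1 M1" "card A1 \<le> p - 1"
    and max1: "\<And>A \<T> M. state 18 R V p k A \<T> M \<Longrightarrow> card A \<le> p - 1 \<Longrightarrow> card A \<le> card A1"
    by (metis fst_conv snd_conv)
  have "card \<T>1 \<ge> 1" using stateD(4)[OF s1(1)] s1(2) p by linarith
  moreover have "card \<T>1 \<noteq> 1" using one_triangle[OF s1(1)] by blast
  ultimately have r1: "card \<T>1 \<ge> 2" by linarith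
  have nr1: "card {e \<in> M1. rich R v e} \<le> 17" if v: "v \<in> \<Union>\<T>1" for v
  proof (rule ccontr)
    assume "\<not> ?thesis"
    then have ge: "card {e \<in> M1. rich R v e} \<ge> 18" by simp
    obtain T where T: "T \<in> \<T>1" "v \<in> T" using v by blast
    have "v \<notin> A1" using cfgD(1)[OF stateD(2)[OF s1(1)] T(1)] T(2) by blast
    then have "card (insert v A1) = Suc (card A1)" using st_fin[OF s1(1)] by simp
    moreover have "card (insert v A1) \<le> p - 1"
      using calculation r1 stateD(4)[OF s1(1)] by linarith
    ultimately show False using max1[OF state_step[OF fin_V s1(1) T ge]] by simp
  qed
  \<comment> \<open>The inclusions record where the second round started, as
    \<open>one_triangle_rich\<close> needs the bound 17 for the vertices it deletes.\<close>
  let ?Q = "\<lambda>z. state 3 R V p k (fst z) (fst (snd z)) (snd (snd z)) \<and> card (fst z) \<le> p - 1 \<and>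
     A1 \<subseteq> fst z \<and> fst z \<subseteq> A1 \<union> \<Union>\<T>1 \<and> fst (snd z) \<subseteq> \<T>1 \<and> M1 \<subseteq> snd (snd z)"
  have "\<exists>z. ?Q z \<and> (\<forall>y. ?Q y \<longrightarrow> card (fst y) \<le> card (fst z))"
  proof (rule Lattices_Big.ex_has_greatest_nat)
    show "?Q (A1, \<T>1, M1)" using state_antimono[OF s1(1), of 3] s1(2) by simp
    show "\<forall>y. ?Q y \<longrightarrow> card (fst y) < p" using p by auto
  qed
  then obtain z where z: "?Q z" "\<forall>y. ?Q y \<longrightarrow> card (fst y) \<le> card (fst z)" by blast
  obtain A \<T> M where zz: "z = (A, \<T>, M)" by (cases z)
  have s: "state 3 R V p k A \<T> M" "card A \<le> p - 1" "A1 \<subseteq> A" "A \<subseteq> A1 \<union> \<Union>\<T>1" "\<T> \<subseteq> \<T>1" "M1 \<subseteq> M"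
    using z(1) zz by simp_all
  have "card \<T> \<ge> 1" using stateD(4)[OF s(1)] s(2) p by linarith
  moreover have "card \<T> \<noteq> 1"
    using one_triangle_rich[OF s1(1) r1 nr1 s(1) _ s(3-6)] by blast
  ultimately have r: "card \<T> \<ge> 2" by linarith
  have "card {e \<in> M. rich R v e} \<le> 2" if v: "v \<in> \<Union>\<T>" for v
  proof (rule ccontr)
    assume "\<not> ?thesis"
    then have ge: "card {e \<in> M. rich R v e} \<ge> 3" by simp
    obtain T where T: "T \<in> \<T>" "v \<in> T" using v by blast
    have "v \<notin> A" using cfgD(1)[OF stateD(2)[OF s(1)] T(1)] T(2) by blast
    then have ins: "card (insert v A) = Suc (card A)" using st_fin[OF s(1)] by simp
    then have "card (insert v A) \<le> p - 1"
      using r stateD(4)[OF s(1)] by linarith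
    moreover have "state 3 R V p k (insert v A) (\<T> - {T}) (insert (T - {v}) M)"
      by (rule state_step[OF fin_V s(1) T ge]) simp
    moreover have "insert v A \<subseteq> A1 \<union> \<Union>\<T>1" using s(4,5) T by blast
    ultimately have Q': "?Q (insert v A, \<T> - {T}, insert (T - {v}) M)"
      using s(3,5,6) by (simp add: subset_insertI2 subset_iff)
    have "card (insert v A) \<le> card A" using z(2)[rule_format, OF Q'] zz by simp
    then show False using ins by simp
  qed
  then show False by (rule no_rich_two[OF s(1) r])
qed

end

text \<open>\<open>E\<close> consists of all edges of a largest rainbow family and one edge of each
  remaining colour, so it has as many edges as there are colours. Mantel's theorem shows that the
  family is not empty.\<close>

lemma upper_bound:
  assumes finV: "finite V" and large: "card V \<ge> 20000000" "2 * card V \<ge> 9 * t + 24"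
    and many: "2 * int (card (c ` pairs V)) \<ge> F2 (int (card V)) (int t) + 4"
  shows "\<exists>\<T>. rainbow_pack c V \<T> \<and> card \<T> = t + 2"
proof (rule ccontr)
  assume no: "\<not> ?thesis"
  have small: "card \<T> < t + 2" if "rainbow_pack c V \<T>" for \<T>
  proof (rule ccontr)
    assume "\<not> ?thesis"
    then obtain \<T>' where "\<T>' \<subseteq> \<T>" "card \<T>' = t + 2"
      using obtain_subset_with_card_n[of "t + 2" \<T>] by (metis not_less)
    then show False using no rainbow_pack_subset[OF that] by blast
  qed
  have "rainbow_pack c V {}" by (simp add: rainbow_pack_def)
  then obtain \<T>0 where T0: "rainbow_pack c V \<T>0" "\<And>\<T>. rainbow_pack c V \<T> \<Longrightarrow> card \<T> \<le> card \<T>0"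
    using Lattices_Big.ex_has_greatest_nat[of "rainbow_pack c V" "{}" card "t + 2"] small by blast
  define P where "P = (\<Union>T\<in>\<T>0. pairs T)"
  have P: "P \<subseteq> pairs V" "inj_on c P"
  proof -
    show "P \<subseteq> pairs V" using T0(1) pairs_mono unfolding P_def rainbow_pack_def by blast
    show "inj_on c P" using T0(1) by (simp add: rainbow_pack_def P_def)
  qed
  obtain U where U: "U \<subseteq> pairs V" "inj_on c U" "c ` pairs V - c ` P = c ` U"
    using subset_image_inj[of "c ` pairs V - c ` P" c "pairs V"] by blast
  define E where "E = P \<union> U"
  have E: "E \<subseteq> pairs V" using P U by (simp add: E_def)
  have injE: "inj_on c E"
  proof -
    have "c ` P \<inter> c ` U = {}" using U(3) by blast
    then have "c ` (P - U) \<inter> c ` (U - P) = {}" by blast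
    then show ?thesis using P(2) U(2) by (simp add: E_def inj_on_Un)
  qed
  have "c ` E = c ` pairs V" using P(1) U(3) by (auto simp: E_def image_Un)
  then have cE: "card E = card (c ` pairs V)" using injE card_image by metis
  have c0: "cfg (adj E) V \<T>0 {}"
  proof (rule cfgI)
    fix T assume T: "T \<in> \<T>0"
    have "pairwise (adj E) T"
    proof (rule pairwiseI)
      fix x y assume "x \<in> T" "y \<in> T" "x \<noteq> y"
      then have "{x, y} \<in> pairs T" by (simp add: pairs_doubleton)
      then show "{x, y} \<in> E" using T by (auto simp: E_def P_def)
    qed
    then show "T \<subseteq> V \<and> card T = 3 \<and> pairwise (adj E) T" using T0(1) T by (simp add: rainbow_pack_def)
  next
    show "pairwise disjnt (\<T>0 \<union> {})" using T0(1) by (simp add: rainbow_pack_def)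
  qed simp
  obtain \<T> M where M: "cfg (adj E) V \<T> M" "card \<T> = card \<T>0"
    "\<And>\<T>' M'. cfg (adj E) V \<T>' M' \<Longrightarrow> card \<T>' = card \<T>0 \<Longrightarrow> card M' \<le> card M"
    using max_cfg_edges[OF finV c0] by metis
  have p1: "card \<T>0 \<ge> 1"
  proof (rule ccontr)
    assume "\<not> ?thesis"
    then have z: "card \<T>0 = 0" by simp
    have "2 * ed (adj E) V V \<le> int (card V) ^ 2"
    proof (rule mantel[OF finV adj_sym adj_irrefl[OF E]])
      show "\<not> cfg (adj E) V {T} {}" for T
      proof
        assume "cfg (adj E) V {T} {}"
        then have "card {T} \<le> card \<T>0" using T0(2) cfg_rainbow[OF _ injE] by blast
        then show False using z by simp
      qed
    qed
    moreover have "E \<inter> pairs V = E" using E by blast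
    then have "ed (adj E) V V = 2 * int (card E)" using ed_adj[OF finV E] by simp
    moreover have "F2 (int (card V)) 0 \<le> F2 (int (card V)) (int t)" using large by (intro F2_mono) auto
    moreover have "2 * F2 (int (card V)) 0 \<ge> int (card V) ^ 2 - 1" using F2_lower[of "int (card V)" 0] by simp
    ultimately show False using many cE by linarith
  qed
  interpret extremal_colouring V c E "card \<T>0" "card M" t
  proof
    show "card \<T>0 \<le> t + 1" using small[OF T0(1)] by simp
  qed (use finV E injE T0(2) M(3) p1 large many cE in simp_all)
  show False by (rule contradiction[OF M(1,2) refl])
qed

section \<open>The extremal colouring and the theorem\<close>

lemma edges_complete_graph: "edges (complete_graph n) = pairs {1..n}"
  by (simp add: complete_graph_def pairs_def)

lemma pairs_image:
  assumes "inj_on f W"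
  shows "pairs (f ` W) = (\<lambda>e. f ` e) ` pairs W"
proof
  show "pairs (f ` W) \<subseteq> (\<lambda>e. f ` e) ` pairs W"
  proof
    fix e assume "e \<in> pairs (f ` W)"
    then obtain x y where "e = {f x, f y}" "x \<in> W" "y \<in> W" "f x \<noteq> f y"
      by (auto simp: pairs_def card_2_iff)
    then have "e = f ` {x, y}" "{x, y} \<in> pairs W" by (auto simp: pairs_doubleton)
    then show "e \<in> (\<lambda>e. f ` e) ` pairs W" by blast
  qed
  show "(\<lambda>e. f ` e) ` pairs W \<subseteq> pairs (f ` W)"
  proof
    fix e' assume "e' \<in> (\<lambda>e. f ` e) ` pairs W"
    then obtain e where e: "e' = f ` e" "e \<subseteq> W" "card e = 2" by (auto simp: pairs_def)
    then have "card e' = 2" using inj_on_subset[OF assms e(2)] by (simp add: card_image)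
    then show "e' \<in> pairs (f ` W)" using e by (auto simp: pairs_def)
  qed
qed

lemma edges_copies:
  "edges (disjoint_copies s (complete_graph k)) = (\<Union>i\<in>{1..s}. pairs (Pair i ` {1..k}))"
proof -
  have "pairs (Pair i ` {1..k}) = (\<lambda>e. Pair i ` e) ` pairs {1..k}" for i :: nat
    by (rule pairs_image) (simp add: inj_on_def)
  moreover have "edges (disjoint_copies s (complete_graph k)) =
      (\<Union>i\<in>{1..s}. (\<lambda>e. Pair i ` e) ` edges (complete_graph k))"
  proof -
    have "{g i e | i e. i \<in> J \<and> e \<in> S} = (\<Union>i\<in>J. g i ` S)"
      for g :: "nat \<Rightarrow> nat set \<Rightarrow> (nat \<times> nat) set" and J S by blast
    then show ?thesis by (simp only: disjoint_copies_def snd_conv)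
  qed
  ultimately show ?thesis by (simp add: edges_complete_graph)
qed

lemma vertices_copies:
  "vertices (disjoint_copies s (complete_graph k)) = (\<Union>i\<in>{1..s}. Pair i ` {1..k})"
  by (auto simp: disjoint_copies_def complete_graph_def)

lemma pack_of_copy:
  assumes "has_rainbow_copy (complete_graph n) c (disjoint_copies s (complete_graph 3))"
  shows "\<exists>\<T>. rainbow_pack c {1..n} \<T> \<and> card \<T> = s"
proof -
  let ?H = "disjoint_copies s (complete_graph 3)"
  obtain G f where G: "subgraph G (complete_graph n)" "rainbow c G"
    and f: "bij_betw f (vertices ?H) (vertices G)" "edges G = (\<lambda>e. f ` e) ` edges ?H"
    using assms by (auto simp: has_rainbow_copy_def graph_isomorphic_def)
  define B where "B i = Pair i ` {1..3::nat}" for i :: nat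
  have B: "B i \<subseteq> vertices ?H" "card (B i) = 3" "finite (B i)" "B i \<noteq> {}" if "i \<in> {1..s}" for i
  proof -
    show "B i \<subseteq> vertices ?H" using that by (auto simp: vertices_copies B_def)
    show "card (B i) = 3" "finite (B i)" "B i \<noteq> {}" by (simp_all add: B_def card_image inj_on_def)
  qed
  have inj: "inj_on f (vertices ?H)" using f(1) by (simp add: bij_betw_def)
  define T where "T i = f ` B i" for i
  have dis: "T i \<inter> T j = {}" if "i \<in> {1..s}" "j \<in> {1..s}" "i \<noteq> j" for i j
  proof -
    have "B i \<inter> B j = {}" using that(3) by (auto simp: B_def)
    then show ?thesis
      using inj_on_image_Int[OF inj B(1)[OF that(1)] B(1)[OF that(2)]] by (simp add: T_def)
  qed
  have injT: "inj_on T {1..s}"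
  proof (rule inj_onI)
    fix i j assume ij: "i \<in> {1..s}" "j \<in> {1..s}" "T i = T j"
    have "T i \<noteq> {}" using B(4)[OF ij(1)] by (simp add: T_def)
    then show "i = j" using dis[OF ij(1,2)] ij(3) by auto
  qed
  have "vertices G \<subseteq> {1..n}" using G(1) by (simp add: subgraph_def complete_graph_def)
  then have sub: "T i \<subseteq> {1..n}" if "i \<in> {1..s}" for i
    using f(1) B(1)[OF that] unfolding bij_betw_def T_def by blast
  have "pairs (T i) = (\<lambda>e. f ` e) ` pairs (B i)" if "i \<in> {1..s}" for i
    unfolding T_def by (rule pairs_image[OF inj_on_subset[OF inj B(1)[OF that]]])
  then have "(\<Union>i\<in>{1..s}. pairs (T i)) = (\<lambda>e. f ` e) ` (\<Union>i\<in>{1..s}. pairs (B i))"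
    by (simp add: image_UN)
  then have "(\<Union>i\<in>{1..s}. pairs (T i)) = edges G"
    using f(2) by (simp only: edges_copies B_def)
  then have "inj_on c (\<Union>X\<in>T ` {1..s}. pairs X)" using G(2) by (simp add: rainbow_def)
  moreover have "pairwise disjnt (T ` {1..s})"
  proof (rule pairwiseI)
    fix X Y assume "X \<in> T ` {1..s}" "Y \<in> T ` {1..s}" "X \<noteq> Y"
    then obtain i j where "X = T i" "Y = T j" "i \<in> {1..s}" "j \<in> {1..s}" "i \<noteq> j" by blast
    then show "disjnt X Y" using dis by (simp add: disjnt_def)
  qed
  moreover have "card (T i) = 3" if "i \<in> {1..s}" for i
    using B(2)[OF that] card_image[OF inj_on_subset[OF inj B(1)[OF that]]] by (simp add: T_def)
  ultimately have "rainbow_pack c {1..n} (T ` {1..s})"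
    using sub by (auto simp: rainbow_pack_def)
  moreover have "card (T ` {1..s}) = s" using injT by (simp add: card_image)
  ultimately show ?thesis by blast
qed

lemma copy_of_pack:
  assumes "rainbow_pack c {1..n} \<T>" "card \<T> = s"
  shows "has_rainbow_copy (complete_graph n) c (disjoint_copies s (complete_graph 3))"
proof -
  let ?H = "disjoint_copies s (complete_graph 3)"
  have P: "\<And>T. T \<in> \<T> \<Longrightarrow> T \<subseteq> {1..n}" "\<And>T. T \<in> \<T> \<Longrightarrow> card T = 3" "pairwise disjnt \<T>"
    "inj_on c (\<Union>T\<in>\<T>. pairs T)"
    using assms(1) by (auto simp: rainbow_pack_def)
  have "\<T> \<subseteq> Pow {1..n}" using P(1) by blast
  then have "finite \<T>" by (rule finite_subset) simp
  then obtain h where h: "bij_betw h {1..s} \<T>" using ex_bij_betw_nat_finite_1 assms(2) by blast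
  have "\<exists>g. bij_betw g {1..3::nat} T" if "T \<in> \<T>" for T
  proof -
    have "finite T" using P(2)[OF that] by (simp add: card_ge_0_finite)
    then show ?thesis using ex_bij_betw_nat_finite_1[of T] P(2)[OF that] by simp
  qed
  then obtain \<phi> where \<phi>: "\<And>T. T \<in> \<T> \<Longrightarrow> bij_betw (\<phi> T) {1..3::nat} T" by metis
  define f where "f z = \<phi> (h (fst z)) (snd z)" for z
  have hT: "h i \<in> \<T>" if "i \<in> {1..s}" for i using h that by (auto simp: bij_betw_def)
  have im: "f ` (Pair i ` {1..3}) = h i" if "i \<in> {1..s}" for i
  proof -
    have "f ` (Pair i ` {1..3}) = \<phi> (h i) ` {1..3}" by (simp add: image_image f_def)
    then show ?thesis using \<phi>[OF hT[OF that]] by (simp add: bij_betw_def)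
  qed
  have inj: "inj_on f (vertices ?H)"
  proof (rule inj_onI)
    fix z w assume zw: "z \<in> vertices ?H" "w \<in> vertices ?H" "f z = f w"
    obtain i x j y where e: "z = (i, x)" "w = (j, y)" "i \<in> {1..s}" "j \<in> {1..s}" "x \<in> {1..3}" "y \<in> {1..3}"
      using zw(1,2) by (auto simp: vertices_copies)
    have "f z \<in> h i" using im[OF e(3)] e(1,5) by blast
    moreover have "f w \<in> h j" using im[OF e(4)] e(2,6) by blast
    ultimately have "\<not> disjnt (h i) (h j)" using zw(3) by (auto simp: disjnt_def)
    then have "h i = h j" using pairwiseD[OF P(3) hT[OF e(3)] hT[OF e(4)]] by blast
    then have ij: "i = j" using inj_onD[OF bij_betw_imp_inj_on[OF h]] e(3,4) by blast
    then have "\<phi> (h i) x = \<phi> (h i) y" using zw(3) e by (simp add: f_def)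
    then have "x = y" using inj_onD[OF bij_betw_imp_inj_on[OF \<phi>[OF hT[OF e(3)]]]] e(5,6) by blast
    then show "z = w" using ij e by simp
  qed
  have hU: "(\<Union>i\<in>{1..s}. h i) = \<Union>\<T>" "(\<Union>i\<in>{1..s}. pairs (h i)) = (\<Union>T\<in>\<T>. pairs T)"
    using h by (auto simp: bij_betw_def)
  have fv: "f ` vertices ?H = \<Union>\<T>"
    unfolding vertices_copies image_UN using im hU(1) by simp
  have "pairs (h i) = (\<lambda>e. f ` e) ` pairs (Pair i ` {1..3})" if "i \<in> {1..s}" for i
  proof -
    have "Pair i ` {1..3} \<subseteq> vertices ?H" using that by (auto simp: vertices_copies)
    then have "pairs (f ` (Pair i ` {1..3})) = (\<lambda>e. f ` e) ` pairs (Pair i ` {1..3})"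
      by (intro pairs_image inj_on_subset[OF inj])
    then show ?thesis using im[OF that] by simp
  qed
  then have fe: "(\<Union>T\<in>\<T>. pairs T) = (\<lambda>e. f ` e) ` edges ?H"
    unfolding hU(2)[symmetric] edges_copies image_UN by simp
  let ?G = "(\<Union>\<T>, \<Union>T\<in>\<T>. pairs T)"
  have "subgraph ?G (complete_graph n)"
    using P(1) pairs_mono by (fastforce simp: subgraph_def edges_complete_graph complete_graph_def pairs_def)
  moreover have "bij_betw f (vertices ?H) (vertices ?G)" using inj fv by (simp add: bij_betw_def)
  then have "graph_isomorphic ?H ?G" unfolding graph_isomorphic_def using fe by auto
  moreover have "rainbow c ?G" using P(4) by (simp add: rainbow_def)
  ultimately show ?thesis unfolding has_rainbow_copy_def by blast
qed

section \<open>The extremal number and its colouring\<close>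

definition extremal :: "nat \<Rightarrow> nat \<Rightarrow> nat" where
  "extremal n t = (t choose 2) + t * (n - t) + (n - t - (n - t) div 2) * ((n - t) div 2)"

lemma int_choose_2: "2 * int (n choose 2) = int n * (int n - 1)"
proof -
  have "even (n * (n - 1))" by (cases "even n") simp_all
  then have "2 * (n choose 2) = n * (n - 1)" by (simp add: choose_two)
  then have "2 * int (n choose 2) = int (n * (n - 1))" by (metis of_nat_mult of_nat_numeral)
  then show ?thesis by (cases n) (simp_all add: algebra_simps)
qed

lemma halves_prod: "(m - m div 2) * (m div 2) = m^2 div 4" for m :: nat
proof (cases "even m")
  case True
  then obtain q where "m = 2 * q" by blast
  then show ?thesis by (simp add: power2_eq_square)
next
  case False
  then obtain q where q: "m = 2 * q + 1" by (rule oddE)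
  have "m^2 = 1 + 4 * ((q + 1) * q)" by (simp add: q power2_eq_square algebra_simps)
  moreover have "(1 + 4 * ((q + 1) * q)) div 4 = (q + 1) * q" by (simp only: div_mult_self2)
  ultimately have "m^2 div 4 = (q + 1) * q" by (simp only:)
  moreover have "m div 2 = q" "m - m div 2 = q + 1" by (simp_all add: q)
  ultimately show ?thesis by (simp only:)
qed

lemma F2_extremal:
  assumes "t \<le> n"
  shows "2 * int (extremal n t) = F2 (int n) (int t)"
proof -
  have "int (extremal n t) = int (t choose 2) + int t * (int n - int t) + (int n - int t)^2 div 4"
    using assms unfolding extremal_def halves_prod by (simp add: of_nat_diff zdiv_int)
  then show ?thesis using int_choose_2[of t] by (simp add: F2_def algebra_simps)
qed

lemma card_pairs: "finite W \<Longrightarrow> card (pairs W) = card W choose 2"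
  unfolding pairs_def by (rule n_subsets)

text \<open>For the largest \<open>N\<close>, the edges inside \<open>B\<close> or \<open>C\<close>
  share one colour and all others have colours of their own. Of \<open>t + 2\<close> disjoint
  triangles at most \<open>t\<close> meet \<open>A\<close>, and each of two others has an edge
  inside \<open>B\<close> or \<open>C\<close>.\<close>

lemma extremal_colouring:
  assumes t: "t + 3 \<le> n" and N: "1 \<le> N" "N \<le> extremal n t + 1"
  shows "\<exists>c. edge_coloring_onto (complete_graph n) N c \<and>
     \<not> (\<exists>\<T>. rainbow_pack c {1..n} \<T> \<and> card \<T> = t + 2)"
proof -
  define b where "b = (n - t) div 2"
  define A where "A = {1..t}"
  define B where "B = {t + 1..t + b}"
  define C where "C = {t + b + 1..n}"
  define Y where "Y = pairs B \<union> pairs C"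
  define X where "X = pairs {1..n} - Y"
  have bn: "b \<ge> 1" "t + b + 2 \<le> n" using t by (auto simp: b_def)
  have ABC: "{1..n} = A \<union> B \<union> C" using bn by (auto simp: A_def B_def C_def)
  have BC: "B \<inter> C = {}" by (auto simp: B_def C_def)
  have Ysub: "Y \<subseteq> pairs {1..n}"
    unfolding Y_def using pairs_mono[of B "{1..n}"] pairs_mono[of C "{1..n}"] ABC by blast
  have finp: "finite (pairs {1..n})" by (rule pairs_finite) simp
  have "pairs B \<inter> pairs C = {}"
  proof (rule equals0I)
    fix e assume "e \<in> pairs B \<inter> pairs C"
    then have "e \<subseteq> B \<inter> C" "card e = 2" by (auto simp: pairs_def)
    then show False using BC by auto
  qed
  then have cY: "card Y = (b choose 2) + ((n - t - b) choose 2)"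
    unfolding Y_def using pairs_finite[of B] pairs_finite[of C] card_pairs[of B] card_pairs[of C]
    by (simp add: card_Un_disjoint B_def C_def)
  have "card X = card (pairs {1..n}) - card Y"
    unfolding X_def using Ysub finp finite_subset[OF Ysub finp] by (simp add: card_Diff_subset)
  moreover have "card Y \<le> card (pairs {1..n})" by (rule card_mono[OF finp Ysub])
  ultimately have "card X + card Y = n choose 2" using card_pairs[of "{1..n}"] by simp
  then have "2 * int (card X) + 2 * int (card Y) = int n * (int n - 1)"
    using int_choose_2[of n] by (metis distrib_left of_nat_add)
  moreover have "2 * int (card Y) = int b * (int b - 1) + int (n - t - b) * (int (n - t - b) - 1)"
    unfolding cY using int_choose_2[of b] int_choose_2[of "n - t - b"] by simp
  moreover have "2 * int (extremal n t) = int t * (int t - 1) + 2 * int t * int (n - t) + 2 * (int (n - t - b) * int b)"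
    unfolding extremal_def b_def[symmetric] using int_choose_2[of t] by simp
  moreover obtain c' where c': "n - t - b = c'" "n = t + b + c'" using bn by (metis add.assoc diff_diff_left le_add_diff_inverse le_trans le_add1)
  ultimately have "2 * int (extremal n t) = 2 * int (card X)"
    by (simp add: algebra_simps)
  then have cX: "card X = extremal n t" by simp
  have finX: "finite X" using finp by (simp add: X_def)
  obtain h where h: "bij_betw h X {1..card X}"
    using ex_bij_betw_nat_finite_1[OF finX] bij_betw_inv by blast
  \<comment> \<open>Colours above \<open>N\<close> are merged into \<open>N\<close>: since
    \<open>ar\<close> is a least number, every smaller \<open>N\<close> needs a colouring
    too.\<close>
  define c where "c e = min N (if e \<in> X then h e else card X + 1)" for e
  have YX: "e \<in> pairs {1..n}" "e \<notin> X" if "e \<in> Y" for e using that Ysub by (auto simp: X_def)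
  have cYN: "c e = N" if "e \<in> Y" for e
    using YX(2)[OF that] N(2) cX by (simp add: c_def)
  have onto: "c ` pairs {1..n} = {1..N}"
  proof
    show "c ` pairs {1..n} \<subseteq> {1..N}"
    proof
      fix k assume "k \<in> c ` pairs {1..n}"
      then obtain e where e: "k = c e" by blast
      have "h e \<ge> 1" if "e \<in> X" using h that by (auto simp: bij_betw_def)
      then show "k \<in> {1..N}" using N(1) by (auto simp: e c_def)
    qed
    show "{1..N} \<subseteq> c ` pairs {1..n}"
    proof
      fix k assume k: "k \<in> {1..N}"
      show "k \<in> c ` pairs {1..n}"
      proof (cases "k \<le> card X")
        case True
        then have "k \<in> h ` X" using h k by (auto simp: bij_betw_def)
        then obtain e where "e \<in> X" "h e = k" by blast
        then have "c e = k" "e \<in> pairs {1..n}" using k by (auto simp: c_def X_def)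
        then show ?thesis by blast
      next
        case False
        then have "k = N" using k N(2) cX by simp
        \<comment> \<open>\<open>C\<close> has at least two elements, so the common colour does
          occur.\<close>
        have "{t + b + 1, t + b + 2} \<in> Y" using bn by (simp add: Y_def pairs_doubleton C_def)
        then show ?thesis using cYN YX(1) \<open>k = N\<close> by blast
      qed
    qed
  qed
  have "\<not> rainbow_pack c {1..n} \<T>" if card: "card \<T> = t + 2" for \<T>
  proof
    assume rp: "rainbow_pack c {1..n} \<T>"
    let ?TA = "{T \<in> \<T>. T \<inter> A \<noteq> {}}"
    have fin: "finite \<T>" using card by (simp add: card_ge_0_finite)
    have "pairwise disjnt ?TA"
      by (rule pairwise_subset[of _ \<T>]) (use rp in \<open>auto simp: rainbow_pack_def\<close>)
    then have "card ?TA \<le> card A" by (intro card_meeting_le) (auto simp: A_def)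
    then have "card ?TA \<le> t" by (simp add: A_def)
    moreover have "card (\<T> - ?TA) = card \<T> - card ?TA" using fin by (intro card_Diff_subset) auto
    ultimately have "card (\<T> - ?TA) \<ge> 2" using card by simp
    then obtain F where "F \<subseteq> \<T> - ?TA" "card F = 2" by (rule obtain_subset_with_card_n)
    then obtain T1 T2 where T: "T1 \<in> \<T> - ?TA" "T2 \<in> \<T> - ?TA" "T1 \<noteq> T2"
      by (auto simp: card_2_iff)
    have mono: "\<exists>e. e \<in> pairs T \<and> e \<in> Y" if T: "T \<in> \<T> - ?TA" for T
    proof -
      have "T \<subseteq> {1..n}" "T \<inter> A = {}" "card T = 3" using T rp by (auto simp: rainbow_pack_def)
      then have TBC: "T \<subseteq> B \<union> C" using ABC by blast
      obtain x y z where xyz: "T = {x, y, z}" "x \<noteq> y" "y \<noteq> z" "x \<noteq> z"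
        using \<open>card T = 3\<close> by (auto simp: card_3_iff)
      have "{x, y} \<in> Y \<or> {y, z} \<in> Y \<or> {x, z} \<in> Y"
        using TBC xyz by (auto simp: Y_def pairs_doubleton)
      then show ?thesis unfolding xyz(1) pairs_triple[OF xyz(2-4)] by blast
    qed
    obtain e1 where e1: "e1 \<in> pairs T1" "e1 \<in> Y" using mono[OF T(1)] by blast
    obtain e2 where e2: "e2 \<in> pairs T2" "e2 \<in> Y" using mono[OF T(2)] by blast
    have "disjnt T1 T2" using rp T by (auto simp: rainbow_pack_def pairwise_def)
    moreover have "e1 \<subseteq> T1" "e2 \<subseteq> T2" "e1 \<noteq> {}" using e1(1) e2(1) by (auto simp: pairs_def)
    ultimately have "e1 \<noteq> e2" by (auto simp: disjnt_def)
    moreover have "e1 \<in> (\<Union>T\<in>\<T>. pairs T)" "e2 \<in> (\<Union>T\<in>\<T>. pairs T)" using e1(1) e2(1) T by blast+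
    moreover have "c e1 = c e2" using cYN e1(2) e2(2) by simp
    moreover have "inj_on c (\<Union>T\<in>\<T>. pairs T)" using rp by (simp add: rainbow_pack_def)
    ultimately show False by (auto dest: inj_onD)
  qed
  then show ?thesis
    using onto unfolding edge_coloring_onto_def edges_complete_graph by blast
qed

lemma ar_value:
  assumes n: "n \<ge> 20000000" "2 * n \<ge> 9 * t + 24"
  shows "ar n (disjoint_copies (t + 2) (complete_graph 3)) = extremal n t + 2"
  unfolding ar_def
proof (rule Least_equality)
  show "extremal n t + 2 \<ge> 1 \<and> (\<forall>c. edge_coloring_onto (complete_graph n) (extremal n t + 2) c \<longrightarrow>
      has_rainbow_copy (complete_graph n) c (disjoint_copies (t + 2) (complete_graph 3)))"
  proof (intro conjI allI impI)
    fix c assume "edge_coloring_onto (complete_graph n) (extremal n t + 2) c"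
    then have "card (c ` pairs {1..n}) = extremal n t + 2"
      by (simp add: edge_coloring_onto_def edges_complete_graph)
    then have "2 * int (card (c ` pairs {1..n})) \<ge> F2 (int (card {1..n})) (int t) + 4"
      using F2_extremal[of t n] n by simp
    then have "\<exists>\<T>. rainbow_pack c {1..n} \<T> \<and> card \<T> = t + 2"
      using n by (intro upper_bound) simp_all
    then show "has_rainbow_copy (complete_graph n) c (disjoint_copies (t + 2) (complete_graph 3))"
      using copy_of_pack by blast
  qed simp
next
  fix N assume N: "N \<ge> 1 \<and> (\<forall>c. edge_coloring_onto (complete_graph n) N c \<longrightarrow>
      has_rainbow_copy (complete_graph n) c (disjoint_copies (t + 2) (complete_graph 3)))"
  show "extremal n t + 2 \<le> N"
  proof (rule ccontr)
    assume "\<not> ?thesis"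
    then have "N \<le> extremal n t + 1" by simp
    moreover have "t + 3 \<le> n" using n by linarith
    ultimately obtain c where "edge_coloring_onto (complete_graph n) N c"
      "\<not> (\<exists>\<T>. rainbow_pack c {1..n} \<T> \<and> card \<T> = t + 2)"
      using extremal_colouring[of t n N] N by blast
    then show False using N pack_of_copy by blast
  qed
qed

theorem theorem1p4:
  "\<exists>N0::nat. \<forall>n\<ge>N0. \<forall>t::nat. t \<ge> 1 \<longrightarrow> real t \<le> 1 / 9 * (2 * real n - 6) - 2 \<longrightarrow>
     int (ar n (disjoint_copies (t + 2) (complete_graph 3))) =
       int (t choose 2) + int t * (int n - int t)
       + \<lceil>(real n - real t) / 2\<rceil> * \<lfloor>(real n - real t) / 2\<rfloor> + 2"
proof (intro exI[of _ 20000000] allI impI)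
  fix n t :: nat
  assume n: "n \<ge> 20000000" and t: "t \<ge> 1" "real t \<le> 1 / 9 * (2 * real n - 6) - 2"
  have "9 * real t + 24 \<le> 2 * real n" using t(2) by (simp add: field_simps)
  then have n2: "9 * t + 24 \<le> 2 * n" by linarith
  then have tn: "t \<le> n" by simp
  define m where "m = n - t"
  have mr: "real n - real t = real m" using tn by (simp add: m_def)
  have fl: "\<lfloor>real m / 2\<rfloor> = int (m div 2)"
    using floor_divide_of_nat_eq[of m 2] by simp
  have ce: "\<lceil>real m / 2\<rceil> = int (m - m div 2)"
    by (rule ceiling_unique) linarith+
  have "int (ar n (disjoint_copies (t + 2) (complete_graph 3))) = int (extremal n t + 2)"
    using ar_value[OF n n2] by simp
  also have "\<dots> = int (t choose 2) + int t * int m + int (m - m div 2) * int (m div 2) + 2"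
    unfolding extremal_def m_def[symmetric] by simp
  finally show "int (ar n (disjoint_copies (t + 2) (complete_graph 3))) =
       int (t choose 2) + int t * (int n - int t)
       + \<lceil>(real n - real t) / 2\<rceil> * \<lfloor>(real n - real t) / 2\<rfloor> + 2"
    unfolding mr fl ce using tn by (simp add: m_def of_nat_diff)
qed

end
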